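(* Assume that $G(o,o|z)=\sum_{n\ge0}\mathbb{P}[X_n=o]z^n$ has radius of convergence strictly bigger than $1$. Let $\mathcal{R}>1$ be a real number with $\sup_{k\in\mathbb{N}}\mathbb{E}\bigl[\mathcal{R}^{\mathrm{length}(\psi_k)}\bigr]<\infty$, and let $f:\Pi\to\mathbb{R}$ be a cone-additive function for which there exist $C\in(0,\infty)$ and $R_f\in(0,\mathcal{R})$ with $|f(\pi)|\le C\cdot R_f^{\mathrm{length}(\pi)}$ for all $\pi\in\Pi$. Then the almost sure constant limit $\mathfrak{c}=\lim_{n\to\infty}\frac1n f([X_0,\ldots,X_n])$ is given by $$\mathfrak{c}=\frac{\mathbb{E}_\varrho\bigl[f\bigl(\psi_1|_{\neg C(\mathbf{W}_1)}\bigr)\bigr]}{\mathbb{E}_\sigma[\mathbf{e}_2-\mathbf{e}_1]}=\ell\cdot\mathbb{E}_\varrho\bigl[f\bigl(\psi_1|_{\neg C(\mathbf{W}_1)}\bigr)\bigr].$$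
   Context: Notation: $\mathbb{N}=\{1,2,\dots\}$, $\mathbb{N}_0=\mathbb{N}\cup\{0\}$. Free product. Let $V_1,V_2$ be disjoint finite or countable sets with $|V_i|\ge 2$, not both of cardinality $2$, with distinguished elements (roots) $o_i\in V_i$; put $V_i^\times=V_i\setminus\{o_i\}$. For $i\in\{1,2\}$ let $P_i=(p_i(x,y))_{x,y\in V_i}$ be a transition matrix on $V_i$ with $p_i(x,x)=0$ for all $x\in V_i$ and such that for every $x\in V_i$ there is $n_x\in\mathbb{N}$ with $p_i^{(n_x)}(o_i,x)>0$ ($p_i^{(n)}$ denotes $n$-step transition probabilities). The free product $V=V_1*V_2$ is the set of all finite words $v_1\dots v_n$, $n\in\mathbb{N}$, with letters in $V_1^\times\cup V_2^\times$ such that no two consecutive letters lie in the same $V_i^\times$, together with the empty word $o$; both $o_1,o_2$ are identified with $o$, so $V_i\subset V$. Word length: $\|v_1\dots v_n\|=n$, $\|o\|=0$. Type: $\delta(v_1\dots v_n)=i$ if $v_n\in V_i^\times$ ($o$ has no type). Words are concatenated whenever the result lies in $V$, with $uo=ou=u$. Random walk. Fix $\alpha\in(0,1)$. Put $\bar p_i(uv,uw)=p_i(v,w)$ for $u\in V$ with $\delta(u)\ne i$ ($u=o$ allowed) and $v,w\in V_i$, and $\bar p_i(x,y)=0$ otherwise. Let $P=\alpha\bar P_1+(1-\alpha)\bar P_2=(p(x,y))_{x,y\in V}$, and let $(X_n)_{n\in\mathbb{N}_0}$ be the Markov chain on $V$ with transition matrix $P$ and $X_0=o$. Let $\mathcal{X}$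 be the directed graph on $V$ with an edge from $x$ to $y$ iff $p(x,y)>0$. A path is a finite sequence $[v_0,\dots,v_n]$, $n\in\mathbb{N}_0$, with an edge from $v_{i-1}$ to $v_i$ for each $i$; its length is $n$. $\Pi$ is the set of all finite paths. The cone $C(x)$ is the set of all words in $V$ with prefix $x$; $C(o)=V$. If $G(o,o|z)$ has radius of convergence $>1$, the walk is transient and $\|X_n\|\to\infty$ almost surely. Restrictions. For a path $\pi=[u_0,\dots,u_m]$ and $A\subseteq V$ containing some $u_\ell$, let $\pi|_A=[x_0,\dots,x_\kappa]$, where $x_0=u_{i_0}$ with $i_0=\inf\{\ell: u_\ell\in A\}$ and $x_j=u_{i_j}$ with $i_j=\inf\{\ell>i_{j-1}: u_\ell\in A\setminus\{x_{j-1}\}\}$, as long as such an index exists (delete vertices outside $A$, then collapse successive repetitions). For $v\in V$, $\pi|_{C(v)}$ is this with $A=C(v)$, and $\pi|_{\neg C(v)}$ is this with $A=V\setminus(C(v)\setminus\{v\})$. If all vertices of $\pi=[vw_0,\dots,vw_m]$ lie in $C(v)$, then $v^{-1}\pi=[w_0,\dots,w_m]$. Final cone entry times. $\mathbf{e}_0=0$ and, for $k\in\mathbb{N}$, $\mathbf{e}_k=\inf\{\ell\in\mathbb{N}: \|X_\ell\|=k,\ X_i\in C(X_\ell)\text{ for all } i\ge\ell\}$ (almost surely finite). $\mathbf{k}(n)=\max\{k\in\mathbb{N}_0:\mathbf{e}_k\le n\}$. For $k\in\mathbb{N}$, $\pi_k=\bigl([X_0,\dots,X_{\mathbf{e}_k}]|_{C(X_{\mathbf{e}_{k-1}})}\bigr)\big|_{\neg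 C(X_{\mathbf{e}_k})}$, and $\pi_n^\ast=[X_0,\dots,X_n]|_{C(X_{\mathbf{e}_{\mathbf{k}(n)}})}$ for $n\in\mathbb{N}$. Cone-additivity. $f:\Pi\to\mathbb{R}$ is cone-additive (w.r.t. $P$) if (i) for all $n\in\mathbb{N}$, $f([X_0,\dots,X_n])=\sum_{j=1}^{\mathbf{k}(n)}f(\pi_j)+f(\pi_n^\ast)$ almost surely; and (ii) for all $j\in\mathbb{N}$, $f(\pi_j)=f(X_{\mathbf{e}_{j-1}}^{-1}\pi_j)$. The process $(\mathbf{W}_k,\psi_k)$. $\mathbf{W}_k$ is the last letter of $X_{\mathbf{e}_k}$. For $i\in\{1,2\}$ let $V_i^\ast$ be the set of words in $V$ starting with a letter of $V_i^\times$, together with $o$. Put $\psi_1=[X_0,\dots,X_{\mathbf{e}_1}]|_{V^\ast_{\delta(X_{\mathbf{e}_1})}}$ and, for $k\ge2$, $\psi_k=X_{\mathbf{e}_{k-1}}^{-1}\bigl([X_0,\dots,X_{\mathbf{e}_k}]|_{C(X_{\mathbf{e}_{k-1}})}\bigr)$. Let $\mathcal{D}=\mathrm{supp}((\mathbf{W}_1,\psi_1))$. The process $((\mathbf{W}_k,\psi_k))_{k\in\mathbb{N}}$ is a homogeneous, irreducible, positive-recurrent Markov chain on $\mathcal{D}$; $\varrho$ is its unique invariant probability measure, and $\mathbb{E}_\varrho[f(\psi_1|_{\neg C(\mathbf{W}_1)})]=\sum_{(g,\varphi)\in\mathcal{D}}\varrho(g,\varphi)f(\varphi|_{\neg C(g)})$.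 It is known that $((\mathbf{W}_k,\mathbf{e}_k-\mathbf{e}_{k-1}))_{k\in\mathbb{N}}$ is a homogeneous, irreducible, positive-recurrent Markov chain on some $\mathcal{D}_0\subseteq(V_1^\times\cup V_2^\times)\times\mathbb{N}$; $\sigma$ is its invariant distribution, and $\mathbb{E}_\sigma[\mathbf{e}_2-\mathbf{e}_1]=\sum_{(g,n)\in\mathcal{D}_0}n\,\sigma(g,n)<\infty$. $\ell=\lim_{n\to\infty}\|X_n\|/n$ is the almost sure rate of escape w.r.t. word length (which exists as a constant in $(0,\infty)$). *)

theory Defs
  imports "HOL-Probability.Probability"
begin

section \<open>Free products of two rooted sets\<close>

text \<open>
  The two factors are indexed by \<open>i \<in> {1, 2}\<close>: \<open>V i\<close> is the vertex set of the \<open>i\<close>-th factor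
  and \<open>rt i\<close> its root.  Elements of the free product are words over the non-root letters,
  that is, lists; the empty word \<open>o\<close> is the empty list.
\<close>

definition nonroot :: "(nat \<Rightarrow> 'a set) \<Rightarrow> (nat \<Rightarrow> 'a) \<Rightarrow> nat \<Rightarrow> 'a set" where
  "nonroot V rt i = V i - {rt i}"

definition fp_words :: "(nat \<Rightarrow> 'a set) \<Rightarrow> (nat \<Rightarrow> 'a) \<Rightarrow> 'a list set" where
  "fp_words V rt =
     {w. set w \<subseteq> nonroot V rt 1 \<union> nonroot V rt 2 \<and>
         successively (\<lambda>a b. \<not> (\<exists>i\<in>{1, 2}. a \<in> nonroot V rt i \<and> b \<in> nonroot V rt i)) w}"

definition word_type :: "(nat \<Rightarrow> 'a set) \<Rightarrow> (nat \<Rightarrow> 'a) \<Rightarrow> 'a list \<Rightarrow> nat option" where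
  "word_type V rt w =
     (if w \<noteq> [] \<and> last w \<in> nonroot V rt 1 then Some 1
      else if w \<noteq> [] \<and> last w \<in> nonroot V rt 2 then Some 2
      else None)"

text \<open>The embedding of \<open>V i\<close> into the free product, which identifies \<open>rt i\<close> with the empty word.\<close>

definition emb :: "(nat \<Rightarrow> 'a) \<Rightarrow> nat \<Rightarrow> 'a \<Rightarrow> 'a list" where
  "emb rt i v = (if v = rt i then [] else [v])"

definition cone :: "(nat \<Rightarrow> 'a set) \<Rightarrow> (nat \<Rightarrow> 'a) \<Rightarrow> 'a list \<Rightarrow> 'a list set" where
  "cone V rt x = {w \<in> fp_words V rt. \<exists>u. w = x @ u}"

text \<open>The words whose first letter lies in the \<open>i\<close>-th factor, together with the empty word.\<close>

definition vstar :: "(nat \<Rightarrow> 'a set) \<Rightarrow> (nat \<Rightarrow> 'a) \<Rightarrow> nat \<Rightarrow> 'a list set" where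
  "vstar V rt i = {w \<in> fp_words V rt. w = [] \<or> hd w \<in> nonroot V rt i}"


section \<open>Transition probabilities\<close>

definition transition_matrix :: "'s set \<Rightarrow> ('s \<Rightarrow> 's \<Rightarrow> real) \<Rightarrow> bool" where
  "transition_matrix S q \<longleftrightarrow>
     (\<forall>x\<in>S. (\<forall>y\<in>S. q x y \<ge> 0) \<and> (q x has_sum 1) S)"

fun nstep :: "'s set \<Rightarrow> ('s \<Rightarrow> 's \<Rightarrow> real) \<Rightarrow> nat \<Rightarrow> 's \<Rightarrow> 's \<Rightarrow> real" where
  "nstep S q 0 x y = (if x = y then 1 else 0)"
| "nstep S q (Suc n) x y = (\<Sum>\<^sub>\<infinity>z\<in>S. q x z * nstep S q n z y)"

definition free_product_data ::
  "(nat \<Rightarrow> 'a set) \<Rightarrow> (nat \<Rightarrow> 'a) \<Rightarrow> (nat \<Rightarrow> 'a \<Rightarrow> 'a \<Rightarrow> real) \<Rightarrow> real \<Rightarrow> bool" where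
  "free_product_data V rt p \<alpha> \<longleftrightarrow>
     V 1 \<inter> V 2 = {} \<and>
     (\<forall>i\<in>{1, 2}. countable (V i) \<and> (finite (V i) \<longrightarrow> card (V i) \<ge> 2) \<and> rt i \<in> V i) \<and>
     \<not> (card (V 1) = 2 \<and> card (V 2) = 2) \<and>
     (\<forall>i\<in>{1, 2}. transition_matrix (V i) (p i) \<and>
        (\<forall>x\<in>V i. p i x x = 0) \<and>
        (\<forall>x\<in>V i. \<exists>n\<ge>1. nstep (V i) (p i) n (rt i) x > 0)) \<and>
     0 < \<alpha> \<and> \<alpha> < 1"

text \<open>
  \<open>lifted_pair V rt i x y v w\<close>: there is a word \<open>u\<close> not of type \<open>i\<close> such that \<open>x = uv\<close> and
  \<open>y = uw\<close> with \<open>v, w\<close> in the \<open>i\<close>-th factor.  The pair \<open>(v, w)\<close> is then unique, see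
  \<open>lifted_pair_unique\<close> below, so that the description in \<open>lift_prob\<close> is proper.
\<close>

definition lifted_pair ::
  "(nat \<Rightarrow> 'a set) \<Rightarrow> (nat \<Rightarrow> 'a) \<Rightarrow> nat \<Rightarrow> 'a list \<Rightarrow> 'a list \<Rightarrow> 'a \<Rightarrow> 'a \<Rightarrow> bool" where
  "lifted_pair V rt i x y v w \<longleftrightarrow>
     v \<in> V i \<and> w \<in> V i \<and>
     (\<exists>u\<in>fp_words V rt. word_type V rt u \<noteq> Some i \<and>
        x = u @ emb rt i v \<and> y = u @ emb rt i w)"

definition lift_prob ::
  "(nat \<Rightarrow> 'a set) \<Rightarrow> (nat \<Rightarrow> 'a) \<Rightarrow> (nat \<Rightarrow> 'a \<Rightarrow> 'a \<Rightarrow> real) \<Rightarrow> nat \<Rightarrow> 'a list \<Rightarrow> 'a list \<Rightarrow> real"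
  where
  "lift_prob V rt p i x y =
     (if \<exists>v w. lifted_pair V rt i x y v w
      then (THE r. \<exists>v w. lifted_pair V rt i x y v w \<and> r = p i v w)
      else 0)"

definition fp_prob ::
  "(nat \<Rightarrow> 'a set) \<Rightarrow> (nat \<Rightarrow> 'a) \<Rightarrow> (nat \<Rightarrow> 'a \<Rightarrow> 'a \<Rightarrow> real) \<Rightarrow> real \<Rightarrow> 'a list \<Rightarrow> 'a list \<Rightarrow> real"
  where
  "fp_prob V rt p \<alpha> x y = \<alpha> * lift_prob V rt p 1 x y + (1 - \<alpha>) * lift_prob V rt p 2 x y"

lemma emb_unique:
  assumes "V 1 \<inter> V 2 = {}" "i \<in> {1, 2}" "v \<in> V i" "v' \<in> V i"
    and "word_type V rt u \<noteq> Some i" "word_type V rt u' \<noteq> Some i"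
    and "u @ emb rt i v = u' @ emb rt i v'"
  shows "u = u' \<and> v = v'"
  using assms
  by (auto simp: emb_def word_type_def nonroot_def split: if_splits)

lemma lifted_pair_unique:
  assumes "V 1 \<inter> V 2 = {}" "i \<in> {1, 2}"
    and "lifted_pair V rt i x y v w" "lifted_pair V rt i x y v' w'"
  shows "v = v' \<and> w = w'"
proof -
  obtain u where u: "word_type V rt u \<noteq> Some i" "x = u @ emb rt i v" "y = u @ emb rt i w"
    and vw: "v \<in> V i" "w \<in> V i"
    using assms(3) by (auto simp: lifted_pair_def)
  obtain u' where u': "word_type V rt u' \<noteq> Some i" "x = u' @ emb rt i v'" "y = u' @ emb rt i w'"
    and vw': "v' \<in> V i" "w' \<in> V i"
    using assms(4) by (auto simp: lifted_pair_def)
  show ?thesis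
    using emb_unique[OF assms(1,2) vw(1) vw'(1) u(1) u'(1)]
      emb_unique[OF assms(1,2) vw(2) vw'(2) u(1) u'(1)] u u' by simp
qed

lemma lift_prob_append:
  assumes "V 1 \<inter> V 2 = {}" "i \<in> {1, 2}" "u \<in> fp_words V rt" "word_type V rt u \<noteq> Some i"
    and "v \<in> V i" "w \<in> V i"
  shows "lift_prob V rt p i (u @ emb rt i v) (u @ emb rt i w) = p i v w"
proof -
  have l: "lifted_pair V rt i (u @ emb rt i v) (u @ emb rt i w) v w"
    using assms by (auto simp: lifted_pair_def)
  have "(THE r. \<exists>v' w'. lifted_pair V rt i (u @ emb rt i v) (u @ emb rt i w) v' w' \<and> r = p i v' w')
        = p i v w"
    by (rule the_equality) (use l lifted_pair_unique[OF assms(1,2) l] in auto)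
  then show ?thesis using l by (auto simp: lift_prob_def)
qed


section \<open>Paths and restrictions\<close>

definition fp_paths ::
  "(nat \<Rightarrow> 'a set) \<Rightarrow> (nat \<Rightarrow> 'a) \<Rightarrow> (nat \<Rightarrow> 'a \<Rightarrow> 'a \<Rightarrow> real) \<Rightarrow> real \<Rightarrow> 'a list list set" where
  "fp_paths V rt p \<alpha> =
     {\<pi>. \<pi> \<noteq> [] \<and> set \<pi> \<subseteq> fp_words V rt \<and> successively (\<lambda>x y. fp_prob V rt p \<alpha> x y > 0) \<pi>}"

text \<open>The length of a path is its number of edges.\<close>

definition path_length :: "'v list \<Rightarrow> nat" where
  "path_length \<pi> = length \<pi> - 1"

definition restrict_path :: "'v list \<Rightarrow> 'v set \<Rightarrow> 'v list" where
  "restrict_path \<pi> A = remdups_adj (filter (\<lambda>v. v \<in> A) \<pi>)"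

definition noncone :: "(nat \<Rightarrow> 'a set) \<Rightarrow> (nat \<Rightarrow> 'a) \<Rightarrow> 'a list \<Rightarrow> 'a list set" where
  "noncone V rt v = fp_words V rt - (cone V rt v - {v})"

text \<open>\<open>unshift v \<pi>\<close> is \<open>v\<^sup>-\<^sup>1\<pi>\<close>; it is meant for paths all of whose vertices have prefix \<open>v\<close>.\<close>

definition unshift :: "'a list \<Rightarrow> 'a list list \<Rightarrow> 'a list list" where
  "unshift v \<pi> = map (drop (length v)) \<pi>"

definition initial_path :: "(nat \<Rightarrow> 'v) \<Rightarrow> nat \<Rightarrow> 'v list" where
  "initial_path x n = map x [0..<Suc n]"


section \<open>Final cone entry times and derived processes\<close>

text \<open>
  All notions in this section are functions of a single trajectory \<open>x\<close>.  On trajectories for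
  which some final cone entry time is infinite (under transience, a null event) the values are
  irrelevant; in particular \<open>Inf {}\<close> and \<open>Max\<close> of an infinite set are not meant to be used.
\<close>

definition entry_time :: "(nat \<Rightarrow> 'a set) \<Rightarrow> (nat \<Rightarrow> 'a) \<Rightarrow> (nat \<Rightarrow> 'a list) \<Rightarrow> nat \<Rightarrow> nat" where
  "entry_time V rt x k =
     (if k = 0 then 0
      else Inf {l. l \<ge> 1 \<and> length (x l) = k \<and> (\<forall>i\<ge>l. x i \<in> cone V rt (x l))})"

definition last_entry :: "(nat \<Rightarrow> 'a set) \<Rightarrow> (nat \<Rightarrow> 'a) \<Rightarrow> (nat \<Rightarrow> 'a list) \<Rightarrow> nat \<Rightarrow> nat" where
  "last_entry V rt x n = Max {k. entry_time V rt x k \<le> n}"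

definition entry_point ::
  "(nat \<Rightarrow> 'a set) \<Rightarrow> (nat \<Rightarrow> 'a) \<Rightarrow> (nat \<Rightarrow> 'a list) \<Rightarrow> nat \<Rightarrow> 'a list" where
  "entry_point V rt x k = x (entry_time V rt x k)"

definition segment ::
  "(nat \<Rightarrow> 'a set) \<Rightarrow> (nat \<Rightarrow> 'a) \<Rightarrow> (nat \<Rightarrow> 'a list) \<Rightarrow> nat \<Rightarrow> 'a list list" where
  "segment V rt x k =
     restrict_path
       (restrict_path (initial_path x (entry_time V rt x k)) (cone V rt (entry_point V rt x (k - 1))))
       (noncone V rt (entry_point V rt x k))"

definition final_segment ::
  "(nat \<Rightarrow> 'a set) \<Rightarrow> (nat \<Rightarrow> 'a) \<Rightarrow> (nat \<Rightarrow> 'a list) \<Rightarrow> nat \<Rightarrow> 'a list list" where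
  "final_segment V rt x n =
     restrict_path (initial_path x n) (cone V rt (entry_point V rt x (last_entry V rt x n)))"

definition last_letter ::
  "(nat \<Rightarrow> 'a set) \<Rightarrow> (nat \<Rightarrow> 'a) \<Rightarrow> (nat \<Rightarrow> 'a list) \<Rightarrow> nat \<Rightarrow> 'a" where
  "last_letter V rt x k = last (entry_point V rt x k)"

definition psi ::
  "(nat \<Rightarrow> 'a set) \<Rightarrow> (nat \<Rightarrow> 'a) \<Rightarrow> (nat \<Rightarrow> 'a list) \<Rightarrow> nat \<Rightarrow> 'a list list" where
  "psi V rt x k =
     (if k = 1
      then restrict_path (initial_path x (entry_time V rt x 1))
             (vstar V rt (the (word_type V rt (entry_point V rt x 1))))
      else unshift (entry_point V rt x (k - 1))
             (restrict_path (initial_path x (entry_time V rt x k))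
                (cone V rt (entry_point V rt x (k - 1)))))"


section \<open>Random walks and cone-additive functions\<close>

definition markov_chain_from ::
  "'w measure \<Rightarrow> 's set \<Rightarrow> ('s \<Rightarrow> 's \<Rightarrow> real) \<Rightarrow> 's \<Rightarrow> (nat \<Rightarrow> 'w \<Rightarrow> 's) \<Rightarrow> bool" where
  "markov_chain_from M S q s X \<longleftrightarrow>
     (\<forall>n. X n \<in> measurable M (count_space S)) \<and>
     (AE \<omega> in M. X 0 \<omega> = s) \<and>
     (\<forall>n h. \<forall>y\<in>S. \<P>(\<omega> in M. \<forall>i\<le>n. X i \<omega> = h i) > 0 \<longrightarrow>
        \<P>(\<omega> in M. X (Suc n) \<omega> = y \<bar> \<forall>i\<le>n. X i \<omega> = h i) = q (h n) y)"

definition cone_additive ::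
  "(nat \<Rightarrow> 'a set) \<Rightarrow> (nat \<Rightarrow> 'a) \<Rightarrow> 'w measure \<Rightarrow> (nat \<Rightarrow> 'w \<Rightarrow> 'a list) \<Rightarrow>
   ('a list list \<Rightarrow> real) \<Rightarrow> bool" where
  "cone_additive V rt M X f \<longleftrightarrow>
     (\<forall>n\<ge>1. AE \<omega> in M. let x = (\<lambda>m. X m \<omega>) in
        f (initial_path x n) =
          (\<Sum>j = 1..last_entry V rt x n. f (segment V rt x j)) + f (final_segment V rt x n)) \<and>
     (\<forall>j\<ge>1. AE \<omega> in M. let x = (\<lambda>m. X m \<omega>) in
        f (segment V rt x j) = f (unshift (entry_point V rt x (j - 1)) (segment V rt x j)))"


section \<open>Invariant distributions of processes indexed by the positive integers\<close>

definition states_at :: "'w measure \<Rightarrow> (nat \<Rightarrow> 'w \<Rightarrow> 's) \<Rightarrow> nat \<Rightarrow> 's set" where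
  "states_at M Y k = {s. \<P>(\<omega> in M. Y k \<omega> = s) > 0}"

text \<open>
  The one-step transition probability of a homogeneous Markov chain \<open>Y 1, Y 2, \<dots>\<close> on states
  that are attained with positive probability.  By homogeneity any time \<open>k\<close> at which \<open>s\<close> is
  attained gives the same value; the first one is taken.
\<close>

definition step_prob :: "'w measure \<Rightarrow> (nat \<Rightarrow> 'w \<Rightarrow> 's) \<Rightarrow> 's \<Rightarrow> 's \<Rightarrow> real" where
  "step_prob M Y s t =
     (let k = (LEAST k. k \<ge> 1 \<and> s \<in> states_at M Y k)
      in \<P>(\<omega> in M. Y (Suc k) \<omega> = t \<bar> Y k \<omega> = s))"

definition invariant_distribution ::
  "'w measure \<Rightarrow> (nat \<Rightarrow> 'w \<Rightarrow> 's) \<Rightarrow> 's set \<Rightarrow> 's pmf \<Rightarrow> bool" where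
  "invariant_distribution M Y D \<mu> \<longleftrightarrow>
     set_pmf \<mu> \<subseteq> D \<and>
     (\<forall>t\<in>D. ((\<lambda>s. pmf \<mu> s * step_prob M Y s t) has_sum pmf \<mu> t) D)"

definition WPsi ::
  "(nat \<Rightarrow> 'a set) \<Rightarrow> (nat \<Rightarrow> 'a) \<Rightarrow> (nat \<Rightarrow> 'w \<Rightarrow> 'a list) \<Rightarrow> nat \<Rightarrow> 'w \<Rightarrow> 'a \<times> 'a list list" where
  "WPsi V rt X k \<omega> = (let x = (\<lambda>m. X m \<omega>) in (last_letter V rt x k, psi V rt x k))"

definition WInc ::
  "(nat \<Rightarrow> 'a set) \<Rightarrow> (nat \<Rightarrow> 'a) \<Rightarrow> (nat \<Rightarrow> 'w \<Rightarrow> 'a list) \<Rightarrow> nat \<Rightarrow> 'w \<Rightarrow> 'a \<times> nat" where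
  "WInc V rt X k \<omega> = (let x = (\<lambda>m. X m \<omega>) in
     (last_letter V rt x k, entry_time V rt x k - entry_time V rt x (k - 1)))"

end

theory Submission
  imports Defs
begin

section \<open>Restricting paths to vertex sets\<close>

lemma remdups_adj_filter_remdups_adj:
  "remdups_adj (filter Q (remdups_adj xs)) = remdups_adj (filter Q xs)"
proof (induction xs rule: remdups_adj.induct)
  case (3 x y xs)
  show ?case
  proof (cases "x = y")
    case True
    then show ?thesis using 3 by simp
  next
    case False
    show ?thesis
    proof (cases "Q x")
      case True
      let ?f = "filter Q (remdups_adj (y # xs))" and ?g = "filter Q (y # xs)"
      have IH: "remdups_adj ?f = remdups_adj ?g" using 3 False by simp
      have "remdups_adj (x # ?f) = remdups_adj (x # ?g)"
        using IH by (simp add: remdups_adj_Cons)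
      then show ?thesis using False True by simp
    qed (use 3 False in simp)
  qed
qed auto

lemma restrict_path_restrict_path:
  "B \<subseteq> A \<Longrightarrow> restrict_path (restrict_path \<pi> A) B = restrict_path \<pi> B"
proof -
  assume "B \<subseteq> A"
  then have "filter (\<lambda>v. v \<in> B) (filter (\<lambda>v. v \<in> A) \<pi>) = filter (\<lambda>v. v \<in> B) \<pi>"
    by (auto intro: filter_cong)
  then show ?thesis by (simp add: restrict_path_def remdups_adj_filter_remdups_adj)
qed

lemma set_restrict_path: "set (restrict_path \<pi> A) = set \<pi> \<inter> A"
  by (auto simp: restrict_path_def)

lemma length_restrict_path_le: "length (restrict_path \<pi> A) \<le> length \<pi>"
  unfolding restrict_path_def
  by (metis length_filter_le le_trans remdups_adj_length)

lemma last_restrict_path: "\<pi> \<noteq> [] \<Longrightarrow> last \<pi> \<in> A \<Longrightarrow> last (restrict_path \<pi> A) = last \<pi>"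
  by (cases \<pi> rule: rev_cases) (simp_all add: restrict_path_def)

lemma hd_restrict_path: "\<pi> \<noteq> [] \<Longrightarrow> hd \<pi> \<in> A \<Longrightarrow> hd (restrict_path \<pi> A) = hd \<pi>"
  by (cases \<pi>) (auto simp: restrict_path_def)

lemma remdups_adj_successively:
  "successively E xs \<Longrightarrow> (\<And>x. \<not> E x x) \<Longrightarrow> remdups_adj xs = xs"
  by (induction xs rule: remdups_adj.induct) auto

lemma remdups_adj_successively_append_tl:
  assumes "successively E ys" "\<And>x. \<not> E x x" "ys \<noteq> []" "xs \<noteq> []" "last xs = hd ys"
  shows "remdups_adj (xs @ tl ys) = remdups_adj (xs @ ys)"
    and "remdups_adj (xs @ tl ys) = remdups_adj xs @ tl ys"
proof -
  obtain y zs where ys: "ys = y # zs" using assms(3) by (cases ys) auto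
  obtain us where us: "xs = us @ [y]" using assms ys by (cases xs rule: rev_cases) auto
  have a: "remdups_adj (y # zs) = y # zs" using remdups_adj_successively[OF assms(1,2)] ys by simp
  have "remdups_adj (us @ y # zs) = remdups_adj (us @ [y]) @ zs"
    by (subst remdups_adj_append) (simp only: a list.sel)
  then show c: "remdups_adj (xs @ tl ys) = remdups_adj xs @ tl ys" by (simp add: us ys)
  have "remdups_adj (us @ y # y # zs) = remdups_adj (us @ [y]) @ zs"
    by (subst remdups_adj_append) (simp only: remdups_adj.simps if_True simp_thms a list.sel)
  then show "remdups_adj (xs @ tl ys) = remdups_adj (xs @ ys)" using c by (simp add: us ys)
qed

text \<open>
  If a set can be left and entered only through one vertex \<open>c\<close>, then the excursions that a
  restriction cuts out begin and end at \<open>c\<close>, so that the pieces fit together.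
\<close>

lemma successively_restrict_path:
  assumes "successively E \<pi>"
    and out: "\<And>x y. E x y \<Longrightarrow> x \<in> A \<Longrightarrow> y \<notin> A \<Longrightarrow> x = c"
    and into: "\<And>x y. E x y \<Longrightarrow> x \<notin> A \<Longrightarrow> y \<in> A \<Longrightarrow> y = c"
  shows "successively E (restrict_path \<pi> A)"
proof -
  have "successively E (remdups_adj (filter (\<lambda>v. v \<in> A) \<pi>)) \<and>
    (\<pi> \<noteq> [] \<and> hd \<pi> \<notin> A \<longrightarrow> filter (\<lambda>v. v \<in> A) \<pi> = [] \<or> hd (filter (\<lambda>v. v \<in> A) \<pi>) = c)"
    using assms(1)
  proof (induction \<pi>)
    case (Cons x xs)
    show ?case
    proof (cases xs)
      case (Cons y ys)
      let ?f = "filter (\<lambda>v. v \<in> A) xs"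
      have E: "E x y" and s: "successively E xs" using Cons.prems Cons by auto
      note IH = Cons.IH[OF s]
      show ?thesis
      proof (cases "x \<in> A")
        case True
        have "successively E (remdups_adj (x # ?f))"
        proof (cases "?f = []")
          case False
          then obtain z zs where zs: "?f = z # zs" by (cases ?f) auto
          have "x = z \<or> E x z"
          proof (cases "y \<in> A")
            case True
            then show ?thesis using zs Cons E by auto
          next
            case False
            then show ?thesis using zs Cons IH out[OF E True False] by auto
          qed
          moreover obtain ws where "remdups_adj (z # zs) = z # ws"
            by (metis remdups_adj_Cons_alt)
          ultimately show ?thesis using IH zs
            by (cases "x = z") auto
        qed simp
        then show ?thesis using True by simp
      next
        case False
        have "?f = [] \<or> hd ?f = c"
        proof (cases "y \<in> A")
          case True
          then show ?thesis using into[OF E False True] Cons by auto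
        next
          case F: False
          then show ?thesis using IH Cons by auto
        qed
        then show ?thesis using IH False by simp
      qed
    qed auto
  qed simp
  then show ?thesis by (simp add: restrict_path_def)
qed

lemma path_word_length_le:
  assumes "successively E \<pi>" "\<pi> \<noteq> []" "hd \<pi> = []"
    and "\<And>x y. E x y \<Longrightarrow> length y \<le> Suc (length x)" and "w \<in> set \<pi>"
  shows "length w \<le> path_length \<pi>"
proof -
  have "i < length \<pi> \<Longrightarrow> length (\<pi> ! i) \<le> i" for i
  proof (induction i)
    case (Suc i)
    then show ?case using assms(4)[of "\<pi> ! i" "\<pi> ! Suc i"] assms(1)
      by (auto simp: successively_conv_nth)
  qed (use assms in \<open>simp add: hd_conv_nth\<close>)
  moreover obtain i where i: "i < length \<pi>" "w = \<pi> ! i"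
    using assms(5) by (auto simp: in_set_conv_nth)
  ultimately have "length w \<le> i" by simp
  then show ?thesis using i unfolding path_length_def by linarith
qed

lemma unshift_map_append [simp]: "unshift c (map ((@) c) \<pi>) = \<pi>"
  by (induction \<pi>) (auto simp: unshift_def)

lemma restrict_path_map_append:
  "restrict_path (map ((@) c) \<pi>) A = map ((@) c) (restrict_path \<pi> {w. c @ w \<in> A})"
  by (simp add: restrict_path_def filter_map o_def remdups_adj_map_injective inj_def)

lemma restrict_path_cong:
  "(\<And>x. x \<in> set \<pi> \<Longrightarrow> x \<in> A \<longleftrightarrow> x \<in> B) \<Longrightarrow> restrict_path \<pi> A = restrict_path \<pi> B"
  unfolding restrict_path_def by (auto intro!: arg_cong[where f = remdups_adj] filter_cong)


section \<open>The geometry of a free product\<close>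

locale free_product =
  fixes V :: "nat \<Rightarrow> 'a set" and rt :: "nat \<Rightarrow> 'a"
    and p :: "nat \<Rightarrow> 'a \<Rightarrow> 'a \<Rightarrow> real" and \<alpha> :: real
  assumes data: "free_product_data V rt p \<alpha>"
begin

abbreviation "W \<equiv> fp_words V rt"
abbreviation "N \<equiv> nonroot V rt"
abbreviation "P \<equiv> fp_prob V rt p \<alpha>"
abbreviation "cn \<equiv> cone V rt"
abbreviation "VS \<equiv> vstar V rt"
abbreviation "adm \<equiv> \<lambda>x y. P x y > 0"

definition ty :: "'a \<Rightarrow> nat" where "ty g = (if g \<in> N 1 then 1 else 2)"

definition wty :: "'a list \<Rightarrow> nat" where "wty w = ty (last w)"

lemma V_disj: "V 1 \<inter> V 2 = {}" using data by (simp add: free_product_data_def)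

lemma N_disj: "g \<in> N 1 \<Longrightarrow> g \<in> N 2 \<Longrightarrow> False"
  using V_disj by (auto simp: nonroot_def)

lemma ty_12: "ty g \<in> {1, 2}" "wty w \<in> {1, 2}" by (auto simp: ty_def wty_def)

lemma ty_eq: "g \<in> N i \<Longrightarrow> i \<in> {1, 2} \<Longrightarrow> ty g = i"
  using N_disj by (auto simp: ty_def)

lemma ty_in: "g \<in> N 1 \<union> N 2 \<Longrightarrow> g \<in> N (ty g)"
  by (auto simp: ty_def)

lemma opp_12: "i \<in> {1, 2} \<Longrightarrow> 3 - i \<in> {1, 2::nat}" by auto

lemma opp_opp: "i \<in> {1, 2} \<Longrightarrow> 3 - (3 - i) = (i::nat)" by auto

lemma rt_V: "i \<in> {1, 2} \<Longrightarrow> rt i \<in> V i"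
  using data by (auto simp: free_product_data_def)

lemma W_letters: "w \<in> W \<Longrightarrow> g \<in> set w \<Longrightarrow> g \<in> N 1 \<union> N 2"
  by (auto simp: fp_words_def)

lemma Nil_W [simp]: "[] \<in> W" by (simp add: fp_words_def)

lemma single_W: "i \<in> {1, 2} \<Longrightarrow> g \<in> N i \<Longrightarrow> [g] \<in> W" by (auto simp: fp_words_def)

lemma append_W:
  "u @ w \<in> W \<longleftrightarrow> u \<in> W \<and> w \<in> W \<and> (u = [] \<or> w = [] \<or> ty (last u) \<noteq> ty (hd w))"
proof -
  have "(\<not> (\<exists>i\<in>{1, 2}. last u \<in> N i \<and> hd w \<in> N i)) \<longleftrightarrow> ty (last u) \<noteq> ty (hd w)"
    if "u \<noteq> []" "w \<noteq> []" "set (u @ w) \<subseteq> N 1 \<union> N 2"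
  proof -
    have "last u \<in> set (u @ w)" "hd w \<in> set (u @ w)" using that by auto
    then have "last u \<in> N 1 \<union> N 2" "hd w \<in> N 1 \<union> N 2" using that(3) by blast+
    then show ?thesis using N_disj by (auto simp: ty_def)
  qed
  then show ?thesis
    by (cases "u = [] \<or> w = []") (auto simp: fp_words_def successively_append_iff)
qed

lemma word_type_iff:
  "u \<in> W \<Longrightarrow> i \<in> {1, 2} \<Longrightarrow> word_type V rt u \<noteq> Some i \<longleftrightarrow> u = [] \<or> ty (last u) \<noteq> i"
  using W_letters[of u "last u"] N_disj by (auto simp: word_type_def ty_def)

lemma word_type_wty: "u \<in> W \<Longrightarrow> u \<noteq> [] \<Longrightarrow> word_type V rt u = Some (wty u)"
  using W_letters[of u "last u"] N_disj by (auto simp: word_type_def wty_def ty_def)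

lemma countable_W: "countable W"
proof -
  have "countable (V 1 \<union> V 2)" using data by (auto simp: free_product_data_def)
  then have "countable (lists (V 1 \<union> V 2))" by blast
  moreover have "W \<subseteq> lists (V 1 \<union> V 2)" by (auto simp: fp_words_def nonroot_def)
  ultimately show ?thesis by (rule countable_subset[rotated])
qed

lemma p_nonneg: "i \<in> {1, 2} \<Longrightarrow> v \<in> V i \<Longrightarrow> w \<in> V i \<Longrightarrow> p i v w \<ge> 0"
  using data unfolding free_product_data_def transition_matrix_def by blast

lemma p_diag: "i \<in> {1, 2} \<Longrightarrow> v \<in> V i \<Longrightarrow> p i v v = 0"
  using data unfolding free_product_data_def by blast

lemma lift_prob_eq:
  "i \<in> {1, 2} \<Longrightarrow> lifted_pair V rt i x y v w \<Longrightarrow> lift_prob V rt p i x y = p i v w"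
  unfolding lifted_pair_def using lift_prob_append[OF V_disj] by blast

lemma lift_prob_nonneg: "i \<in> {1, 2} \<Longrightarrow> lift_prob V rt p i x y \<ge> 0"
proof (cases "\<exists>v w. lifted_pair V rt i x y v w")
  case True
  assume i: "i \<in> {1, 2}"
  from True obtain v w where l: "lifted_pair V rt i x y v w" by blast
  then show ?thesis using lift_prob_eq[OF i l] p_nonneg[OF i] by (simp add: lifted_pair_def)
qed (simp add: lift_prob_def)

lemma lift_prob_diag: "i \<in> {1, 2} \<Longrightarrow> lift_prob V rt p i x x = 0"
proof (cases "\<exists>v w. lifted_pair V rt i x x v w")
  case True
  assume i: "i \<in> {1, 2}"
  from True obtain v w where l: "lifted_pair V rt i x x v w" by blast
  then have "v = w" "v \<in> V i" by (auto simp: lifted_pair_def emb_def split: if_splits)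
  then show ?thesis using lift_prob_eq[OF i l] p_diag[OF i] by auto
qed (simp add: lift_prob_def)

lemma alpha: "0 < \<alpha>" "\<alpha> < 1" using data by (auto simp: free_product_data_def)

lemma P_nonneg: "P x y \<ge> 0"
  using lift_prob_nonneg[of 1] lift_prob_nonneg[of 2] alpha by (simp add: fp_prob_def)

lemma P_diag: "P x x = 0"
  by (simp add: fp_prob_def lift_prob_diag)

lemma adm_irrefl: "\<not> adm x x" by (simp add: P_diag)

lemma P_posE:
  assumes "P x y > 0"
  obtains i u v w where "i \<in> {1, 2}" "v \<in> V i" "w \<in> V i" "v \<noteq> w" "u \<in> W"
    "u = [] \<or> ty (last u) \<noteq> i" "x = u @ emb rt i v" "y = u @ emb rt i w"
proof -
  have "lift_prob V rt p 1 x y \<noteq> 0 \<or> lift_prob V rt p 2 x y \<noteq> 0"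
    using assms by (auto simp: fp_prob_def)
  then obtain i where i: "i \<in> {1, 2}" "lift_prob V rt p i x y \<noteq> 0" by blast
  then obtain v w where l: "lifted_pair V rt i x y v w"
    by (auto simp: lift_prob_def split: if_splits)
  have "p i v w \<noteq> 0" using lift_prob_eq[OF i(1) l] i by simp
  then have "v \<noteq> w" using p_diag[OF i(1)] l by (auto simp: lifted_pair_def)
  then show ?thesis using that[OF i(1)] l word_type_iff[OF _ i(1)] unfolding lifted_pair_def by metis
qed

lemma emb_append_W:
  assumes "i \<in> {1, 2}" "u \<in> W" "u = [] \<or> ty (last u) \<noteq> i" "v \<in> V i"
  shows "u @ emb rt i v \<in> W"
proof (cases "v = rt i")
  case False
  then have v: "v \<in> N i" using assms by (simp add: nonroot_def)
  have "u @ [v] \<in> W"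
    using assms(2,3) single_W[OF assms(1) v] ty_eq[OF v assms(1)] by (subst append_W) auto
  then show ?thesis using False by (simp add: emb_def)
qed (use assms in \<open>simp add: emb_def\<close>)

lemma P_pos_W: "P x y > 0 \<Longrightarrow> x \<in> W \<and> y \<in> W"
  by (elim P_posE) (auto simp: emb_append_W)

lemma P_pos_length: "P x y > 0 \<Longrightarrow> length y \<le> Suc (length x)"
  by (elim P_posE) (auto simp: emb_def)

text \<open>A cone is left and entered only through its apex: a step changes at most the last letter.\<close>

lemma cone_gate:
  assumes "P x y > 0"
  shows "x \<in> cn c \<Longrightarrow> y \<notin> cn c \<Longrightarrow> x = c" "x \<notin> cn c \<Longrightarrow> y \<in> cn c \<Longrightarrow> y = c"
proof -
  obtain i u v w where d: "x = u @ emb rt i v" "y = u @ emb rt i w"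
    using P_posE[OF assms] by metis
  have xy: "x \<in> W" "y \<in> W" using P_pos_W[OF assms] by auto
  have key: "u @ emb rt i w' \<in> cn c"
    if vc: "u @ emb rt i v' \<in> cn c" "u @ emb rt i v' \<noteq> c" and wW: "u @ emb rt i w' \<in> W" for v' w'
  proof -
    obtain t where t: "u @ emb rt i v' = c @ t" "t \<noteq> []"
      using vc unfolding cone_def by fastforce
    have "\<exists>t'. u = c @ t'"
    proof (cases "v' = rt i")
      case False
      then have "u @ [v'] = c @ t" using t by (simp add: emb_def)
      then show ?thesis using t(2) by (metis append_assoc append_butlast_last_id append1_eq_conv)
    qed (use t in \<open>auto simp: emb_def\<close>)
    then show ?thesis using wW by (auto simp: cone_def)
  qed
  show "x \<in> cn c \<Longrightarrow> y \<notin> cn c \<Longrightarrow> x = c" using key[of v w] d xy by auto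
  show "x \<notin> cn c \<Longrightarrow> y \<in> cn c \<Longrightarrow> y = c" using key[of w v] d xy by auto
qed

lemma noncone_gate:
  assumes "P x y > 0"
  shows "x \<in> noncone V rt c \<Longrightarrow> y \<notin> noncone V rt c \<Longrightarrow> x = c"
    "x \<notin> noncone V rt c \<Longrightarrow> y \<in> noncone V rt c \<Longrightarrow> y = c"
  using cone_gate[OF assms, of c] P_pos_W[OF assms] by (auto simp: noncone_def)

lemma vstar_gate:
  assumes "P x y > 0" "j \<in> {1, 2}"
  shows "x \<in> VS j \<Longrightarrow> y \<notin> VS j \<Longrightarrow> x = []" "x \<notin> VS j \<Longrightarrow> y \<in> VS j \<Longrightarrow> y = []"
proof -
  obtain i u v w where d: "i \<in> {1, 2}" "v \<in> V i" "w \<in> V i" "x = u @ emb rt i v" "y = u @ emb rt i w"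
    using P_posE[OF assms(1)] by metis
  have xy: "x \<in> W" "y \<in> W" using P_pos_W[OF assms(1)] by auto
  have N_disj': "g \<in> N i \<Longrightarrow> g \<in> N j \<Longrightarrow> i = j" for g using ty_eq d(1) assms(2) by metis
  have key: "u @ emb rt i w' \<in> VS j"
    if "u @ emb rt i v' \<in> VS j" "u @ emb rt i v' \<noteq> []" "u @ emb rt i w' \<in> W" "v' \<in> V i" "w' \<in> V i"
    for v' w'
  proof (cases "u = []")
    case True
    then show ?thesis using that N_disj'[of v'] by (auto simp: vstar_def emb_def nonroot_def split: if_splits)
  next
    case False
    then show ?thesis using that by (auto simp: vstar_def)
  qed
  show "x \<in> VS j \<Longrightarrow> y \<notin> VS j \<Longrightarrow> x = []" using key[of v w] d xy by auto
  show "x \<notin> VS j \<Longrightarrow> y \<in> VS j \<Longrightarrow> y = []" using key[of w v] d xy by auto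
qed

lemma vstar_ty: "w \<in> VS i \<Longrightarrow> i \<in> {1, 2} \<Longrightarrow> w \<noteq> [] \<Longrightarrow> ty (hd w) = i"
  by (auto simp: vstar_def ty_eq)

lemma vstar_W: "w \<in> VS i \<Longrightarrow> w \<in> W" by (auto simp: vstar_def)

lemma Nil_vstar [simp]: "[] \<in> VS i" by (auto simp: vstar_def)

lemma cone_eq:
  assumes "c \<in> W" "c \<noteq> []"
  shows "cn c = (@) c ` VS (3 - wty c)"
proof -
  have c: "ty (last c) \<in> {1, 2}" using ty_12 by auto
  have "c @ u \<in> W \<longleftrightarrow> u \<in> VS (3 - wty c)" for u
  proof (cases "u = []")
    case True
    then show ?thesis using assms by simp
  next
    case False
    have "ty (last c) \<noteq> ty (hd u) \<longleftrightarrow> hd u \<in> N (3 - wty c)" if "u \<in> W"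
    proof -
      have "hd u \<in> N 1 \<union> N 2" using W_letters[OF that] False by simp
      then show ?thesis using N_disj by (auto simp: ty_def wty_def)
    qed
    then show ?thesis using assms False by (auto simp: append_W vstar_def)
  qed
  then show ?thesis by (auto simp: cone_def image_iff)
qed

text \<open>
  Moving the apex of a cone to the empty word preserves transition probabilities; only the steps
  in the copy of the factor that the apex closes are lost, and these leave the cone.
\<close>

lemma P_shift:
  assumes c: "c \<in> W" "c \<noteq> []" and uw: "u \<in> VS (3 - wty c)" "w \<in> VS (3 - wty c)"
  shows "P (c @ u) (c @ w) = P u w"
proof (cases "u = w")
  case True
  then show ?thesis by (simp add: P_diag)
next
  case ne: False
  have tc: "ty (last c) \<in> {1, 2}" using ty_12 by auto
  have "lifted_pair V rt j (c @ u) (c @ w) a b \<longleftrightarrow> lifted_pair V rt j u w a b"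
    if j: "j \<in> {1, 2}" for j a b
  proof
    assume l: "lifted_pair V rt j (c @ u) (c @ w) a b"
    then obtain t where t: "t \<in> W" "t = [] \<or> ty (last t) \<noteq> j" "c @ u = t @ emb rt j a"
      "c @ w = t @ emb rt j b" and ab: "a \<in> V j" "b \<in> V j"
      unfolding lifted_pair_def using word_type_iff[OF _ j] by metis
    have "\<exists>t'. t = c @ t'"
    proof (rule ccontr)
      assume n: "\<nexists>t'. t = c @ t'"
      have "u = []" if "c @ u = t @ emb rt j a" for u a
      proof (rule ccontr)
        assume "u \<noteq> []"
        then obtain u' g where "u = u' @ [g]" by (cases u rule: rev_cases) auto
        then show False using that n by (auto simp: emb_def split: if_splits)
      qed
      then show False using t(3,4) ne by metis
    qed
    then obtain t' where t': "t = c @ t'" by blast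
    have "t' \<in> W" "t' = [] \<or> ty (last t') \<noteq> j" using t t' by (auto simp: append_W)
    then have "word_type V rt t' \<noteq> Some j" using word_type_iff j by blast
    then show "lifted_pair V rt j u w a b" using t t' ab \<open>t' \<in> W\<close> unfolding lifted_pair_def by auto
  next
    assume l: "lifted_pair V rt j u w a b"
    then obtain t where t: "t \<in> W" "t = [] \<or> ty (last t) \<noteq> j" "u = t @ emb rt j a"
      "w = t @ emb rt j b" and ab: "a \<in> V j" "b \<in> V j"
      unfolding lifted_pair_def using word_type_iff[OF _ j] by metis
    have ct: "c @ t \<in> W \<and> ty (last (c @ t)) \<noteq> j"
    proof (cases "t = []")
      case True
      have "ty (last c) \<noteq> j"
      proof
        assume j': "ty (last c) = j"
        have "x = []" if "x = emb rt j a'" "x \<in> VS (3 - wty c)" "a' \<in> V j" for x a'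
        proof (rule ccontr)
          assume "x \<noteq> []"
          then have x: "a' \<noteq> rt j" "x = [a']" using that(1) by (auto simp: emb_def split: if_splits)
          then have "a' \<in> N j" "a' \<in> N (3 - j)" using that j' by (auto simp: vstar_def nonroot_def wty_def)
          then show False using j N_disj by auto
        qed
        then show False using t True ab uw ne by (metis append_Nil)
      qed
      then show ?thesis using c True by simp
    next
      case False
      then have "ty (hd t) = 3 - wty c" using vstar_ty[OF uw(1)] tc t(3) by (auto simp: wty_def)
      then have "ty (last c) \<noteq> ty (hd t)" using tc by (auto simp: wty_def)
      then show ?thesis using c t False by (auto simp: append_W)
    qed
    then show "lifted_pair V rt j (c @ u) (c @ w) a b"
      unfolding lifted_pair_def using t ab word_type_iff[OF _ j, of "c @ t"] by auto
  qed
  then have "lift_prob V rt p j (c @ u) (c @ w) = lift_prob V rt p j u w" if "j \<in> {1, 2}" for j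
    using that unfolding lift_prob_def by presburger
  then show ?thesis by (simp add: fp_prob_def)
qed

lemma ex_child:
  assumes i: "i \<in> {1, 2}"
  shows "\<exists>g\<in>N i. P [] [g] > 0"
proof -
  have t: "(p i (rt i) has_sum 1) (V i)"
    using data i rt_V[OF i] unfolding free_product_data_def transition_matrix_def by blast
  have "\<exists>v\<in>V i. p i (rt i) v \<noteq> 0"
  proof (rule ccontr)
    assume "\<not> ?thesis"
    then have "(p i (rt i) has_sum 0) (V i)" using has_sum_0[of "V i" "p i (rt i)"] by auto
    then show False using t has_sum_unique by fastforce
  qed
  then obtain v where v: "v \<in> V i" "p i (rt i) v \<noteq> 0" by blast
  have vr: "v \<noteq> rt i" using p_diag[OF i rt_V[OF i]] v by auto
  have "lift_prob V rt p i [] [v] = p i (rt i) v"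
    using lift_prob_append[OF V_disj i, of "[]" rt "rt i" v p] rt_V[OF i] v vr
    by (auto simp: emb_def word_type_def)
  moreover have "p i (rt i) v > 0" using p_nonneg[OF i rt_V[OF i] v(1)] v by simp
  ultimately have "P [] [v] > 0"
    using i alpha lift_prob_nonneg[of 1 "[]" "[v]"] lift_prob_nonneg[of 2 "[]" "[v]"]
    by (auto simp: fp_prob_def intro: add_pos_nonneg add_nonneg_pos)
  moreover have "v \<in> N i" using v vr by (simp add: nonroot_def)
  ultimately show ?thesis by blast
qed

end

section \<open>Path probabilities and the chance of staying in a cone\<close>

lemma initial_path_eq_iff:
  "initial_path x n = h \<longleftrightarrow> length h = Suc n \<and> (\<forall>i\<le>n. x i = h ! i)"
  unfolding initial_path_def
  by (subst list_eq_iff_nth_eq) (auto simp: less_Suc_eq_le simp del: upt_Suc)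

lemma initial_path_Suc: "initial_path x (Suc n) = initial_path x n @ [x (Suc n)]"
  by (simp add: initial_path_def)

lemma length_initial_path [simp]: "length (initial_path x n) = Suc n"
  by (simp add: initial_path_def)

lemma initial_path_not_Nil [simp]: "initial_path x n \<noteq> []"
  by (simp add: initial_path_def)

lemma last_initial_path [simp]: "last (initial_path x n) = x n"
  by (simp add: initial_path_def)

lemma hd_initial_path [simp]: "hd (initial_path x n) = x 0"
  by (simp add: initial_path_def hd_map del: upt_Suc)

lemma nth_initial_path: "i \<le> n \<Longrightarrow> initial_path x n ! i = x i"
  by (simp add: initial_path_def del: upt_Suc)

locale free_product_walk = free_product V rt p \<alpha> + prob_space M
  for V :: "nat \<Rightarrow> 'a set" and rt p \<alpha> and M :: "'w measure" +
  fixes X :: "nat \<Rightarrow> 'w \<Rightarrow> 'a list"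
  assumes chain: "markov_chain_from M (fp_words V rt) (fp_prob V rt p \<alpha>) [] X"
begin

definition IP :: "nat \<Rightarrow> 'w \<Rightarrow> 'a list list" where
  "IP n \<omega> = initial_path (\<lambda>m. X m \<omega>) n"

lemma IP_simps [simp]:
  "length (IP n \<omega>) = Suc n" "IP n \<omega> \<noteq> []" "last (IP n \<omega>) = X n \<omega>" "hd (IP n \<omega>) = X 0 \<omega>"
  by (simp_all add: IP_def)

lemma IP_eq_iff: "IP n \<omega> = h \<longleftrightarrow> length h = Suc n \<and> (\<forall>i\<le>n. X i \<omega> = h ! i)"
  by (simp add: IP_def initial_path_eq_iff)

lemma IP_Suc: "IP (Suc n) \<omega> = IP n \<omega> @ [X (Suc n) \<omega>]"
  by (simp add: IP_def initial_path_Suc)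

lemma X_W: "\<omega> \<in> space M \<Longrightarrow> X n \<omega> \<in> W"
  using chain measurable_space[of "X n" M "count_space W"] by (simp add: markov_chain_from_def)

lemma X_measurable [measurable]: "X n \<in> measurable M (count_space UNIV)"
proof -
  have "X n \<in> measurable M (count_space W)" using chain by (simp add: markov_chain_from_def)
  then show ?thesis
    using measurable_compose[of "X n" M "count_space W" "\<lambda>x. x" "count_space UNIV"] by simp
qed

lemma X_pred_measurable [measurable]: "Measurable.pred M (\<lambda>\<omega>. X i \<omega> \<in> A)"
  using measurable_compose[OF X_measurable, of "\<lambda>x. x \<in> A" "count_space UNIV" i] by simp

lemma IP_measurable [measurable]: "IP n \<in> measurable M (count_space UNIV)"
proof -
  have "IP n \<in> measurable M (count_space (lists W))"
  proof (subst measurable_count_space_eq_countable)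
    show "countable (lists W)" using countable_W by blast
    have "IP n -` {h} \<inter> space M = {\<omega> \<in> space M. length h = Suc n \<and> (\<forall>i\<le>n. X i \<omega> = h ! i)}" for h
      by (auto simp: IP_eq_iff IP_def initial_path_eq_iff nth_initial_path)
    then show "IP n \<in> space M \<rightarrow> lists W \<and>
        (\<forall>a\<in>lists W. IP n -` {a} \<inter> space M \<in> sets M)"
      using X_W by (auto simp: IP_def initial_path_def)
  qed
  then show ?thesis
    using measurable_compose[of "\<lambda>\<omega>. IP n \<omega>" M "count_space (lists W)" "\<lambda>x. x" "count_space UNIV"]
    by simp
qed

lemma IP_lists: "\<omega> \<in> space M \<Longrightarrow> IP n \<omega> \<in> lists W"
  using X_W by (auto simp: IP_def initial_path_def)

fun pp :: "'a list list \<Rightarrow> real" where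
  "pp (x # y # r) = P x y * pp (y # r)"
| "pp _ = 1"

lemma pp_append: "h \<noteq> [] \<Longrightarrow> pp (h @ r) = pp h * pp (last h # r)"
  by (induction h rule: pp.induct) (auto simp: neq_Nil_conv split: list.splits)

lemma pp_nonneg: "pp h \<ge> 0"
  by (induction h rule: pp.induct) (auto simp: P_nonneg)

lemma pp_pos_iff: "pp h > 0 \<longleftrightarrow> successively adm h"
  by (induction h rule: pp.induct) (use pp_nonneg P_nonneg in \<open>auto simp: zero_less_mult_iff less_le\<close>)

abbreviation "cyl h \<equiv> {\<omega> \<in> space M. IP (length h - 1) \<omega> = h}"

lemma prob_cyl:
  assumes "h \<in> lists W" "h \<noteq> []"
  shows "prob (cyl h) = (if hd h = [] then pp h else 0)"
  using assms
proof (induction h rule: rev_induct)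
  case (snoc y h)
  show ?case
  proof (cases "h = []")
    case True
    have X0: "AE \<omega> in M. X 0 \<omega> = []" using chain by (simp add: markov_chain_from_def)
    have e: "cyl [y] = {\<omega> \<in> space M. X 0 \<omega> = y}" by (auto simp: IP_eq_iff)
    show ?thesis
    proof (cases "y = []")
      case True
      then show ?thesis using X0 \<open>h = []\<close> e by (simp add: prob_eq_1)
    next
      case False
      have "prob {\<omega> \<in> space M. X 0 \<omega> = y} = 0"
        using X0 False by (intro iffD2[OF prob_eq_0]) auto
      then show ?thesis using False \<open>h = []\<close> e by simp
    qed
  next
    case False
    define n where "n = length h - 1"
    have n: "length h = Suc n" using False by (simp add: n_def)
    have IH: "prob (cyl h) = (if hd h = [] then pp h else 0)" using snoc False by auto
    let ?A = "\<lambda>\<omega>. \<forall>i\<le>n. X i \<omega> = h ! i"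
    have eA: "cyl h = {\<omega> \<in> space M. ?A \<omega>}" using n by (auto simp: IP_eq_iff)
    have eB: "cyl (h @ [y]) = {\<omega> \<in> space M. X (Suc n) \<omega> = y \<and> ?A \<omega>}"
    proof -
      have l: "length (h @ [y]) - 1 = Suc n" using n by simp
      have "IP (Suc n) \<omega> = h @ [y] \<longleftrightarrow> IP n \<omega> = h \<and> X (Suc n) \<omega> = y" for \<omega>
        by (simp add: IP_Suc)
      then show ?thesis unfolding l using n by (auto simp: IP_eq_iff)
    qed
    have "prob (cyl (h @ [y])) = prob (cyl h) * P (last h) y"
    proof (cases "prob (cyl h) = 0")
      case True
      have "prob (cyl (h @ [y])) \<le> prob (cyl h)"
        unfolding eA eB by (intro finite_measure_mono) auto
      then show ?thesis using True by (simp add: measure_le_0_iff)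
    next
      case F: False
      then have "prob {\<omega> \<in> space M. ?A \<omega>} > 0" unfolding eA by (simp only: zero_less_measure_iff) simp
      moreover have "y \<in> W" using snoc by simp
      ultimately have "\<P>(\<omega> in M. X (Suc n) \<omega> = y \<bar> ?A \<omega>) = P (h ! n) y"
        using chain unfolding markov_chain_from_def by blast
      moreover have "h ! n = last h" using n False by (simp add: last_conv_nth)
      ultimately show ?thesis using F unfolding eA eB cond_prob_def by (simp add: field_simps)
    qed
    then show ?thesis using IH False by (simp add: pp_append)
  qed
qed simp

text \<open>
  \<open>st A n y\<close> is the probability that the walk started at \<open>y\<close> spends its first \<open>n\<close> steps in \<open>A\<close>;
  \<open>stinf A y\<close> is the probability that it stays in \<open>A\<close> forever.
\<close>

fun st :: "'a list set \<Rightarrow> nat \<Rightarrow> 'a list \<Rightarrow> ennreal" where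
  "st A 0 y = 1"
| "st A (Suc n) y = (\<integral>\<^sup>+z. ennreal (P y z) * st A n z \<partial>count_space A)"

definition stinf :: "'a list set \<Rightarrow> 'a list \<Rightarrow> ennreal" where
  "stinf A y = (INF n. st A n y)"

lemma emeasure_cyl_snoc:
  assumes "h \<in> lists W" "h \<noteq> []" "y \<in> W"
  shows "emeasure M (cyl (h @ [y])) = emeasure M (cyl h) * ennreal (P (last h) y)"
  using assms prob_cyl[of h] prob_cyl[of "h @ [y]"] P_nonneg pp_nonneg
  by (auto simp: emeasure_eq_measure pp_append ennreal_mult)

lemma emeasure_path_stay_n:
  assumes "h \<in> lists W" "h \<noteq> []" "A \<subseteq> W"
  shows "emeasure M {\<omega> \<in> space M. IP (length h - 1) \<omega> = h \<and>
      (\<forall>i. length h \<le> i \<and> i < length h + n \<longrightarrow> X i \<omega> \<in> A)} = emeasure M (cyl h) * st A n (last h)"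
  using assms(1,2)
proof (induction n arbitrary: h)
  case 0
  have e: "(\<forall>i. length h \<le> i \<and> i < length h + 0 \<longrightarrow> X i \<omega> \<in> A) = True" for \<omega> by auto
  show ?case by (simp only: e simp_thms st.simps mult_1_right)
next
  case (Suc n)
  let ?F = "\<lambda>z. {\<omega> \<in> space M. IP (length (h @ [z]) - 1) \<omega> = h @ [z] \<and>
      (\<forall>i. length (h @ [z]) \<le> i \<and> i < length (h @ [z]) + n \<longrightarrow> X i \<omega> \<in> A)}"
  obtain k where k: "length h = Suc k" using Suc.prems by (cases h) auto
  have hz: "IP (length (h @ [z]) - 1) \<omega> = h @ [z] \<longleftrightarrow> IP (length h - 1) \<omega> = h \<and> X (length h) \<omega> = z" for z \<omega>
    by (simp add: k IP_Suc)
  define T where "T \<omega> = (\<forall>i. Suc (length h) \<le> i \<and> i < Suc (length h) + n \<longrightarrow> X i \<omega> \<in> A)" for \<omega>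
  have split: "(\<forall>i. length h \<le> i \<and> i < length h + Suc n \<longrightarrow> X i \<omega> \<in> A) \<longleftrightarrow>
      X (length h) \<omega> \<in> A \<and> T \<omega>" for \<omega>
    unfolding T_def by (auto simp: Suc_le_eq) (metis Suc_leI le_neq_implies_less)
  have F: "?F z = {\<omega> \<in> space M. (IP (length h - 1) \<omega> = h \<and> X (length h) \<omega> = z) \<and> T \<omega>}" for z
    unfolding hz T_def by simp
  have U: "{\<omega> \<in> space M. IP (length h - 1) \<omega> = h \<and>
      (\<forall>i. length h \<le> i \<and> i < length h + Suc n \<longrightarrow> X i \<omega> \<in> A)} = (\<Union>z\<in>A. ?F z)"
  proof (intro set_eqI)
    fix \<omega>
    have "\<omega> \<in> ?F z \<longleftrightarrow> \<omega> \<in> space M \<and> (IP (length h - 1) \<omega> = h \<and> X (length h) \<omega> = z) \<and> T \<omega>" for z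
      using F[of z] by blast
    then show "\<omega> \<in> {\<omega> \<in> space M. IP (length h - 1) \<omega> = h \<and>
      (\<forall>i. length h \<le> i \<and> i < length h + Suc n \<longrightarrow> X i \<omega> \<in> A)} \<longleftrightarrow> \<omega> \<in> (\<Union>z\<in>A. ?F z)"
      using split[of \<omega>] by (simp only: mem_Collect_eq UN_iff) blast
  qed
  have "emeasure M (\<Union>z\<in>A. ?F z) = (\<integral>\<^sup>+z. emeasure M (?F z) \<partial>count_space A)"
    using countable_subset[OF assms(3) countable_W]
  proof (intro emeasure_UN_countable)
    show "?F z \<in> sets M" for z by measurable
    have "?F z \<inter> ?F z' = {}" if "z \<noteq> z'" for z z' unfolding F using that by blast
    then show "disjoint_family_on ?F A" unfolding disjoint_family_on_def by blast
  qed
  also have "\<dots> = (\<integral>\<^sup>+z. emeasure M (cyl h) * (ennreal (P (last h) z) * st A n z) \<partial>count_space A)"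
  proof (intro nn_integral_cong)
    fix z assume "z \<in> space (count_space A)"
    then have z: "z \<in> W" using assms(3) by auto
    show "emeasure M (?F z) = emeasure M (cyl h) * (ennreal (P (last h) z) * st A n z)"
      using Suc.IH[of "h @ [z]"] Suc.prems z emeasure_cyl_snoc[OF Suc.prems z]
      by (simp add: mult.assoc)
  qed
  also have "\<dots> = emeasure M (cyl h) * st A (Suc n) (last h)"
    by (simp add: nn_integral_cmult)
  finally show ?case unfolding U .
qed

lemma emeasure_path_stay:
  assumes "h \<in> lists W" "h \<noteq> []" "A \<subseteq> W"
  shows "emeasure M {\<omega> \<in> space M. IP (length h - 1) \<omega> = h \<and> (\<forall>i\<ge>length h. X i \<omega> \<in> A)}
    = emeasure M (cyl h) * stinf A (last h)"
proof -
  let ?E = "\<lambda>n. {\<omega> \<in> space M. IP (length h - 1) \<omega> = h \<and>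
      (\<forall>i. length h \<le> i \<and> i < length h + n \<longrightarrow> X i \<omega> \<in> A)}"
  have all: "(\<Inter>n. ?E n) = {\<omega> \<in> space M. IP (length h - 1) \<omega> = h \<and> (\<forall>i\<ge>length h. X i \<omega> \<in> A)}"
    (is "_ = ?S")
  proof (intro equalityI subsetI)
    fix \<omega> assume w: "\<omega> \<in> (\<Inter>n. ?E n)"
    then have "X i \<omega> \<in> A" if "i \<ge> length h" for i
      using that INT_D[OF w, of "Suc i"] by simp
    then show "\<omega> \<in> ?S" using w by auto
  qed auto
  have dec: "decseq ?E" by (rule decseq_SucI) auto
  have lim: "(\<lambda>n. emeasure M (?E n)) \<longlonglongrightarrow> emeasure M ?S"
    unfolding all[symmetric] by (rule Lim_emeasure_decseq) (use dec in auto)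
  note eq = emeasure_path_stay_n[OF assms]
  show ?thesis
  proof (cases "emeasure M (cyl h) = 0")
    case True
    have "emeasure M ?S \<le> emeasure M (cyl h)" by (intro emeasure_mono) auto
    then show ?thesis using True by simp
  next
    case False
    have "decseq (\<lambda>n. st A n (last h))"
    proof (rule decseq_SucI)
      fix n
      have "emeasure M (?E (Suc n)) \<le> emeasure M (?E n)" by (intro emeasure_mono) auto
      then have "emeasure M (cyl h) * st A (Suc n) (last h) \<le> emeasure M (cyl h) * st A n (last h)"
        unfolding eq .
      then show "st A (Suc n) (last h) \<le> st A n (last h)"
        using False by (simp add: ennreal_mult_le_mult_iff emeasure_eq_measure zero_less_iff_neq_zero)
    qed
    then have "(\<lambda>n. st A n (last h)) \<longlonglongrightarrow> stinf A (last h)"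
      unfolding stinf_def by (rule LIMSEQ_INF)
    then have "(\<lambda>n. emeasure M (cyl h) * st A n (last h)) \<longlonglongrightarrow> emeasure M (cyl h) * stinf A (last h)"
      by (intro ennreal_tendsto_cmult) (simp add: emeasure_eq_measure)
    then show ?thesis using lim LIMSEQ_unique unfolding eq by blast
  qed
qed

lemma st_shift:
  assumes c: "c \<in> W" "c \<noteq> []"
  shows "u \<in> VS (3 - wty c) \<Longrightarrow> st (cn c) n (c @ u) = st (VS (3 - wty c)) n u"
proof (induction n arbitrary: u)
  case (Suc n)
  have b: "bij_betw ((@) c) (VS (3 - wty c)) (cn c)"
    unfolding cone_eq[OF c] by (auto simp: bij_betw_def inj_on_def)
  have "st (cn c) (Suc n) (c @ u) =
      (\<integral>\<^sup>+w. ennreal (P (c @ u) (c @ w)) * st (cn c) n (c @ w) \<partial>count_space (VS (3 - wty c)))"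
    using nn_integral_bij_count_space[OF b, of "\<lambda>z. ennreal (P (c @ u) z) * st (cn c) n z"] by simp
  also have "\<dots> = st (VS (3 - wty c)) (Suc n) u"
    by (auto intro!: nn_integral_cong simp: P_shift[OF c] Suc)
  finally show ?case .
qed simp

text \<open>By homogeneity, the chance to remain in a cone depends on the type of its apex only.\<close>

definition sg :: "nat \<Rightarrow> ennreal" where "sg i = stinf (VS i) []"

lemma stinf_cone: "c \<in> W \<Longrightarrow> c \<noteq> [] \<Longrightarrow> stinf (cn c) c = sg (3 - wty c)"
  using st_shift[of c "[]"] by (simp add: stinf_def sg_def)

lemma sg_le_1: "sg i \<le> 1"
  unfolding sg_def stinf_def by (rule INF_lower2[of 0]) auto

lemma AE_path: "AE \<omega> in M. X 0 \<omega> = [] \<and> (\<forall>n. adm (X n \<omega>) (X (Suc n) \<omega>))"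
proof -
  let ?B = "{h \<in> lists W. h \<noteq> [] \<and> (hd h \<noteq> [] \<or> pp h = 0)}"
  have "countable ?B" using countable_W by (intro countable_subset[of ?B "lists W"]) auto
  moreover have "AE \<omega> in M. IP (length h - 1) \<omega> \<noteq> h" if "h \<in> ?B" for h
  proof -
    have "prob (cyl h) = 0" using that prob_cyl[of h] by auto
    then show ?thesis by (subst (asm) prob_eq_0) auto
  qed
  ultimately have "AE \<omega> in M. \<forall>h\<in>?B. IP (length h - 1) \<omega> \<noteq> h"
    by (subst AE_ball_countable) auto
  with AE_space show ?thesis
  proof eventually_elim
    case (elim \<omega>)
    have "IP n \<omega> \<notin> ?B" for n using elim(2) by fastforce
    then have *: "hd (IP n \<omega>) = [] \<and> pp (IP n \<omega>) \<noteq> 0" for n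
      using IP_lists[OF elim(1)] by auto
    have "successively adm (IP (Suc n) \<omega>)" for n
      using * pp_pos_iff pp_nonneg by (metis less_le)
    then have "adm (X n \<omega>) (X (Suc n) \<omega>)" for n
      by (simp add: IP_Suc successively_append_iff)
    then show ?case using *[of 0] by simp
  qed
qed

end

section \<open>Transience\<close>

locale transient_walk = free_product_walk V rt p \<alpha> M X
  for V :: "nat \<Rightarrow> 'a set" and rt p \<alpha> and M :: "'w measure" and X +
  assumes green: "conv_radius (\<lambda>n. \<P>(\<omega> in M. X n \<omega> = [])) > 1"
begin

lemma AE_finitely_many_returns: "AE \<omega> in M. eventually (\<lambda>n. X n \<omega> \<noteq> []) sequentially"
proof -
  have "summable (\<lambda>n. norm (prob {\<omega> \<in> space M. X n \<omega> = []} * 1 ^ n))"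
    by (rule abs_summable_in_conv_radius) (use green in \<open>simp add: one_ereal_def\<close>)
  then have "summable (\<lambda>n. prob {\<omega> \<in> space M. X n \<omega> = []})" by simp
  then have "AE \<omega> in M. eventually (\<lambda>n. \<omega> \<in> space M - {\<omega> \<in> space M. X n \<omega> = []}) sequentially"
    by (intro borel_cantelli_AE1) (auto simp: emeasure_eq_measure)
  then show ?thesis by eventually_elim (auto elim: eventually_mono)
qed

lemma word_in_vstar: "w \<in> W \<Longrightarrow> w \<in> VS (ty (hd w))"
  using W_letters[of w "hd w"] by (cases "w = []") (auto simp: vstar_def ty_def)

lemma vstar_subset_W: "VS i \<subseteq> W" by (auto simp: vstar_def)

lemma stays_in_vstar:
  assumes "\<And>n. adm (x n) (x (Suc n))" "i \<in> {1, 2}" "x n \<in> VS i" "\<And>m. m \<ge> n \<Longrightarrow> x m \<noteq> []" "m \<ge> n"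
  shows "x m \<in> VS i"
  using assms(5)
proof (induction m rule: dec_induct)
  case (step m)
  show ?case
    using vstar_gate(1)[OF assms(1)[of m] assms(2) step.IH] assms(4)[of m] step by auto
qed (use assms in simp)

text \<open>
  The last visit to the empty word is a disjoint decomposition of the whole space, so that some
  last-visit event is not null; after that visit the walk never leaves one of the two sets
  \<open>V\<^sub>i\<^sup>*\<close>.  From there positivity is carried over to the other type by one step into it.
\<close>

lemma sg_pos_ex: "\<exists>i\<in>{1, 2}. sg i > 0"
proof (rule ccontr)
  assume neg: "\<not> ?thesis"
  define L where "L n i = {\<omega> \<in> space M. X n \<omega> = [] \<and> (\<forall>m\<ge>Suc n. X m \<omega> \<in> VS i)}" for n i
  have null: "AE \<omega> in M. \<omega> \<notin> L n i" if i: "i \<in> {1, 2}" for n i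
  proof -
    let ?H = "{h \<in> lists W. length h = Suc n \<and> last h = []}"
    let ?F = "\<lambda>h. {\<omega> \<in> space M. IP (length h - 1) \<omega> = h \<and> (\<forall>m\<ge>length h. X m \<omega> \<in> VS i)}"
    have c: "countable ?H" using countable_W by (intro countable_subset[of ?H "lists W"]) auto
    have z: "AE \<omega> in M. \<omega> \<notin> ?F h" if h: "h \<in> ?H" for h
    proof -
      have "emeasure M (?F h) = emeasure M (cyl h) * sg i"
        unfolding sg_def using emeasure_path_stay[of h "VS i"] h vstar_subset_W by fastforce
      also have "\<dots> = 0" using neg i by auto
      finally have "?F h \<in> null_sets M" by (intro null_setsI) measurable
      then show ?thesis by (rule AE_not_in)
    qed
    have "AE \<omega> in M. \<forall>h\<in>?H. \<omega> \<notin> ?F h" using z by (subst AE_ball_countable[OF c]) auto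
    with AE_space show ?thesis
    proof eventually_elim
      case (elim \<omega>)
      show ?case
      proof
        assume "\<omega> \<in> L n i"
        then have "\<omega> \<in> ?F (IP n \<omega>)" "IP n \<omega> \<in> ?H" using IP_lists by (auto simp: L_def)
        then show False using elim by blast
      qed
    qed
  qed
  have "AE \<omega> in M. \<forall>n. \<forall>i\<in>{1, 2}. \<omega> \<notin> L n i"
    using null by (simp add: AE_all_countable)
  with AE_path AE_finitely_many_returns AE_space have "AE \<omega> in M. False"
  proof eventually_elim
    case (elim \<omega>)
    then obtain n0 where n0: "X n \<omega> \<noteq> []" if "n \<ge> n0" for n by (auto simp: eventually_sequentially)
    let ?S = "{n. X n \<omega> = []}"
    have "n \<le> n0" if "X n \<omega> = []" for n using n0[of n] that by (cases "n \<le> n0") auto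
    then have "?S \<subseteq> {..n0}" by auto
    then have fin: "finite ?S" by (rule finite_subset) simp
    have "0 \<in> ?S" using elim by simp
    define n where "n = Max ?S"
    have n: "X n \<omega> = []" using Max_in[OF fin] \<open>0 \<in> ?S\<close> unfolding n_def by blast
    have later: "X m \<omega> \<noteq> []" if "m \<ge> Suc n" for m
      using Max_ge[OF fin, of m] that unfolding n_def by auto
    let ?i = "ty (hd (X (Suc n) \<omega>))"
    have "X (Suc n) \<omega> \<in> VS ?i" by (rule word_in_vstar) (rule X_W[OF elim(3)])
    then have "X m \<omega> \<in> VS ?i" if "m \<ge> Suc n" for m
      using stays_in_vstar[of "\<lambda>n. X n \<omega>" ?i "Suc n" m] elim(1) ty_12(1)[of "hd (X (Suc n) \<omega>)"] later that by blast
    then have "\<omega> \<in> L n ?i" using n elim(3) by (simp add: L_def)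
    then show False using elim(4) ty_12(1)[of "hd (X (Suc n) \<omega>)"] by blast
  qed
  then show False by simp
qed

lemma emeasure_step_stay:
  assumes "h \<in> lists W" "h \<noteq> []" "y \<in> W" "y \<noteq> []"
  shows "emeasure M {\<omega> \<in> space M. IP (length h) \<omega> = h @ [y] \<and> (\<forall>i\<ge>Suc (length h). X i \<omega> \<in> cn y)}
    = emeasure M (cyl h) * ennreal (P (last h) y) * sg (3 - wty y)"
  using emeasure_path_stay[of "h @ [y]" "cn y"] emeasure_cyl_snoc[of h y] assms stinf_cone[of y]
  by (auto simp: cone_def)

lemma emeasure_cyl_Nil: "emeasure M (cyl [[]]) = 1"
  using prob_cyl[of "[[]]"] by (simp add: emeasure_eq_measure)

lemma single_ty: "g \<in> N i \<Longrightarrow> i \<in> {1, 2} \<Longrightarrow> wty [g] = i"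
  by (simp add: wty_def ty_eq)

lemma sg_pos:
  assumes j: "j \<in> {1, 2}"
  shows "sg j > 0"
proof -
  obtain i where i: "i \<in> {1, 2}" "sg i > 0" using sg_pos_ex by blast
  show ?thesis
  proof (cases "i = j")
    case False
    then have ij: "i = 3 - j" using i j by auto
    obtain g where g: "g \<in> N j" "P [] [g] > 0" using ex_child[OF j] by blast
    have gW: "[g] \<in> W" by (rule single_W[OF j g(1)])
    have sub: "cn [g] \<subseteq> VS j" using g by (auto simp: cone_def vstar_def)
    let ?h = "[[]] :: 'a list list"
    have "0 < ennreal (P [] [g]) * sg i" using g i by (simp add: ennreal_zero_less_mult_iff)
    also have "\<dots> = emeasure M {\<omega> \<in> space M. IP (length ?h) \<omega> = ?h @ [[g]] \<and>
        (\<forall>i\<ge>Suc (length ?h). X i \<omega> \<in> cn [g])}"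
      by (subst emeasure_step_stay) (use gW ij emeasure_cyl_Nil single_ty[OF g(1) j] in auto)
    also have "\<dots> \<le> emeasure M {\<omega> \<in> space M. IP (length ?h - 1) \<omega> = ?h \<and>
        (\<forall>i\<ge>length ?h. X i \<omega> \<in> VS j)}"
    proof (intro emeasure_mono subsetI)
      fix \<omega> assume a: "\<omega> \<in> {\<omega> \<in> space M. IP (length ?h) \<omega> = ?h @ [[g]] \<and>
        (\<forall>i\<ge>Suc (length ?h). X i \<omega> \<in> cn [g])}"
      then have "X 1 \<omega> = [g]" "X 0 \<omega> = []" by (auto simp: IP_eq_iff nth_Cons split: nat.splits)
      moreover have "[g] \<in> cn [g]" using gW by (auto simp: cone_def)
      ultimately have "X m \<omega> \<in> cn [g]" if "m \<ge> 1" for m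
        using a that by (cases "m = 1") auto
      then show "\<omega> \<in> {\<omega> \<in> space M. IP (length ?h - 1) \<omega> = ?h \<and> (\<forall>i\<ge>length ?h. X i \<omega> \<in> VS j)}"
        using a sub \<open>X 0 \<omega> = []\<close> by (auto simp: IP_eq_iff)
    qed measurable
    also have "\<dots> = sg j"
      unfolding sg_def using emeasure_path_stay[of ?h "VS j"] vstar_subset_W emeasure_cyl_Nil
      by simp
    finally show ?thesis .
  qed (use i in simp)
qed

definition child :: "nat \<Rightarrow> 'a" where "child i = (SOME g. g \<in> N i \<and> P [] [g] > 0)"

lemma child: "i \<in> {1, 2} \<Longrightarrow> child i \<in> N i" "i \<in> {1, 2} \<Longrightarrow> P [] [child i] > 0"
  using someI_ex[of "\<lambda>g. g \<in> N i \<and> P [] [g] > 0"] ex_child[of i] unfolding child_def by blast+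

definition next_word :: "'a list \<Rightarrow> 'a list" where
  "next_word x = x @ [child (3 - wty x)]"

lemma next_word:
  assumes "x \<in> W"
  shows "next_word x \<in> W" "next_word x \<noteq> []" "wty (next_word x) = 3 - wty x"
    "P x (next_word x) = P [] [child (3 - wty x)]"
proof -
  have i: "3 - wty x \<in> {1, 2}" using ty_12(2)[of x] by auto
  note c = child[OF i]
  show "next_word x \<noteq> []" by (simp add: next_word_def)
  show "wty (next_word x) = 3 - wty x"
    using ty_eq[OF c(1) i] by (simp add: next_word_def wty_def)
  have s: "[child (3 - wty x)] \<in> VS (3 - wty x)" using c single_W[OF i c(1)] by (simp add: vstar_def)
  show "P x (next_word x) = P [] [child (3 - wty x)]"
    using P_shift[of x "[]"] s assms by (cases "x = []") (auto simp: next_word_def)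
  show "next_word x \<in> W"
    using s cone_eq[of x] assms vstar_W[OF s] unfolding next_word_def
    by (cases "x = []") (auto simp: cone_def)
qed

text \<open>
  From a vertex of level \<open>k\<close> the walk moves, with a probability bounded from below, to a vertex of
  level \<open>k + 1\<close> whose cone it never leaves again.  For different times these events are disjoint,
  so that the expected number of visits to level \<open>k\<close> is finite.
\<close>

lemma AE_level_left: "AE \<omega> in M. eventually (\<lambda>n. length (X n \<omega>) \<noteq> k) sequentially"
proof -
  define B where "B n = {\<omega> \<in> space M. length (X n \<omega>) = k \<and> X (Suc n) \<omega> = next_word (X n \<omega>) \<and>
      (\<forall>m\<ge>Suc (Suc n). X m \<omega> \<in> cn (X (Suc n) \<omega>))}" for n
  define A where "A n = {\<omega> \<in> space M. length (X n \<omega>) = k}" for n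
  define c where "c = min (ennreal (P [] [child 1]) * sg 2) (ennreal (P [] [child 2]) * sg 1)"
  have cpos: "c > 0" unfolding c_def using child sg_pos by (simp add: ennreal_zero_less_mult_iff)
  have c_le: "c \<le> ennreal (P [] [child i]) * sg (3 - i)" if "i \<in> {1, 2}" for i
    using that unfolding c_def by auto
  have clt: "c < \<top>"
  proof -
    have "c \<le> ennreal (P [] [child 1]) * 1" unfolding c_def
      by (rule order.trans[OF min.cobounded1]) (intro mult_left_mono sg_le_1, simp)
    then show ?thesis by (simp add: le_less_trans ennreal_less_top)
  qed
  have [measurable]: "B n \<in> sets M" for n
  proof -
    have "B n = (\<Union>x\<in>W. {\<omega> \<in> space M. X n \<omega> \<in> {x} \<and> length x = k \<and> X (Suc n) \<omega> \<in> {next_word x} \<and>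
        (\<forall>m\<ge>Suc (Suc n). X m \<omega> \<in> cn (next_word x))})"
      using X_W unfolding B_def by auto
    also have "\<dots> \<in> sets M" by (intro sets.countable_UN'' countable_W) measurable
    finally show ?thesis .
  qed
  have [measurable]: "A n \<in> sets M" for n unfolding A_def by measurable
  have key: "c * emeasure M (A n) \<le> emeasure M (B n)" for n
  proof -
    let ?H = "{h \<in> lists W. length h = Suc n \<and> length (last h) = k}"
    let ?G = "\<lambda>h. {\<omega> \<in> space M. IP (length h) \<omega> = h @ [next_word (last h)] \<and>
        (\<forall>i\<ge>Suc (length h). X i \<omega> \<in> cn (next_word (last h)))}"
    have cH: "countable ?H" using countable_W by (intro countable_subset[of ?H "lists W"]) auto
    have lastW: "last h \<in> W" if "h \<in> ?H" for h
      using that by (metis (mono_tags, lifting) in_listsD last_in_set length_0_conv mem_Collect_eq nat.distinct(1))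
    have disj: "disjoint_family_on cyl ?H" by (auto simp: disjoint_family_on_def)
    have "A n = (\<Union>h\<in>?H. cyl h)"
    proof (intro set_eqI iffI)
      fix \<omega> assume "\<omega> \<in> A n"
      then have "IP n \<omega> \<in> ?H" "\<omega> \<in> cyl (IP n \<omega>)" using IP_lists by (auto simp: A_def)
      then show "\<omega> \<in> (\<Union>h\<in>?H. cyl h)" by blast
    next
      fix \<omega> assume "\<omega> \<in> (\<Union>h\<in>?H. cyl h)"
      then obtain h where h: "h \<in> ?H" "\<omega> \<in> cyl h" by blast
      then have "IP n \<omega> = h" by simp
      then show "\<omega> \<in> A n" using h by (auto simp: A_def)
    qed
    then have "c * emeasure M (A n) = c * (\<integral>\<^sup>+h. emeasure M (cyl h) \<partial>count_space ?H)"
      using cH disj by (subst emeasure_UN_countable[symmetric]) auto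
    also have "\<dots> = (\<integral>\<^sup>+h. c * emeasure M (cyl h) \<partial>count_space ?H)"
      by (simp add: nn_integral_cmult)
    also have "\<dots> \<le> (\<integral>\<^sup>+h. emeasure M (?G h) \<partial>count_space ?H)"
    proof (intro nn_integral_mono)
      fix h assume "h \<in> space (count_space ?H)"
      then have h: "h \<in> ?H" by simp
      then have hn: "h \<noteq> []" by auto
      note nw = next_word[OF lastW[OF h]]
      have i: "3 - wty (last h) \<in> {1, 2}" using ty_12(2)[of "last h"] by auto
      have "emeasure M (?G h) = emeasure M (cyl h) * ennreal (P (last h) (next_word (last h))) * sg (3 - wty (next_word (last h)))"
        using h hn nw by (intro emeasure_step_stay) auto
      also have "\<dots> = emeasure M (cyl h) * (ennreal (P [] [child (3 - wty (last h))]) * sg (3 - (3 - wty (last h))))"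
        unfolding nw by (simp add: mult.assoc)
      finally have e: "emeasure M (?G h) = emeasure M (cyl h) *
          (ennreal (P [] [child (3 - wty (last h))]) * sg (3 - (3 - wty (last h))))" .
      show "c * emeasure M (cyl h) \<le> emeasure M (?G h)"
        unfolding e mult.commute[of c] by (intro mult_left_mono c_le[OF i]) simp
    qed
    also have "\<dots> = emeasure M (\<Union>h\<in>?H. ?G h)"
    proof (rule emeasure_UN_countable[symmetric, OF _ cH])
      show "?G h \<in> sets M" if "h \<in> ?H" for h by measurable
      have "length h = Suc n \<Longrightarrow> \<omega> \<in> ?G h \<Longrightarrow> IP n \<omega> = h" for h \<omega>
        by (auto simp: IP_Suc)
      then show "disjoint_family_on ?G ?H" unfolding disjoint_family_on_def by blast
    qed
    also have "\<dots> \<le> emeasure M (B n)"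
    proof (intro emeasure_mono)
      show "(\<Union>h\<in>?H. ?G h) \<subseteq> B n" by (auto simp: B_def IP_Suc)
    qed measurable
    finally show ?thesis .
  qed
  have len: "length (X m \<omega>) > k" if "\<omega> \<in> B n" "m > n" for \<omega> m n
  proof (cases "m = Suc n")
    case True
    then show ?thesis using that by (simp add: B_def next_word_def)
  next
    case False
    then have "m \<ge> Suc (Suc n)" using that by simp
    then have "X m \<omega> \<in> cn (X (Suc n) \<omega>)" using that(1) unfolding B_def by blast
    then show ?thesis using that(1) by (auto simp: cone_def B_def next_word_def)
  qed
  have "disjoint_family B"
    unfolding disjoint_family_on_def
  proof (intro ballI impI)
    fix m n :: nat assume "m \<noteq> n"
    then have "\<not> (\<omega> \<in> B m \<and> \<omega> \<in> B n)" for \<omega>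
      using len[of \<omega> n m] len[of \<omega> m n] by (cases m n rule: linorder_cases) (auto simp: B_def)
    then show "B m \<inter> B n = {}" by blast
  qed
  then have "(\<Sum>n. emeasure M (B n)) = emeasure M (\<Union>n. B n)"
    by (intro suminf_emeasure) auto
  also have "\<dots> \<le> 1" by (rule emeasure_le_1)
  finally have "(\<Sum>n. c * emeasure M (A n)) \<le> 1"
    using suminf_le[OF key] order.trans by (meson summableI)
  then have "c * (\<Sum>n. emeasure M (A n)) \<le> 1" by (simp add: ennreal_suminf_cmult)
  then have "(\<Sum>n. emeasure M (A n)) \<noteq> \<top>" using cpos by (auto simp: ennreal_mult_top top_unique split: if_splits)
  then have "summable (\<lambda>n. prob (A n))"
    by (intro summable_suminf_not_top) (auto simp: emeasure_eq_measure)
  then have "AE \<omega> in M. eventually (\<lambda>n. \<omega> \<in> space M - A n) sequentially"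
    by (intro borel_cantelli_AE1) (auto simp: emeasure_eq_measure)
  then show ?thesis by eventually_elim (auto elim: eventually_mono simp: A_def)
qed

end

definition (in free_product) nice :: "(nat \<Rightarrow> 'a list) \<Rightarrow> bool" where
  "nice x \<longleftrightarrow> x 0 = [] \<and> (\<forall>n. adm (x n) (x (Suc n))) \<and>
    (\<forall>k. eventually (\<lambda>n. length (x n) > k) sequentially)"

lemma (in transient_walk) AE_nice: "AE \<omega> in M. nice (\<lambda>n. X n \<omega>)"
proof -
  have "AE \<omega> in M. \<forall>k. eventually (\<lambda>n. length (X n \<omega>) \<noteq> k) sequentially"
    using AE_level_left by (simp add: AE_all_countable)
  with AE_path show ?thesis
  proof eventually_elim
    case (elim \<omega>)
    have "eventually (\<lambda>n. length (X n \<omega>) > k) sequentially" for k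
    proof -
      have "eventually (\<lambda>n. \<forall>j\<in>{..k}. length (X n \<omega>) \<noteq> j) sequentially"
        using elim by (intro eventually_ball_finite) auto
      then show ?thesis by (rule eventually_mono) (metis atMost_iff not_less)
    qed
    then show ?case using elim by (simp add: nice_def)
  qed
qed

section \<open>Final cone entries of a single trajectory\<close>

context free_product
begin

abbreviation "et x k \<equiv> entry_time V rt x k"

lemma nice_adm: "nice x \<Longrightarrow> adm (x n) (x (Suc n))" by (simp add: nice_def)

lemma nice_W: "nice x \<Longrightarrow> x n \<in> W" using P_pos_W[OF nice_adm] by blast

lemma cone_refl: "c \<in> W \<Longrightarrow> c \<in> cn c" by (simp add: cone_def)

lemma cone_Nil: "cn [] = W" by (auto simp: cone_def)

lemma cone_trans: "c' \<in> cn c \<Longrightarrow> w \<in> cn c' \<Longrightarrow> w \<in> cn c" by (auto simp: cone_def)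

lemma cone_length: "w \<in> cn c \<Longrightarrow> length c \<le> length w" by (auto simp: cone_def)

lemma cone_eq_length: "w \<in> cn c \<Longrightarrow> length w = length c \<Longrightarrow> w = c" by (auto simp: cone_def)

lemma cone_take: "w \<in> cn c \<Longrightarrow> c = take (length c) w" by (auto simp: cone_def)

lemma adm_longer_cone: "adm x y \<Longrightarrow> length y > length x \<Longrightarrow> y \<in> cn x"
proof -
  assume a: "adm x y" and l: "length y > length x"
  have "\<exists>u. y = x @ u" using a l by (elim P_posE) (auto simp: emb_def split: if_splits)
  then show ?thesis using P_pos_W[OF a] by (simp add: cone_def)
qed

lemma ex_final_entry:
  assumes x: "nice x" and k: "k \<ge> 1"
  shows "\<exists>l\<ge>1. length (x l) = k \<and> (\<forall>i\<ge>l. x i \<in> cn (x l))"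
proof -
  let ?S = "{n. length (x n) \<le> k}"
  obtain n0 where n0: "\<And>n. n \<ge> n0 \<Longrightarrow> length (x n) > k"
    using x unfolding nice_def eventually_sequentially by blast
  have "n \<le> n0" if "length (x n) \<le> k" for n using n0[of n] that by (cases "n \<le> n0") auto
  then have fin: "finite ?S" by (intro finite_subset[of ?S "{..n0}"]) auto
  have "0 \<in> ?S" using x by (simp add: nice_def)
  define t where "t = Max ?S"
  have t: "length (x t) \<le> k" using Max_in[OF fin] \<open>0 \<in> ?S\<close> unfolding t_def by blast
  have later: "length (x m) > k" if "m > t" for m
    using Max_ge[OF fin, of m] that unfolding t_def by force
  have tk: "length (x t) = k"
    using t later[of "Suc t"] P_pos_length[OF nice_adm[OF x, of t]] by simp
  have "x i \<in> cn (x t)" if "i \<ge> t" for i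
    using that
  proof (induction i rule: dec_induct)
    case base
    then show ?case using cone_refl nice_W[OF x] by blast
  next
    case (step i)
    show ?case
    proof (cases "i = t")
      case True
      then show ?thesis using adm_longer_cone[OF nice_adm[OF x]] later[of "Suc t"] tk by simp
    next
      case False
      then have "x i \<noteq> x t" using later[of i] step tk by auto
      then show ?thesis using cone_gate(1)[OF nice_adm[OF x]] step.IH by blast
    qed
  qed
  moreover have "t \<ge> 1" using tk k x by (cases t) (auto simp: nice_def)
  ultimately show ?thesis using tk by blast
qed

lemma entry_time_mem:
  assumes "nice x" "k \<ge> 1"
  shows "et x k \<ge> 1" "length (x (et x k)) = k" "\<And>i. i \<ge> et x k \<Longrightarrow> x i \<in> cn (x (et x k))"
    "\<And>l. l \<ge> 1 \<Longrightarrow> length (x l) = k \<Longrightarrow> (\<And>i. i \<ge> l \<Longrightarrow> x i \<in> cn (x l)) \<Longrightarrow> et x k \<le> l"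
proof -
  let ?S = "{l. l \<ge> 1 \<and> length (x l) = k \<and> (\<forall>i\<ge>l. x i \<in> cn (x l))}"
  have e: "et x k = Inf ?S" using assms by (simp add: entry_time_def)
  have "?S \<noteq> {}" using ex_final_entry[OF assms] by blast
  then have "Inf ?S \<in> ?S" by (rule Inf_nat_def1)
  then show "et x k \<ge> 1" "length (x (et x k)) = k" "\<And>i. i \<ge> et x k \<Longrightarrow> x i \<in> cn (x (et x k))"
    unfolding e by blast+
  show "et x k \<le> l" if "l \<ge> 1" "length (x l) = k" "\<And>i. i \<ge> l \<Longrightarrow> x i \<in> cn (x l)" for l
    unfolding e by (rule cInf_lower) (use that in auto)
qed

lemma entry_time_0: "et x 0 = 0" by (simp add: entry_time_def)

lemma entry_length: "nice x \<Longrightarrow> length (x (et x k)) = k"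
  using entry_time_mem(2)[of x k] by (cases "k = 0") (auto simp: entry_time_0 nice_def)

lemma entry_stays: "nice x \<Longrightarrow> i \<ge> et x k \<Longrightarrow> x i \<in> cn (x (et x k))"
  using entry_time_mem(3)[of x k i] nice_W[of x i]
  by (cases "k = 0") (auto simp: entry_time_0 nice_def cone_Nil)

text \<open>The final cone entry is an entry: the walk steps into the cone at that time.\<close>

lemma entry_from_outside:
  assumes x: "nice x" and k: "k \<ge> 1"
  shows "x (et x k - 1) \<notin> cn (x (et x k))"
proof
  let ?y = "x (et x k)"
  assume a: "x (et x k - 1) \<in> cn ?y"
  define s where "s = (LEAST s. \<forall>i\<ge>s. x i \<in> cn ?y)"
  have stay: "\<forall>i\<ge>et x k - 1. x i \<in> cn ?y"
  proof (intro allI impI)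
    fix i assume "i \<ge> et x k - 1"
    then show "x i \<in> cn ?y" using a entry_stays[OF x, of k i] by (cases "i = et x k - 1") auto
  qed
  then have s1: "\<forall>i\<ge>s. x i \<in> cn ?y" unfolding s_def by (rule LeastI)
  have s2: "s \<le> et x k - 1" using stay unfolding s_def by (rule Least_le)
  have "length ?y = k" using entry_length[OF x] .
  moreover have "x 0 = []" using x by (simp add: nice_def)
  ultimately have "x 0 \<notin> cn ?y" using cone_length[of "x 0" ?y] k by auto
  then have "s \<noteq> 0" using s1 by (metis le0)
  then obtain r where r: "s = Suc r" by (cases s) auto
  have "x r \<notin> cn ?y"
  proof
    assume "x r \<in> cn ?y"
    then have "\<forall>i\<ge>r. x i \<in> cn ?y" using s1 r by (metis Suc_leI le_neq_implies_less)
    then have "s \<le> r" unfolding s_def by (rule Least_le)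
    then show False using r by simp
  qed
  moreover have "x s \<in> cn ?y" using s1 by blast
  ultimately have "x s = ?y" using cone_gate(2)[OF nice_adm[OF x, of r]] r by blast
  then have "et x k \<le> s" using entry_time_mem(4)[OF x k, of s] s1 r entry_length[OF x, of k] by simp
  then show False using s2 entry_time_mem(1)[OF x k] by simp
qed

lemma entry_time_eqI:
  assumes x: "nice x" and l: "l \<ge> 1" "length (x l) = k" "\<And>i. i \<ge> l \<Longrightarrow> x i \<in> cn (x l)"
    "x (l - 1) \<notin> cn (x l)"
  shows "et x k = l"
proof -
  have "x l \<noteq> []" using l(4) nice_W[OF x] cone_Nil by auto
  then have k: "k \<ge> 1" using l(2) by (cases "x l") auto
  have le: "et x k \<le> l" using entry_time_mem(4)[OF x k] l by blast
  moreover have "\<not> et x k < l"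
  proof
    assume "et x k < l"
    then have "x l = x (et x k)" "x (l - 1) \<in> cn (x (et x k))"
      using entry_stays[OF x] cone_eq_length[of "x l" "x (et x k)"] entry_length[OF x, of k] l(2) by auto
    then show False using l(4) by simp
  qed
  ultimately show ?thesis by simp
qed

lemma entry_time_Suc:
  assumes x: "nice x"
  shows "et x k < et x (Suc k)" "x (et x k) = butlast (x (et x (Suc k)))"
proof -
  show lt: "et x k < et x (Suc k)"
  proof (rule ccontr)
    assume "\<not> ?thesis"
    then have "x (et x k) \<in> cn (x (et x (Suc k)))" using entry_stays[OF x] by simp
    then show False using cone_length entry_length[OF x] by fastforce
  qed
  then have "x (et x (Suc k)) \<in> cn (x (et x k))" using entry_stays[OF x] by simp
  then show "x (et x k) = butlast (x (et x (Suc k)))"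
    using cone_take entry_length[OF x] by (metis butlast_conv_take diff_Suc_1)
qed

lemma entry_mono: "nice x \<Longrightarrow> strict_mono (et x)"
  using entry_time_Suc(1) by (simp add: strict_mono_Suc_iff)


section \<open>The block decomposition of a trajectory\<close>

text \<open>
  \<open>hist x k\<close> is the trajectory up to its \<open>k\<close>-th final cone entry; \<open>hists k\<close> are the values it can
  take.  \<open>blocks i\<close> are the paths inside \<open>V\<^sub>i\<^sup>*\<close> by which a history is extended to the next level.
\<close>

definition hist :: "(nat \<Rightarrow> 'a list) \<Rightarrow> nat \<Rightarrow> 'a list list" where
  "hist x k = initial_path x (et x k)"

definition hists :: "nat \<Rightarrow> 'a list list set" where
  "hists k = {h. 2 \<le> length h \<and> hd h = [] \<and> h \<in> lists W \<and> successively adm h \<and>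
     length (last h) = k \<and> last (butlast h) \<notin> cn (last h)}"

definition blocks :: "nat \<Rightarrow> 'a list list set" where
  "blocks i = {a. 2 \<le> length a \<and> hd a = [] \<and> set a \<subseteq> VS i \<and> successively adm a \<and>
     length (last a) = 1 \<and> last (butlast a) \<notin> cn (last a)}"

definition ext :: "'a list list \<Rightarrow> 'a list list \<Rightarrow> 'a list list" where
  "ext h a = h @ map ((@) (last h)) (tl a)"

abbreviation "opp h \<equiv> 3 - wty (last h)"

lemma opp_range: "opp h \<in> {1, 2}" using ty_12(2)[of "last h"] by auto

lemma initial_path_append:
  "m \<le> n \<Longrightarrow> initial_path x n = initial_path x m @ map x [Suc m..<Suc n]"
  using upt_add_eq_append[of 0 "Suc m" "n - m"] by (simp add: initial_path_def del: upt_Suc)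

lemma successively_initial_path: "nice x \<Longrightarrow> successively adm (initial_path x n)"
  by (simp add: successively_conv_nth initial_path_def nice_adm del: upt_Suc)

lemma hists_last: "h \<in> hists k \<Longrightarrow> h \<noteq> [] \<and> last h \<in> W \<and> length (last h) = k"
  using last_in_set[of h] by (cases "h = []") (auto simp: hists_def)

lemma hists_last_ne: "h \<in> hists k \<Longrightarrow> k \<ge> 1 \<Longrightarrow> last h \<noteq> []"
  using hists_last by fastforce

lemma butlast_initial_path: "n \<ge> 1 \<Longrightarrow> last (butlast (initial_path x n)) = x (n - 1)"
  by (cases n) (auto simp: initial_path_Suc)

lemma hist_in_hists:
  assumes "nice x" "k \<ge> 1"
  shows "hist x k \<in> hists k"
proof -
  have "initial_path x n \<in> lists W" for n
    using nice_W[OF assms(1)] by (auto simp: initial_path_def)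
  moreover have "x 0 = []" using assms(1) by (simp add: nice_def)
  ultimately show ?thesis
    unfolding hists_def hist_def
    using entry_time_mem(1,2)[OF assms] entry_from_outside[OF assms] butlast_initial_path[of "et x k" x]
      successively_initial_path[OF assms(1)]
    by simp
qed

lemma hist_eq_iff:
  assumes x: "nice x" and h: "h \<in> hists k"
  shows "hist x k = h \<longleftrightarrow> initial_path x (length h - 1) = h \<and> (\<forall>i\<ge>length h. x i \<in> cn (last h))"
proof
  assume "hist x k = h"
  then have e: "h = initial_path x (et x k)" by (simp add: hist_def)
  then have "length h - 1 = et x k" "last h = x (et x k)" by simp_all
  then show "initial_path x (length h - 1) = h \<and> (\<forall>i\<ge>length h. x i \<in> cn (last h))"
    using e entry_stays[OF x] by simp
next
  assume a: "initial_path x (length h - 1) = h \<and> (\<forall>i\<ge>length h. x i \<in> cn (last h))"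
  define l where "l = length h - 1"
  have l: "l \<ge> 1" "length h = Suc l" using h by (auto simp: hists_def l_def)
  have xl: "x l = last h" using a by (metis l_def last_initial_path)
  have "x i \<in> cn (x l)" if "i \<ge> l" for i
    using that a l xl hists_last[OF h] cone_refl by (cases "i = l") auto
  moreover have "x (l - 1) \<notin> cn (x l)"
  proof -
    have "last (butlast h) = x (l - 1)" using a butlast_initial_path[OF l(1), of x] by (simp add: l_def)
    then show ?thesis using h xl by (simp add: hists_def)
  qed
  ultimately have "et x k = l"
    using hists_last[OF h] xl by (intro entry_time_eqI[OF x l(1)]) auto
  then show "hist x k = h" using a by (simp add: hist_def l_def)
qed

lemma blocks_D:
  assumes "a \<in> blocks i"
  obtains r z where "a = [] # r @ [[z]]" "last (butlast a) = last ([] # r)"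
proof -
  have a: "2 \<le> length a" "hd a = []" "length (last a) = 1" using assms by (auto simp: blocks_def)
  then obtain b y where b: "a = b @ [y]" by (cases a rule: rev_cases) auto
  then obtain r where r: "b = [] # r" using a by (cases b) auto
  obtain z where "y = [z]" using a b by (cases y) auto
  then show ?thesis using that[of r z] b r by simp
qed

lemma blocks_ne: "a \<in> blocks i \<Longrightarrow> a \<noteq> [] \<and> tl a \<noteq> [] \<and> last (tl a) = last a"
  by (elim blocks_D) auto

lemma ext_Cons: "a \<in> blocks i \<Longrightarrow> map ((@) c) a = c # map ((@) c) (tl a)"
  by (elim blocks_D) auto

lemma last_ext: "a \<in> blocks i \<Longrightarrow> last (ext h a) = last h @ last a"
  using blocks_ne[of a i] by (simp add: ext_def last_map)

lemma block_letter:
  assumes "a \<in> blocks i" "i \<in> {1, 2}"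
  shows "last (last a) \<in> N i" "last a = [last (last a)]" "wty (last a) = i" "last a \<in> VS i"
proof -
  have a: "length (last a) = 1" "last a \<in> VS i" using assms(1) blocks_ne[OF assms(1)] by (auto simp: blocks_def)
  then obtain z where z: "last a = [z]" by (cases "last a") auto
  then show "last (last a) \<in> N i" "last a = [last (last a)]" "last a \<in> VS i" using a by (auto simp: vstar_def)
  then show "wty (last a) = i" using ty_eq assms by (simp add: wty_def)
qed

lemma successively_shift:
  assumes "c \<in> W" "c \<noteq> []" "set a \<subseteq> VS (3 - wty c)"
  shows "successively adm (map ((@) c) a) \<longleftrightarrow> successively adm a"
  unfolding successively_map using P_shift[OF assms(1,2)] assms(3)
  by (induction a rule: induct_list012) auto

lemma ext_in_hists:
  assumes h: "h \<in> hists k" and k: "k \<ge> 1" and a: "a \<in> blocks (opp h)"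
  shows "ext h a \<in> hists (Suc k)"
proof -
  define c where "c = last h"
  have c: "c \<in> W" "c \<noteq> []" "length c = k" "h \<noteq> []"
    using hists_last[OF h] hists_last_ne[OF h k] by (auto simp: c_def)
  have sa: "set a \<subseteq> VS (3 - wty c)" "successively adm a" "last (butlast a) \<notin> cn (last a)"
    using a by (auto simp: blocks_def c_def)
  obtain r z where r: "a = [] # r @ [[z]]" "last (butlast a) = last ([] # r)" using blocks_D[OF a] .
  have e: "ext h a = h @ map ((@) c) (tl a)" by (simp add: ext_def c_def)
  have "successively adm (c # map ((@) c) (tl a))"
    using successively_shift[OF c(1,2) sa(1)] sa(2) ext_Cons[OF a] by metis
  then have "successively adm (ext h a)"
    using h c unfolding e by (auto simp: hists_def successively_append_iff successively_Cons c_def[symmetric])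
  moreover have "c @ w \<in> W" if "w \<in> set a" for w
    using that sa(1) cone_eq[OF c(1,2)] by (auto simp: cone_def)
  then have "ext h a \<in> lists W" using h r unfolding e by (auto simp: hists_def)
  moreover have "length (last (ext h a)) = Suc k" using last_ext[OF a] c r by (simp add: c_def)
  moreover have "last (butlast (ext h a)) \<notin> cn (last (ext h a))"
  proof -
    have "ext h a = (h @ map ((@) c) r) @ [c @ [z]]" unfolding e by (simp add: r(1))
    then have b: "butlast (ext h a) = h @ map ((@) c) r" by (simp only: butlast_snoc)
    have "last (butlast (ext h a)) = c @ last (butlast a)"
      unfolding b r(2) using c by (cases r) (auto simp: c_def last_map)
    moreover have "last (butlast a) \<in> W"
    proof -
      have "last (butlast a) \<in> set a" using r by (cases r) auto
      then show ?thesis using sa(1) vstar_W by blast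
    qed
    ultimately show ?thesis using sa(3) last_ext[OF a, of h] by (auto simp: cone_def c_def)
  qed
  moreover have "hd (ext h a) = []" "length (ext h a) \<ge> 2" using h c(4) by (simp_all add: hists_def e)
  ultimately show ?thesis by (simp add: hists_def)
qed

lemma hist_Suc:
  assumes x: "nice x" and k: "k \<ge> 1"
  obtains a where "a \<in> blocks (opp (hist x k))" "hist x (Suc k) = ext (hist x k) a"
    "length a - 1 = et x (Suc k) - et x k"
proof -
  define c where "c = x (et x k)"
  define e e' where "e = et x k" and "e' = et x (Suc k)"
  have c: "c \<in> W" "c \<noteq> []" "length c = k"
    using nice_W[OF x] entry_length[OF x, of k] k by (auto simp: c_def)
  have last_h: "last (hist x k) = c" by (simp add: hist_def c_def)
  have ee: "e < e'" using entry_time_Suc(1)[OF x] by (simp add: e_def e'_def)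
  define b where "b = map x [e..<Suc e']"
  have inc: "x i \<in> cn c" if "i \<ge> e" for i using that entry_stays[OF x] by (simp add: c_def e_def)
  define a where "a = map (drop k) b"
  have drop: "c @ drop k (x i) = x i \<and> drop k (x i) \<in> VS (3 - wty c)" if "i \<ge> e" for i
    using inc[OF that] c(3) unfolding cone_eq[OF c(1,2)] by auto
  have ba: "b = map ((@) c) a" unfolding a_def b_def using drop by (auto simp del: upt_Suc)
  have sa: "set a \<subseteq> VS (3 - wty c)" unfolding a_def b_def using drop by (auto simp del: upt_Suc)
  have len: "length a = Suc e' - e" by (simp add: a_def b_def del: upt_Suc)
  have hd_a: "hd a = []" using ee c(3) by (simp add: a_def b_def hd_map c_def e_def del: upt_Suc)
  have "successively adm b"
    unfolding b_def by (simp add: successively_conv_nth nice_adm[OF x] del: upt_Suc)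
  then have s: "successively adm a" using successively_shift[OF c(1,2) sa] ba by simp
  have la: "last a = drop k (x e')" using ee by (simp add: a_def b_def)
  have bl: "last (butlast a) = drop k (x (e' - 1))"
  proof -
    have "a = map (\<lambda>i. drop k (x i)) [e..<e'] @ [drop k (x e')]"
      using ee by (simp add: a_def b_def)
    then have "butlast a = map (\<lambda>i. drop k (x i)) [e..<e']" by (simp only: butlast_snoc)
    then show ?thesis using ee by (simp add: last_map)
  qed
  have out: "last (butlast a) \<notin> cn (last a)"
  proof
    assume "last (butlast a) \<in> cn (last a)"
    then obtain u where "drop k (x (e' - 1)) = drop k (x e') @ u" unfolding la bl cone_def by auto
    then have "x (e' - 1) = x e' @ u"
      using drop[of e'] drop[of "e' - 1"] ee by (metis append.assoc less_imp_le_nat less_imp_diff_less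
          Suc_diff_1 Suc_leI less_Suc_eq_le not_gr_zero not_less0)
    then have "x (e' - 1) \<in> cn (x e')" using nice_W[OF x, of "e' - 1"] by (simp add: cone_def)
    then show False using entry_from_outside[OF x, of "Suc k"] by (simp add: e'_def)
  qed
  have "length (last a) = 1" using la entry_length[OF x, of "Suc k"] by (simp add: e'_def)
  then have a: "a \<in> blocks (opp (hist x k))"
    unfolding blocks_def last_h using len ee hd_a sa s out by auto
  have "hist x (Suc k) = initial_path x e @ map x [Suc e..<Suc e']"
    using initial_path_append[of e e' x] ee by (simp add: hist_def e'_def)
  also have "map x [Suc e..<Suc e'] = tl b"
    using ee by (simp add: b_def upt_conv_Cons del: upt_Suc)
  also have "\<dots> = map ((@) c) (tl a)" by (simp add: ba map_tl)
  finally have "hist x (Suc k) = ext (hist x k) a" by (simp add: ext_def last_h) (simp add: hist_def e_def)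
  then show ?thesis using that[OF a] len ee by (simp add: e_def e'_def)
qed

lemma hist_ext:
  assumes x: "nice x" and h: "h \<in> hists k" and k: "k \<ge> 1" and a: "a \<in> blocks (opp h)"
    and e: "hist x (Suc k) = ext h a"
  shows "hist x k = h" "et x (Suc k) - et x k = length a - 1"
proof -
  note G = ext_in_hists[OF h k a]
  have p: "initial_path x (length (ext h a) - 1) = ext h a"
    "\<And>i. i \<ge> length (ext h a) \<Longrightarrow> x i \<in> cn (last (ext h a))"
    using hist_eq_iff[OF x G] e by auto
  obtain r z where r: "a = [] # r @ [[z]]" using blocks_D[OF a] by metis
  have hne: "h \<noteq> []" using hists_last[OF h] by blast
  define m where "m = length h - 1"
  have m: "length h = Suc m" using hne by (simp add: m_def)
  have le: "m \<le> length (ext h a) - 1" by (simp add: ext_def m)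
  have ph: "initial_path x m = h"
    using initial_path_append[OF le, of x] p(1) m unfolding ext_def
    by (metis append_eq_append_conv length_initial_path)
  have c: "last h \<in> W" "last h \<noteq> []" using hists_last[OF h] hists_last_ne[OF h k] by auto
  have "x i \<in> cn (last h)" if "i \<ge> length h" for i
  proof (cases "i \<ge> length (ext h a)")
    case True
    moreover have "last (ext h a) \<in> cn (last h)"
      using last_ext[OF a, of h] hists_last[OF G] by (auto simp: cone_def)
    ultimately show ?thesis using p(2) cone_trans by blast
  next
    case False
    then have "x i = ext h a ! i" using p(1) nth_initial_path[of i "length (ext h a) - 1" x] by simp
    also have "\<dots> = last h @ tl a ! (i - length h)"
      using that False by (simp add: ext_def nth_append)
    finally have "x i = last h @ tl a ! (i - length h)" .
    moreover have "i - length h < length (tl a)" using that False by (simp add: ext_def)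
    then have "tl a ! (i - length h) \<in> set (tl a)" by (rule nth_mem)
    then have "tl a ! (i - length h) \<in> set a" using r by (simp add: r)
    ultimately show ?thesis using a cone_eq[OF c] by (auto simp: blocks_def)
  qed
  then show hk: "hist x k = h" using hist_eq_iff[OF x h] ph by (simp add: m_def)
  have "Suc (et x k) = length h" "Suc (et x (Suc k)) = length (ext h a)"
    using hk e by (metis hist_def length_initial_path)+
  then show "et x (Suc k) - et x k = length a - 1" by (simp add: ext_def)
qed

end

section \<open>The law of the blocks\<close>

context transient_walk
begin

definition E :: "nat \<Rightarrow> 'w \<Rightarrow> nat" where "E k \<omega> = et (\<lambda>n. X n \<omega>) k"

definition H :: "nat \<Rightarrow> 'w \<Rightarrow> 'a list list" where "H k \<omega> = IP (E k \<omega>) \<omega>"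

lemma H_hist: "H k \<omega> = hist (\<lambda>n. X n \<omega>) k" by (simp add: H_def hist_def IP_def E_def)

lemma X_in_cone_measurable [measurable]: "Measurable.pred M (\<lambda>\<omega>. X i \<omega> \<in> cn (X l \<omega>))"
proof -
  have "IP (max i l) \<omega> ! i = X i \<omega>" "IP (max i l) \<omega> ! l = X l \<omega>" for \<omega>
    using nth_initial_path[of i "max i l" "\<lambda>n. X n \<omega>"] nth_initial_path[of l "max i l" "\<lambda>n. X n \<omega>"]
    by (simp_all add: IP_def)
  then show ?thesis
    using measurable_compose[OF IP_measurable[of "max i l"], of "\<lambda>h. h ! i \<in> cn (h ! l)" "count_space UNIV"]
    by simp
qed

lemma E_measurable [measurable]: "E k \<in> measurable M (count_space UNIV)"
proof (cases "k = 0")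
  case True
  then show ?thesis by (simp add: E_def[abs_def] entry_time_0)
next
  case False
  have [measurable]: "Measurable.pred M (\<lambda>\<omega>. length (X l \<omega>) = k)" for l
    using X_pred_measurable[of l "{w. length w = k}"] by simp
  have "(\<lambda>\<omega>. LEAST l. l \<ge> 1 \<and> length (X l \<omega>) = k \<and> (\<forall>i\<ge>l. X i \<omega> \<in> cn (X l \<omega>)))
      \<in> measurable M (count_space UNIV)"
    by measurable
  moreover have "E k = (\<lambda>\<omega>. LEAST l. l \<ge> 1 \<and> length (X l \<omega>) = k \<and> (\<forall>i\<ge>l. X i \<omega> \<in> cn (X l \<omega>)))"
    using False by (auto simp: E_def entry_time_def Inf_nat_def)
  ultimately show ?thesis by simp
qed

lemma H_measurable [measurable]: "H k \<in> measurable M (count_space UNIV)"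
  unfolding H_def[abs_def]
  by (rule measurable_compose_countable[OF IP_measurable E_measurable])

lemma H_fun_measurable: "(\<lambda>\<omega>. F (H k \<omega>)) \<in> measurable M (count_space UNIV)"
  using measurable_compose[OF H_measurable[of k], of F "count_space UNIV"] by simp

lemma AE_H_hists: "AE \<omega> in M. \<forall>k\<ge>1. H k \<omega> \<in> hists k"
  using AE_nice by eventually_elim (simp add: H_hist hist_in_hists)

lemma countable_hists: "countable (hists k)"
  using countable_W by (intro countable_subset[of "hists k" "lists W"]) (auto simp: hists_def)

lemma countable_blocks: "countable (blocks i)"
  using countable_W vstar_subset_W by (intro countable_subset[of "blocks i" "lists W"]) (auto simp: blocks_def)

lemma AE_emeasure_cong:
  "(AE \<omega> in M. Q \<omega> \<longleftrightarrow> R \<omega>) \<Longrightarrow> Measurable.pred M Q \<Longrightarrow> Measurable.pred M R \<Longrightarrow>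
    emeasure M {\<omega> \<in> space M. Q \<omega>} = emeasure M {\<omega> \<in> space M. R \<omega>}"
  by (rule emeasure_eq_AE) auto

lemma H_pred: "Measurable.pred M (\<lambda>\<omega>. Q (H k \<omega>))"
  using measurable_compose[OF H_measurable[of k], of Q "count_space UNIV"] by simp

lemma emeasure_H:
  assumes h: "h \<in> hists k" and k: "k \<ge> 1"
  shows "emeasure M {\<omega> \<in> space M. H k \<omega> = h} = ennreal (pp h) * sg (opp h)"
proof -
  have hW: "h \<in> lists W" "h \<noteq> []" "hd h = []" using h by (auto simp: hists_def)
  have c: "last h \<in> W" "last h \<noteq> []" using hists_last[OF h] hists_last_ne[OF h k] by auto
  have "AE \<omega> in M. H k \<omega> = h \<longleftrightarrow> IP (length h - 1) \<omega> = h \<and> (\<forall>i\<ge>length h. X i \<omega> \<in> cn (last h))"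
    using AE_nice by eventually_elim (use hist_eq_iff[OF _ h] in \<open>simp add: H_hist IP_def\<close>)
  then have "emeasure M {\<omega> \<in> space M. H k \<omega> = h} =
    emeasure M {\<omega> \<in> space M. IP (length h - 1) \<omega> = h \<and> (\<forall>i\<ge>length h. X i \<omega> \<in> cn (last h))}"
    by (rule AE_emeasure_cong) measurable
  also have "\<dots> = emeasure M (cyl h) * stinf (cn (last h)) (last h)"
    by (rule emeasure_path_stay[OF hW(1,2)]) (auto simp: cone_def)
  also have "\<dots> = ennreal (pp h) * sg (opp h)"
    using prob_cyl[OF hW(1,2)] hW(3) stinf_cone[OF c] by (simp add: emeasure_eq_measure)
  finally show ?thesis .
qed

lemma pp_ext:
  assumes h: "h \<in> hists k" and k: "k \<ge> 1" and a: "a \<in> blocks (opp h)"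
  shows "pp (ext h a) = pp h * pp a"
proof -
  have c: "last h \<in> W" "last h \<noteq> []" "h \<noteq> []" using hists_last[OF h] hists_last_ne[OF h k] by auto
  have "pp (map ((@) (last h)) b) = pp b" if "set b \<subseteq> VS (opp h)" for b
    using that by (induction b rule: pp.induct) (use P_shift[OF c(1,2)] in auto)
  then have "pp (map ((@) (last h)) a) = pp a" using a by (simp add: blocks_def)
  then have "pp (last h # map ((@) (last h)) (tl a)) = pp a" unfolding ext_Cons[OF a] .
  then show ?thesis using c(3) by (simp add: ext_def pp_append)
qed

lemma opp_ext: "a \<in> blocks (opp h) \<Longrightarrow> opp (ext h a) = 3 - opp h"
proof -
  assume a: "a \<in> blocks (opp h)"
  have "last a \<noteq> []" using block_letter(2)[OF a opp_range] by (metis list.distinct(1))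
  then have "wty (last (ext h a)) = wty (last a)" by (simp add: last_ext[OF a] wty_def)
  then show ?thesis using block_letter(3)[OF a opp_range] by simp
qed

text \<open>A history is extended by exactly one block, and the extended history determines it.\<close>

lemma emeasure_H_split:
  assumes h: "h \<in> hists k" and k: "k \<ge> 1" and R: "Measurable.pred M R"
  shows "emeasure M {\<omega> \<in> space M. H k \<omega> = h \<and> R \<omega>} =
    (\<integral>\<^sup>+a. emeasure M {\<omega> \<in> space M. H (Suc k) \<omega> = ext h a \<and> R \<omega>} \<partial>count_space (blocks (opp h)))"
proof -
  note R [measurable]
  have inj: "a = a'" if "ext h a = ext h a'" "a \<in> blocks (opp h)" "a' \<in> blocks (opp h)" for a a'
  proof -
    have "tl a = tl a'" using that(1) by (simp add: ext_def inj_map_eq_map inj_def)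
    moreover have "hd a = hd a'" "a \<noteq> []" "a' \<noteq> []" using that(2,3) by (auto simp: blocks_def)
    ultimately show ?thesis by (metis list.expand)
  qed
  define B where "B g \<longleftrightarrow> (\<exists>a\<in>blocks (opp h). g = ext h a)" for g
  have [measurable]: "Measurable.pred M (\<lambda>\<omega>. B (H (Suc k) \<omega>))" by (rule H_pred)
  have "AE \<omega> in M. (H k \<omega> = h \<and> R \<omega>) \<longleftrightarrow> B (H (Suc k) \<omega>) \<and> R \<omega>"
    using AE_nice
  proof eventually_elim
    case (elim \<omega>)
    show ?case
      using hist_Suc[OF elim k] hist_ext(1)[OF elim h k] unfolding H_hist B_def by metis
  qed
  then have "emeasure M {\<omega> \<in> space M. H k \<omega> = h \<and> R \<omega>} =
     emeasure M {\<omega> \<in> space M. B (H (Suc k) \<omega>) \<and> R \<omega>}"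
    by (rule AE_emeasure_cong) measurable
  also have "{\<omega> \<in> space M. B (H (Suc k) \<omega>) \<and> R \<omega>}
      = (\<Union>a\<in>blocks (opp h). {\<omega> \<in> space M. H (Suc k) \<omega> = ext h a \<and> R \<omega>})"
    unfolding B_def by blast
  also have "emeasure M \<dots> = (\<integral>\<^sup>+a. emeasure M {\<omega> \<in> space M. H (Suc k) \<omega> = ext h a \<and> R \<omega>}
      \<partial>count_space (blocks (opp h)))"
  proof (rule emeasure_UN_countable[OF _ countable_blocks])
    show "{\<omega> \<in> space M. H (Suc k) \<omega> = ext h a \<and> R \<omega>} \<in> sets M" for a by measurable
    show "disjoint_family_on (\<lambda>a. {\<omega> \<in> space M. H (Suc k) \<omega> = ext h a \<and> R \<omega>}) (blocks (opp h))"
      unfolding disjoint_family_on_def using inj by fastforce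
  qed
  finally show ?thesis .
qed

lemma emeasure_H_ext:
  assumes h: "h \<in> hists k" and k: "k \<ge> 1" and a: "a \<in> blocks (opp h)"
  shows "emeasure M {\<omega> \<in> space M. H (Suc k) \<omega> = ext h a} = ennreal (pp h) * (ennreal (pp a) * sg (3 - opp h))"
  using emeasure_H[OF ext_in_hists[OF h k a]] pp_ext[OF h k a] opp_ext[OF a] pp_nonneg
  by (simp add: ennreal_mult mult.assoc)

lemma block_mass:
  assumes i: "i \<in> {1, 2}"
  shows "(\<integral>\<^sup>+a. ennreal (pp a) * sg (3 - i) \<partial>count_space (blocks i)) = sg i"
proof -
  have j: "3 - i \<in> {1, 2}" using i by auto
  define h where "h = [[], [child (3 - i)]]"
  have h: "h \<in> hists 1"
    using child[OF j] single_W[OF j] by (auto simp: h_def hists_def cone_def)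
  have wt: "opp h = i" using single_ty[OF child(1)[OF j] j] i by (auto simp: h_def)
  have pph: "pp h > 0" using child[OF j] by (simp add: h_def)
  have "ennreal (pp h) * sg i = emeasure M {\<omega> \<in> space M. H 1 \<omega> = h \<and> True}"
    using emeasure_H[OF h] wt by simp
  also have "\<dots> = (\<integral>\<^sup>+a. emeasure M {\<omega> \<in> space M. H (Suc 1) \<omega> = ext h a \<and> True} \<partial>count_space (blocks i))"
    using emeasure_H_split[OF h, of "\<lambda>_. True"] wt by simp
  also have "\<dots> = (\<integral>\<^sup>+a. ennreal (pp h) * (ennreal (pp a) * sg (3 - i)) \<partial>count_space (blocks i))"
    by (intro nn_integral_cong) (use emeasure_H_ext[OF h] wt in auto)
  also have "\<dots> = ennreal (pp h) * (\<integral>\<^sup>+a. ennreal (pp a) * sg (3 - i) \<partial>count_space (blocks i))"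
    by (simp add: nn_integral_cmult)
  finally show ?thesis using pph
    by (subst (asm) ennreal_mult_cancel_left) auto
qed

definition sgr :: "nat \<Rightarrow> real" where "sgr i = enn2real (sg i)"

lemma sg_sgr: "sg i = ennreal (sgr i)"
  using order.strict_trans1[OF sg_le_1[of i] ennreal_one_less_top] by (simp add: sgr_def)

lemma sgr_pos: "i \<in> {1, 2} \<Longrightarrow> sgr i > 0"
  using sg_pos[of i] by (simp add: sg_sgr)

text \<open>
  The law of a block of type \<open>i\<close>: the path probability, reweighted with the chances to stay in the
  cone that is entered, given that the walk stays in the current one.
\<close>

definition mu :: "nat \<Rightarrow> 'a list list pmf" where
  "mu i = embed_pmf (\<lambda>a. if a \<in> blocks i then pp a * sgr (3 - i) / sgr i else 0)"

lemma pmf_mu: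
  assumes i: "i \<in> {1, 2}"
  shows "pmf (mu i) a = (if a \<in> blocks i then pp a * sgr (3 - i) / sgr i else 0)"
  unfolding mu_def
proof (rule pmf_embed_pmf)
  have p: "sgr i > 0" "sgr (3 - i) > 0" using i sgr_pos[of i] sgr_pos[of "3 - i"] by auto
  show "0 \<le> (if a \<in> blocks i then pp a * sgr (3 - i) / sgr i else 0)" for a
    using p pp_nonneg by simp
  have "(\<integral>\<^sup>+a. ennreal (if a \<in> blocks i then pp a * sgr (3 - i) / sgr i else 0) \<partial>count_space UNIV) =
      (\<integral>\<^sup>+a. ennreal (pp a * sgr (3 - i) / sgr i) \<partial>count_space (blocks i))"
    by (subst nn_integral_count_space_indicator) (auto intro!: nn_integral_cong split: split_indicator)
  also have "\<dots> = (\<integral>\<^sup>+a. ennreal (1 / sgr i) * (ennreal (pp a) * sg (3 - i)) \<partial>count_space (blocks i))"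
    using p pp_nonneg by (intro nn_integral_cong) (simp add: sg_sgr flip: ennreal_mult)
  also have "\<dots> = ennreal (1 / sgr i) * sg i"
    by (simp add: nn_integral_cmult block_mass[OF i])
  also have "\<dots> = 1" using p by (simp add: sg_sgr flip: ennreal_mult)
  finally show "(\<integral>\<^sup>+a. ennreal (if a \<in> blocks i then pp a * sgr (3 - i) / sgr i else 0) \<partial>count_space UNIV) = 1" .
qed

lemma set_mu: "i \<in> {1, 2} \<Longrightarrow> set_pmf (mu i) \<subseteq> blocks i"
  unfolding set_pmf_eq by (simp only: pmf_mu) (auto split: if_splits)

lemma emeasure_H_Suc:
  assumes h: "h \<in> hists k" and k: "k \<ge> 1" and a: "a \<in> blocks (opp h)"
  shows "emeasure M {\<omega> \<in> space M. H (Suc k) \<omega> = ext h a} =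
    emeasure M {\<omega> \<in> space M. H k \<omega> = h} * ennreal (pmf (mu (opp h)) a)"
proof -
  have p: "sgr (opp h) > 0" "sgr (3 - opp h) > 0"
    using sgr_pos[OF opp_range] sgr_pos[OF opp_12[OF opp_range]] by blast+
  have "pmf (mu (opp h)) a = pp a * sgr (3 - opp h) / sgr (opp h)"
    using a by (simp only: pmf_mu[OF opp_range] if_True)
  then have "ennreal (pp a) * sg (3 - opp h) = sg (opp h) * ennreal (pmf (mu (opp h)) a)"
    using p pp_nonneg[of a] unfolding sg_sgr by (simp flip: ennreal_mult)
  then show ?thesis unfolding emeasure_H_ext[OF assms] emeasure_H[OF h k] by (simp only: mult.assoc)
qed

end


section \<open>Markov chains driven by the blocks\<close>

primrec iter_kernel :: "('s \<Rightarrow> 's pmf) \<Rightarrow> nat \<Rightarrow> 's \<Rightarrow> 's pmf" where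
  "iter_kernel Q 0 s = return_pmf s"
| "iter_kernel Q (Suc m) s = bind_pmf (Q s) (iter_kernel Q m)"

text \<open>
  A function of the history whose new value depends on the old value and on the new block only is a
  Markov chain, since the law of the new block depends on the type of the old history only.
\<close>

locale block_chain = transient_walk V rt p \<alpha> M X
  for V :: "nat \<Rightarrow> 'a set" and rt p \<alpha> and M :: "'w measure" and X +
  fixes \<Psi> :: "'a list list \<Rightarrow> 'a \<times> 'b" and T :: "'a \<times> 'b \<Rightarrow> 'a list list \<Rightarrow> 'a \<times> 'b"
  assumes upd: "\<And>h k a. h \<in> hists k \<Longrightarrow> k \<ge> 1 \<Longrightarrow> a \<in> blocks (opp h) \<Longrightarrow> \<Psi> (ext h a) = T (\<Psi> h) a"
    and fst_\<Psi>: "\<And>h. fst (\<Psi> h) = last (last h)"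
begin

definition Q :: "'a \<times> 'b \<Rightarrow> ('a \<times> 'b) pmf" where
  "Q s = map_pmf (T s) (mu (3 - ty (fst s)))"

lemma Q_\<Psi>: "Q (\<Psi> h) = map_pmf (T (\<Psi> h)) (mu (opp h))"
  by (simp add: Q_def fst_\<Psi> wty_def)

abbreviation "Y k \<omega> \<equiv> \<Psi> (H k \<omega>)"

lemma Y_measurable [measurable]: "Y k \<in> measurable M (count_space UNIV)"
  using H_fun_measurable .

lemma Y_pred [measurable]: "Measurable.pred M (\<lambda>\<omega>. Y k \<omega> = s)"
  using H_pred[of "\<lambda>h. \<Psi> h = s" k] by simp

lemma emeasure_H_Y:
  "h \<in> hists k \<Longrightarrow> k \<ge> 1 \<Longrightarrow> emeasure M {\<omega> \<in> space M. H k \<omega> = h \<and> Y (k + m) \<omega> = t} =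
    emeasure M {\<omega> \<in> space M. H k \<omega> = h} * ennreal (pmf (iter_kernel Q m (\<Psi> h)) t)"
proof (induction m arbitrary: k h)
  case 0
  have "{\<omega> \<in> space M. H k \<omega> = h \<and> Y (k + 0) \<omega> = t} = (if \<Psi> h = t then {\<omega> \<in> space M. H k \<omega> = h} else {})"
    by auto
  then show ?case by (auto simp: indicator_def)
next
  case (Suc m)
  let ?c = "emeasure M {\<omega> \<in> space M. H k \<omega> = h}"
  have "emeasure M {\<omega> \<in> space M. H k \<omega> = h \<and> Y (k + Suc m) \<omega> = t} =
    (\<integral>\<^sup>+a. emeasure M {\<omega> \<in> space M. H (Suc k) \<omega> = ext h a \<and> Y (Suc k + m) \<omega> = t} \<partial>count_space (blocks (opp h)))"
    using emeasure_H_split[OF Suc.prems Y_pred] by simp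
  also have "\<dots> = (\<integral>\<^sup>+a. ?c * (ennreal (pmf (mu (opp h)) a) * ennreal (pmf (iter_kernel Q m (T (\<Psi> h) a)) t))
      \<partial>count_space (blocks (opp h)))"
  proof (intro nn_integral_cong)
    fix a assume "a \<in> space (count_space (blocks (opp h)))"
    then have a: "a \<in> blocks (opp h)" by simp
    show "emeasure M {\<omega> \<in> space M. H (Suc k) \<omega> = ext h a \<and> Y (Suc k + m) \<omega> = t} =
      ?c * (ennreal (pmf (mu (opp h)) a) * ennreal (pmf (iter_kernel Q m (T (\<Psi> h) a)) t))"
      using Suc.IH[OF ext_in_hists[OF Suc.prems a]] upd[OF Suc.prems a] emeasure_H_Suc[OF Suc.prems a]
      by (simp add: mult.assoc)
  qed
  also have "\<dots> = ?c * (\<integral>\<^sup>+a. ennreal (pmf (mu (opp h)) a) * ennreal (pmf (iter_kernel Q m (T (\<Psi> h) a)) t)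
      \<partial>count_space (blocks (opp h)))"
    by (simp add: nn_integral_cmult)
  also have "(\<integral>\<^sup>+a. ennreal (pmf (mu (opp h)) a) * ennreal (pmf (iter_kernel Q m (T (\<Psi> h) a)) t)
      \<partial>count_space (blocks (opp h))) = (\<integral>\<^sup>+a. pmf (iter_kernel Q m (T (\<Psi> h) a)) t \<partial>measure_pmf (mu (opp h)))"
    unfolding nn_integral_measure_pmf
    by (subst nn_integral_count_space_indicator)
       (auto intro!: nn_integral_cong simp: pmf_mu[OF opp_range] split: split_indicator)
  also have "\<dots> = ennreal (pmf (iter_kernel Q (Suc m) (\<Psi> h)) t)"
    by (simp add: Q_\<Psi> bind_map_pmf ennreal_pmf_bind)
  finally show ?case .
qed

lemma emeasure_Y_Y:
  assumes k: "k \<ge> 1"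
  shows "emeasure M {\<omega> \<in> space M. Y k \<omega> = s \<and> Y (k + m) \<omega> = t} =
    emeasure M {\<omega> \<in> space M. Y k \<omega> = s} * ennreal (pmf (iter_kernel Q m s) t)"
proof -
  let ?I = "{h \<in> hists k. \<Psi> h = s}"
  have c: "countable ?I" using countable_hists by (rule countable_subset[rotated]) auto
  have *: "emeasure M {\<omega> \<in> space M. Y k \<omega> = s \<and> R \<omega>} =
      (\<integral>\<^sup>+h. emeasure M {\<omega> \<in> space M. H k \<omega> = h \<and> R \<omega>} \<partial>count_space ?I)"
    if [measurable]: "Measurable.pred M R" for R
  proof -
    define B where "B g \<longleftrightarrow> (\<exists>h\<in>?I. g = h)" for g
    have [measurable]: "Measurable.pred M (\<lambda>\<omega>. B (H k \<omega>))" by (rule H_pred)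
    have "AE \<omega> in M. Y k \<omega> = s \<and> R \<omega> \<longleftrightarrow> B (H k \<omega>) \<and> R \<omega>"
      using AE_H_hists by eventually_elim (use k in \<open>auto simp: B_def\<close>)
    then have "emeasure M {\<omega> \<in> space M. Y k \<omega> = s \<and> R \<omega>} =
        emeasure M {\<omega> \<in> space M. B (H k \<omega>) \<and> R \<omega>}"
      by (rule AE_emeasure_cong) measurable
    also have "{\<omega> \<in> space M. B (H k \<omega>) \<and> R \<omega>} = (\<Union>h\<in>?I. {\<omega> \<in> space M. H k \<omega> = h \<and> R \<omega>})"
      unfolding B_def by blast
    also have "emeasure M \<dots> = (\<integral>\<^sup>+h. emeasure M {\<omega> \<in> space M. H k \<omega> = h \<and> R \<omega>} \<partial>count_space ?I)"
    proof (rule emeasure_UN_countable[OF _ c])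
      show "{\<omega> \<in> space M. H k \<omega> = h \<and> R \<omega>} \<in> sets M" for h by measurable
    qed (auto simp: disjoint_family_on_def)
    finally show ?thesis .
  qed
  have "emeasure M {\<omega> \<in> space M. Y k \<omega> = s \<and> Y (k + m) \<omega> = t} =
      (\<integral>\<^sup>+h. emeasure M {\<omega> \<in> space M. H k \<omega> = h \<and> True} * ennreal (pmf (iter_kernel Q m s) t) \<partial>count_space ?I)"
    unfolding *[OF Y_pred] using emeasure_H_Y[OF _ k] by (intro nn_integral_cong) auto
  also have "\<dots> = emeasure M {\<omega> \<in> space M. Y k \<omega> = s \<and> True} * ennreal (pmf (iter_kernel Q m s) t)"
    using *[of "\<lambda>_. True"] by (subst nn_integral_multc) auto
  finally show ?thesis by simp
qed

lemma prob_Y_Y: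
  "k \<ge> 1 \<Longrightarrow> prob {\<omega> \<in> space M. Y k \<omega> = s \<and> Y (k + m) \<omega> = t} =
    prob {\<omega> \<in> space M. Y k \<omega> = s} * pmf (iter_kernel Q m s) t"
  using emeasure_Y_Y[of k s m t] by (simp add: emeasure_eq_measure flip: ennreal_mult)

end

section \<open>A law of large numbers from variance bounds\<close>

lemma cesaro_null:
  fixes a :: "nat \<Rightarrow> real"
  assumes "a \<longlonglongrightarrow> 0"
  shows "(\<lambda>n. (\<Sum>k<n. a k) / real n) \<longlonglongrightarrow> 0"
proof (rule LIMSEQ_I)
  fix e :: real assume e: "e > 0"
  then obtain N where N: "\<bar>a k\<bar> < e / 2" if "k \<ge> N" for k
    using LIMSEQ_D[OF assms, of "e / 2"] by auto
  define C where "C = (\<Sum>k<N. \<bar>a k\<bar>)"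
  obtain n0 :: nat where n0: "2 * C / e < real n0" using reals_Archimedean2 by blast
  show "\<exists>no. \<forall>n\<ge>no. norm ((\<Sum>k<n. a k) / real n - 0) < e"
  proof (intro exI[of _ "N + n0 + 1"] allI impI)
    fix n assume n: "n \<ge> N + n0 + 1"
    have "(\<Sum>k<n. \<bar>a k\<bar>) = C + (\<Sum>k\<in>{N..<n}. \<bar>a k\<bar>)"
      unfolding C_def using n by (subst sum.union_disjoint[symmetric]) (auto intro!: sum.cong)
    also have "(\<Sum>k\<in>{N..<n}. \<bar>a k\<bar>) \<le> (\<Sum>k\<in>{N..<n}. e / 2)"
      using N by (intro sum_mono) (auto intro: less_imp_le)
    also have "\<dots> \<le> real n * (e / 2)" using e n by (simp add: of_nat_diff mult_right_mono)
    finally have "\<bar>\<Sum>k<n. a k\<bar> \<le> C + real n * (e / 2)"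
      using sum_abs[of a "{..<n}"] by linarith
    moreover have "C < real n * (e / 2)"
    proof -
      have "2 * C / e < real n" using n0 n by linarith
      then show ?thesis using e by (simp add: field_simps)
    qed
    ultimately have "\<bar>\<Sum>k<n. a k\<bar> < e * real n" by (simp add: field_simps)
    then show "norm ((\<Sum>k<n. a k) / real n - 0) < e" using n by (simp add: field_simps)
  qed
qed

lemma cesaro:
  fixes a :: "nat \<Rightarrow> real"
  assumes "a \<longlonglongrightarrow> L"
  shows "(\<lambda>n. (\<Sum>k<n. a k) / real n) \<longlonglongrightarrow> L"
proof -
  have "(\<lambda>n. (\<Sum>k<n. a k - L) / real n) \<longlonglongrightarrow> 0"
    using assms by (intro cesaro_null) (simp add: LIM_zero)
  then have "(\<lambda>n. (\<Sum>k<n. a k - L) / real n + L) \<longlonglongrightarrow> 0 + L" by (intro tendsto_intros)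
  moreover have "eventually (\<lambda>n. (\<Sum>k<n. a k - L) / real n + L = (\<Sum>k<n. a k) / real n) sequentially"
    using eventually_gt_at_top[of 0] by eventually_elim (simp add: sum_subtractf field_simps)
  ultimately show ?thesis by (simp add: filterlim_cong)
qed

text \<open>
  Averages of nonnegative terms with bounded centerings converge as soon as they do so along
  \<open>(i + 1) ^ q\<close>: partial sums are monotone and consecutive indices have ratio tending to 1.
\<close>

lemma averages_interpolation:
  fixes s m :: "nat \<Rightarrow> real"
  assumes s: "\<And>k. s k \<ge> 0" and m: "\<And>k. m k \<ge> 0" "\<And>k. m k \<le> B" and q: "q \<ge> 1"
    and lim: "(\<lambda>i. ((\<Sum>k<Suc i ^ q. s k) - (\<Sum>k<Suc i ^ q. m k)) / real (Suc i ^ q)) \<longlonglongrightarrow> 0"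
  shows "(\<lambda>n. ((\<Sum>k<n. s k) - (\<Sum>k<n. m k)) / real n) \<longlonglongrightarrow> 0"
proof (rule LIMSEQ_I)
  fix e :: real assume e: "e > 0"
  define S where "S n = (\<Sum>k<n. s k)" for n
  define Z where "Z n = (\<Sum>k<n. m k)" for n
  define N where "N i = Suc i ^ q" for i
  define a where "a i = (S (N i) - Z (N i)) / real (N i)" for i
  define r where "r i = real (N (Suc i)) / real (N i)" for i
  define E where "E i = \<bar>a i\<bar> + \<bar>a (Suc i)\<bar> * r i + B * (r i - 1)" for i
  have a0: "a \<longlonglongrightarrow> 0" using lim by (simp add: a_def[abs_def] S_def Z_def N_def)
  have "(\<lambda>i. (real (Suc (Suc i)) / real (Suc i)) ^ q) \<longlonglongrightarrow> 1 ^ q"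
    by (intro tendsto_power LIMSEQ_Suc[OF LIMSEQ_Suc_n_over_n])
  then have r1: "r \<longlonglongrightarrow> 1" by (simp add: r_def[abs_def] N_def power_divide)
  have "E \<longlonglongrightarrow> \<bar>0\<bar> + \<bar>0\<bar> * 1 + B * (1 - 1)"
    unfolding E_def[abs_def] by (intro tendsto_intros a0 r1 LIMSEQ_Suc[OF a0])
  then have "E \<longlonglongrightarrow> 0" by simp
  from LIMSEQ_D[OF this e] obtain I where I: "\<And>i. i \<ge> I \<Longrightarrow> \<bar>E i\<bar> < e" by auto
  have N1: "N i \<ge> 1" for i by (simp add: N_def)
  have Smono: "S x \<le> S y" if "x \<le> y" for x y
    unfolding S_def using that s by (intro sum_mono2) auto
  have Zmono: "Z x \<le> Z y" "Z y - Z x \<le> B * (real y - real x)" if "x \<le> y" for x y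
  proof -
    show "Z x \<le> Z y" unfolding Z_def using that m by (intro sum_mono2) auto
    have "Z y = Z x + (\<Sum>k\<in>{x..<y}. m k)"
      unfolding Z_def using that by (subst sum.union_disjoint[symmetric]) (auto intro!: sum.cong)
    also have "(\<Sum>k\<in>{x..<y}. m k) \<le> (\<Sum>k\<in>{x..<y}. B)" using m by (intro sum_mono) auto
    finally show "Z y - Z x \<le> B * (real y - real x)" using that by (simp add: of_nat_diff mult.commute)
  qed
  show "\<exists>no. \<forall>n\<ge>no. norm (((\<Sum>k<n. s k) - (\<Sum>k<n. m k)) / real n - 0) < e"
  proof (intro exI[of _ "N (Suc I)"] allI impI)
    fix n assume n: "n \<ge> N (Suc I)"
    define j where "j = (LEAST j. n < N j)"
    have "Suc n ^ 1 \<le> Suc n ^ q" using q by (intro power_increasing) auto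
    then have "n < N n" unfolding N_def by simp
    then have j: "n < N j" unfolding j_def by (rule LeastI)
    have "j \<noteq> 0" using j n N1[of "Suc I"] by (auto simp: N_def intro: ccontr)
    then obtain i where i: "j = Suc i" by (cases j) auto
    have "\<not> n < N i" using not_less_Least[of i "\<lambda>j. n < N j"] i by (simp add: j_def)
    then have ni: "N i \<le> n" "n < N (Suc i)" using j i by auto
    have iI: "i \<ge> I"
    proof (rule ccontr)
      assume "\<not> i \<ge> I"
      then have "N (Suc i) \<le> N (Suc I)" unfolding N_def by (intro power_mono) auto
      then show False using ni n by simp
    qed
    have npos: "real n > 0" "real (N i) > 0" using N1[of i] ni by simp_all
    have B0: "B \<ge> 0" using m[of 0] by linarith
    have aN: "S (N i) - Z (N i) = a i * real (N i)" for i
      using N1[of i] by (simp add: a_def)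
    have rN: "real (N (Suc i)) = r i * real (N i)" using N1[of i] by (simp add: r_def)
    have r_ge: "r i \<ge> 1" using ni npos by (simp add: r_def)
    have "S n - Z n \<le> S (N (Suc i)) - Z (N (Suc i)) + (Z (N (Suc i)) - Z (N i))"
      using Smono[of n "N (Suc i)"] Zmono(1)[of "N i" n] ni by linarith
    also have "\<dots> \<le> \<bar>a (Suc i)\<bar> * real (N (Suc i)) + B * (real (N (Suc i)) - real (N i))"
      using Zmono(2)[of "N i" "N (Suc i)"] ni unfolding aN
      by (intro add_mono) (auto intro: mult_right_mono)
    also have "\<dots> = (\<bar>a (Suc i)\<bar> * r i + B * (r i - 1)) * real (N i)"
      unfolding rN by (simp add: algebra_simps)
    also have "\<dots> \<le> E i * real (N i)" unfolding E_def by (intro mult_right_mono) auto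
    finally have up: "S n - Z n \<le> E i * real (N i)" .
    have "Z n - S n \<le> Z (N i) - S (N i) + (Z (N (Suc i)) - Z (N i))"
      using Smono[of "N i" n] Zmono(1)[of n "N (Suc i)"] ni by linarith
    also have "\<dots> \<le> \<bar>a i\<bar> * real (N i) + B * (real (N (Suc i)) - real (N i))"
    proof (intro add_mono)
      have "Z (N i) - S (N i) = (- a i) * real (N i)" using aN[of i] by simp
      also have "\<dots> \<le> \<bar>a i\<bar> * real (N i)" by (intro mult_right_mono) auto
      finally show "Z (N i) - S (N i) \<le> \<bar>a i\<bar> * real (N i)" .
    qed (use Zmono(2)[of "N i" "N (Suc i)"] ni in auto)
    also have "\<dots> = (\<bar>a i\<bar> + B * (r i - 1)) * real (N i)"
      unfolding rN by (simp add: algebra_simps)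
    also have "\<dots> \<le> E i * real (N i)"
      unfolding E_def using r_ge by (intro mult_right_mono) auto
    finally have "\<bar>S n - Z n\<bar> \<le> E i * real (N i)" using up by linarith
    moreover have "E i \<ge> 0" unfolding E_def using r_ge B0 by auto
    then have "E i * real (N i) \<le> E i * real n" using ni by (intro mult_left_mono) auto
    ultimately have "\<bar>S n - Z n\<bar> / real n \<le> E i" using npos by (simp add: field_simps)
    then have "\<bar>S n - Z n\<bar> / real n < e" using I[OF iI] by linarith
    then show "norm (((\<Sum>k<n. s k) - (\<Sum>k<n. m k)) / real n - 0) < e"
      by (simp add: S_def Z_def)
  qed
qed

lemma (in prob_space) lln_of_variance:
  fixes U :: "nat \<Rightarrow> 'a \<Rightarrow> real"
  assumes U [measurable]: "\<And>k. U k \<in> borel_measurable M"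
    and U0: "\<And>k \<omega>. 0 \<le> U k \<omega>" and Ub: "\<And>k \<omega>. U k \<omega> \<le> b k"
    and UB: "\<And>k. expectation (U k) \<le> B" and D: "D \<ge> 0" and \<gamma>: "\<gamma> > 0"
    and var: "\<And>n. n \<ge> 1 \<Longrightarrow>
      expectation (\<lambda>\<omega>. ((\<Sum>k<n. U k \<omega>) - (\<Sum>k<n. expectation (U k)))\<^sup>2) \<le> D * real n powr (2 - \<gamma>)"
  shows "AE \<omega> in M. (\<lambda>n. ((\<Sum>k<n. U k \<omega>) - (\<Sum>k<n. expectation (U k))) / real n) \<longlonglongrightarrow> 0"
proof -
  obtain q0 :: nat where q0: "2 / \<gamma> < real q0" using reals_Archimedean2 by blast
  define q where "q = max 1 q0"
  have q: "q \<ge> 1" "real q * \<gamma> \<ge> 2" 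
  proof -
    have "2 \<le> real q0 * \<gamma>" using q0 \<gamma> by (simp add: field_simps)
    also have "\<dots> \<le> real q * \<gamma>" using \<gamma> by (intro mult_right_mono) (auto simp: q_def)
    finally show "real q * \<gamma> \<ge> 2" .
  qed (simp add: q_def)
  define N where "N i = Suc i ^ q" for i
  have N1: "N i \<ge> 1" for i by (simp add: N_def)
  define G where "G n \<omega> = (\<Sum>k<n. U k \<omega>) - (\<Sum>k<n. expectation (U k))" for n \<omega>
  define Z where "Z i \<omega> = G (N i) \<omega> / real (N i)" for i \<omega>
  have [measurable]: "G n \<in> borel_measurable M" for n unfolding G_def[abs_def] by measurable
  have [measurable]: "Z i \<in> borel_measurable M" for i unfolding Z_def[abs_def] by measurable
  have Gb: "\<bar>G n \<omega>\<bar> \<le> (\<Sum>k<n. b k) + \<bar>\<Sum>k<n. expectation (U k)\<bar>" for n \<omega>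
  proof -
    have "(\<Sum>k<n. U k \<omega>) \<le> (\<Sum>k<n. b k)" "(\<Sum>k<n. U k \<omega>) \<ge> 0"
      by (auto intro!: sum_mono sum_nonneg Ub U0)
    then show ?thesis unfolding G_def by linarith
  qed
  have int: "integrable M (\<lambda>\<omega>. (Z i \<omega>)\<^sup>2)" for i
  proof (rule integrable_const_bound)
    let ?c = "((\<Sum>k<N i. b k) + \<bar>\<Sum>k<N i. expectation (U k)\<bar>) / real (N i)"
    have "\<bar>Z i \<omega>\<bar> \<le> ?c" for \<omega>
      using Gb[of "N i" \<omega>] by (simp add: Z_def divide_right_mono)
    then have "(Z i \<omega>)\<^sup>2 \<le> ?c\<^sup>2" for \<omega> by (metis abs_ge_zero power2_abs power_mono)
    then show "AE \<omega> in M. norm ((Z i \<omega>)\<^sup>2) \<le> ?c\<^sup>2" by simp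
  qed measurable
  have EZ: "expectation (\<lambda>\<omega>. (Z i \<omega>)\<^sup>2) \<le> D * real (Suc i) powr (-2)" for i
  proof -
    have "expectation (\<lambda>\<omega>. (Z i \<omega>)\<^sup>2) = expectation (\<lambda>\<omega>. (G (N i) \<omega>)\<^sup>2) / (real (N i))\<^sup>2"
      by (simp add: Z_def power_divide)
    also have "\<dots> \<le> D * real (N i) powr (2 - \<gamma>) / (real (N i))\<^sup>2"
      using var[OF N1, of i] by (intro divide_right_mono) (auto simp: G_def)
    also have "\<dots> = D * real (N i) powr (- \<gamma>)"
    proof -
      have "(real (N i))\<^sup>2 = real (N i) powr 2" using N1[of i] by (simp add: powr_numeral)
      moreover have "real (N i) powr (2 - \<gamma>) = real (N i) powr 2 * real (N i) powr (- \<gamma>)"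
        using powr_add[of "real (N i)" 2 "- \<gamma>"] by simp
      ultimately show ?thesis using N1[of i] by simp
    qed
    also have "real (N i) powr (- \<gamma>) = real (Suc i) powr (- (real q * \<gamma>))"
    proof -
      have "real (N i) = real (Suc i) powr real q"
        by (simp only: N_def of_nat_power powr_realpow[of "real (Suc i)" q, OF of_nat_0_less_iff[THEN iffD2, OF zero_less_Suc]])
      then show ?thesis by (simp only: powr_powr) simp
    qed
    also have "\<dots> \<le> real (Suc i) powr (-2)" using q by (intro powr_mono) auto
    finally show ?thesis using D by (simp add: mult_left_mono)
  qed
  have sm: "summable (\<lambda>i. D * real (Suc i) powr (-2))"
    using summable_real_powr_iff[of "-2"] summable_Suc_iff[of "\<lambda>i. real i powr (-2)"]
    by (intro summable_mult) simp
  have "(\<integral>\<^sup>+\<omega>. (\<Sum>i. ennreal ((Z i \<omega>)\<^sup>2)) \<partial>M) = (\<Sum>i. \<integral>\<^sup>+\<omega>. ennreal ((Z i \<omega>)\<^sup>2) \<partial>M)"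
    by (rule nn_integral_suminf) measurable
  also have "\<dots> \<le> (\<Sum>i. ennreal (D * real (Suc i) powr (-2)))"
    using EZ by (intro suminf_le summableI) (auto simp: nn_integral_eq_integral[OF int] intro!: ennreal_leI)
  also have "\<dots> < \<top>"
    using D by (subst suminf_ennreal2[OF _ sm]) auto
  finally have "(\<integral>\<^sup>+\<omega>. (\<Sum>i. ennreal ((Z i \<omega>)\<^sup>2)) \<partial>M) \<noteq> \<infinity>" by simp
  then have "AE \<omega> in M. (\<Sum>i. ennreal ((Z i \<omega>)\<^sup>2)) \<noteq> \<infinity>"
    by (intro nn_integral_PInf_AE) measurable
  then show ?thesis
  proof eventually_elim
    case (elim \<omega>)
    then have "summable (\<lambda>i. (Z i \<omega>)\<^sup>2)" by (intro summable_suminf_not_top) auto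
    then have "(\<lambda>i. sqrt ((Z i \<omega>)\<^sup>2)) \<longlonglongrightarrow> sqrt 0"
      by (intro tendsto_real_sqrt summable_LIMSEQ_zero)
    then have "(\<lambda>i. Z i \<omega>) \<longlonglongrightarrow> 0" by (simp add: tendsto_rabs_zero_iff)
    then have lim: "(\<lambda>i. ((\<Sum>k<Suc i ^ q. U k \<omega>) - (\<Sum>k<Suc i ^ q. expectation (U k))) / real (Suc i ^ q)) \<longlonglongrightarrow> 0"
      by (simp only: Z_def G_def N_def)
    show ?case
      by (rule averages_interpolation[OF U0 _ UB q(1) lim]) (simp add: U0)
  qed
qed

lemma (in prob_space) distr_eq_pmf:
  assumes [measurable]: "Z \<in> measurable M (count_space UNIV)"
    and eq: "\<And>s. prob {\<omega> \<in> space M. Z \<omega> = s} = pmf q s"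
  shows "distr M (count_space UNIV) Z = measure_pmf q"
proof (rule measure_eqI_countable_AE)
  have m: "{\<omega> \<in> space M. Z \<omega> \<in> A} \<in> sets M" for A
    using measurable_sets[OF assms(1), of A] by (simp add: vimage_def Int_def conj_commute)
  have "emeasure M {\<omega> \<in> space M. Z \<omega> \<in> set_pmf q} = emeasure M (\<Union>s\<in>set_pmf q. {\<omega> \<in> space M. Z \<omega> = s})"
    by (rule arg_cong[where f = "emeasure M"]) auto
  also have "\<dots> = (\<integral>\<^sup>+s. emeasure M {\<omega> \<in> space M. Z \<omega> = s} \<partial>count_space (set_pmf q))"
    using m[of "{_}"] by (intro emeasure_UN_countable) (auto simp: disjoint_family_on_def)
  also have "\<dots> = (\<integral>\<^sup>+s. ennreal (pmf q s) \<partial>count_space (set_pmf q))"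
    by (simp add: emeasure_eq_measure eq)
  also have "\<dots> = 1"
    by (simp add: nn_integral_pmf emeasure_pmf)
  finally have "AE \<omega> in M. Z \<omega> \<in> set_pmf q"
    using m[of "set_pmf q"] by (intro AE_I_eq_1) auto
  then show "AE x in distr M (count_space UNIV) Z. x \<in> set_pmf q"
    by (subst AE_distr_iff) auto
  show "emeasure (distr M (count_space UNIV) Z) {x} = emeasure (measure_pmf q) {x}" for x
    using eq[of x] by (subst emeasure_distr)
      (auto simp: emeasure_eq_measure emeasure_pmf_single vimage_def Int_def conj_commute)
qed (auto simp: AE_measure_pmf)

lemma (in prob_space) ex_law:
  assumes Z [measurable]: "Z \<in> measurable M (count_space UNIV)"
    and S: "countable S" "AE \<omega> in M. Z \<omega> \<in> S"
  obtains q where "distr M (count_space UNIV) Z = measure_pmf q" "set_pmf q \<subseteq> S"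
    "\<And>s. pmf q s = prob {\<omega> \<in> space M. Z \<omega> = s}"
proof -
  have m: "{\<omega> \<in> space M. Z \<omega> \<in> A} \<in> sets M" for A
    using measurable_sets[OF Z, of A] by (simp add: vimage_def Int_def conj_commute)
  define q where "q = embed_pmf (\<lambda>s. prob {\<omega> \<in> space M. Z \<omega> = s})"
  have z: "prob {\<omega> \<in> space M. Z \<omega> = s} = 0" if "s \<notin> S" for s
    using S(2) that m[of "{s}"] by (intro iffD2[OF prob_eq_0]) auto
  have "(\<integral>\<^sup>+s. ennreal (prob {\<omega> \<in> space M. Z \<omega> = s}) \<partial>count_space UNIV) =
      (\<integral>\<^sup>+s. emeasure M {\<omega> \<in> space M. Z \<omega> = s} \<partial>count_space S)"
    unfolding emeasure_eq_measure
    by (subst (2) nn_integral_count_space_indicator)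
       (auto intro!: nn_integral_cong simp: z split: split_indicator)
  also have "\<dots> = emeasure M (\<Union>s\<in>S. {\<omega> \<in> space M. Z \<omega> = s})"
    using m[of "{_}"] by (intro emeasure_UN_countable[symmetric] S) (auto simp: disjoint_family_on_def)
  also have "(\<Union>s\<in>S. {\<omega> \<in> space M. Z \<omega> = s}) = {\<omega> \<in> space M. Z \<omega> \<in> S}" by auto
  also have "emeasure M \<dots> = 1" using S(2) m[of S] by (intro emeasure_eq_1_AE) auto
  finally have p: "pmf q s = prob {\<omega> \<in> space M. Z \<omega> = s}" for s
    unfolding q_def by (intro pmf_embed_pmf) auto
  have "distr M (count_space UNIV) Z = measure_pmf q" by (rule distr_eq_pmf) (simp_all add: p)
  moreover have "set_pmf q \<subseteq> S" 
  proof
    fix s assume "s \<in> set_pmf q"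
    then have "pmf q s \<noteq> 0" by (simp add: set_pmf_iff)
    then show "s \<in> S" unfolding p using z by blast
  qed
  ultimately show ?thesis using that p by blast
qed

section \<open>Chains that forget their initial state\<close>

abbreviation "Ep q g \<equiv> measure_pmf.expectation q g"

lemma integrable_pmf_bounded:
  fixes g :: "'s \<Rightarrow> real"
  assumes "\<And>s. s \<in> set_pmf q \<Longrightarrow> \<bar>g s\<bar> \<le> b"
  shows "integrable (measure_pmf q) g"
  by (rule measure_pmf.integrable_const_bound[where B = b]) (use assms in \<open>auto simp: AE_measure_pmf_iff\<close>)

lemma Ep_bounds:
  fixes g :: "'s \<Rightarrow> real"
  assumes "\<And>s. s \<in> set_pmf q \<Longrightarrow> 0 \<le> g s" "\<And>s. s \<in> set_pmf q \<Longrightarrow> g s \<le> b"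
  shows "0 \<le> Ep q g" "Ep q g \<le> b"
proof -
  have i: "integrable (measure_pmf q) g"
    using assms by (intro integrable_pmf_bounded[of _ _ b]) (auto simp: abs_le_iff order.trans[of _ 0])
  show "0 \<le> Ep q g" using assms by (intro integral_nonneg_AE) (auto simp: AE_measure_pmf_iff)
  have "Ep q g \<le> Ep q (\<lambda>_. b)"
    using assms i by (intro integral_mono_AE) (auto simp: AE_measure_pmf_iff)
  then show "Ep q g \<le> b" by simp
qed

lemma Ep_mono:
  fixes g h :: "'s \<Rightarrow> real"
  assumes "integrable (measure_pmf q) g" "integrable (measure_pmf q) h" "\<And>s. s \<in> set_pmf q \<Longrightarrow> g s \<le> h s"
  shows "Ep q g \<le> Ep q h"
  using assms by (intro integral_mono_AE) (auto simp: AE_measure_pmf_iff)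

lemma Ep_abs_le:
  fixes g h :: "'s \<Rightarrow> real"
  assumes "integrable (measure_pmf q) h" "\<And>s. s \<in> set_pmf q \<Longrightarrow> \<bar>g s\<bar> \<le> h s"
  shows "\<bar>Ep q g\<bar> \<le> Ep q h"
proof -
  have g: "integrable (measure_pmf q) g"
    by (rule Bochner_Integration.integrable_bound[OF assms(1)]) (use assms(2) in \<open>force simp: AE_measure_pmf_iff\<close>)+
  have "\<bar>Ep q g\<bar> \<le> Ep q (\<lambda>s. \<bar>g s\<bar>)" by (rule integral_abs_bound)
  also have "\<dots> \<le> Ep q h" using g assms by (intro Ep_mono) auto
  finally show ?thesis .
qed

lemma Ep_bind:
  fixes u :: "'s \<Rightarrow> real"
  assumes u: "\<And>s. 0 \<le> u s" "\<And>s. u s \<le> b"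
  shows "Ep (bind_pmf q K) u = Ep q (\<lambda>s. Ep (K s) u)"
proof -
  have i: "integrable (measure_pmf q') u" for q'
    using u by (intro integrable_pmf_bounded[of _ _ b]) (simp add: abs_le_iff order.trans[of _ 0])
  have n: "0 \<le> Ep q' u" "Ep q' u \<le> b" for q' using Ep_bounds[of q' u b] u by auto
  have i2: "integrable (measure_pmf q) (\<lambda>s. Ep (K s) u)"
    using n by (intro integrable_pmf_bounded[of _ _ b]) simp
  have "ennreal (Ep (bind_pmf q K) u) = (\<integral>\<^sup>+s. \<integral>\<^sup>+t. ennreal (u t) \<partial>K s \<partial>q)"
    using u by (subst nn_integral_eq_integral[symmetric, OF i]) auto
  also have "\<dots> = (\<integral>\<^sup>+s. ennreal (Ep (K s) u) \<partial>q)"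
    using u by (intro nn_integral_cong nn_integral_eq_integral i) auto
  also have "\<dots> = ennreal (Ep q (\<lambda>s. Ep (K s) u))"
    using n by (intro nn_integral_eq_integral i2) auto
  finally show ?thesis using n Ep_bounds[of q "\<lambda>s. Ep (K s) u" b] by (subst (asm) ennreal_inj) auto
qed

lemma pmf_bind_Pair:
  "pmf (bind_pmf q (\<lambda>s. map_pmf (Pair s) (K s))) (s, t) = pmf q s * pmf (K s) t"
proof -
  have "ennreal (pmf (map_pmf (Pair x) (K x)) (s, t)) = ennreal (pmf (K s) t) * indicator {s} x" for x
    using pmf_map_inj'[of "Pair x" "K x" t] pmf_map_outside[of "(s, t)" "Pair x" "K x"]
    by (auto simp: inj_def split: split_indicator)
  then have "ennreal (pmf (bind_pmf q (\<lambda>s. map_pmf (Pair s) (K s))) (s, t)) =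
      (\<integral>\<^sup>+x. ennreal (pmf (K s) t) * indicator {s} x \<partial>q)"
    unfolding ennreal_pmf_bind by simp
  also have "\<dots> = ennreal (pmf q s * pmf (K s) t)"
    by (simp add: nn_integral_cmult emeasure_pmf_single ennreal_mult mult.commute)
  finally show ?thesis by simp
qed

lemma exp_moment_pmf:
  fixes \<kappa> :: "'s \<Rightarrow> nat"
  assumes R: "R > 1" and B: "(\<integral>\<^sup>+s. ennreal (R ^ \<kappa> s) \<partial>measure_pmf q) \<le> ennreal B" "B \<ge> 0"
  shows "integrable (measure_pmf q) (\<lambda>s. R ^ \<kappa> s)" "Ep q (\<lambda>s. R ^ \<kappa> s) \<le> B"
    "measure_pmf.prob q {s. m \<le> \<kappa> s} \<le> B / R ^ m"
proof -
  show i: "integrable (measure_pmf q) (\<lambda>s. R ^ \<kappa> s)"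
    using R B by (intro integrableI_nonneg) (auto simp: less_top[symmetric] top_unique intro!: le_less_trans[OF B(1)])
  have "ennreal (Ep q (\<lambda>s. R ^ \<kappa> s)) \<le> ennreal B"
    using B R by (subst nn_integral_eq_integral[symmetric, OF i]) auto
  then show e: "Ep q (\<lambda>s. R ^ \<kappa> s) \<le> B" using B by (simp add: ennreal_le_iff)
  have "measure_pmf.prob q {s. m \<le> \<kappa> s} * R ^ m = Ep q (\<lambda>s. indicator {s. m \<le> \<kappa> s} s * R ^ m)"
    by simp
  also have "\<dots> \<le> Ep q (\<lambda>s. R ^ \<kappa> s)"
    using i R by (intro Ep_mono integrable_mult_left)
      (auto simp: integrable_pmf_bounded[of _ _ 1] power_increasing split: split_indicator)
  finally show "measure_pmf.prob q {s. m \<le> \<kappa> s} \<le> B / R ^ m"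
    using e R by (simp add: field_simps)
qed

text \<open>
  \<open>Y\<close> is a chain with \<open>m\<close>-step kernels \<open>K m\<close> and alternating types \<open>\<tau>\<close>.  The size \<open>\<kappa>\<close> of a state
  has uniformly bounded exponential moments, and \<open>m\<close> steps make the chain forget an initial state
  of size less than \<open>m\<close> up to its type.
\<close>

locale coupled_chain = prob_space M
  for M :: "'w measure" +
  fixes Y :: "nat \<Rightarrow> 'w \<Rightarrow> 's" and K :: "nat \<Rightarrow> 's \<Rightarrow> 's pmf" and S :: "'s set"
    and \<kappa> \<tau> :: "'s \<Rightarrow> nat" and R B :: real
  assumes Y_meas [measurable]: "\<And>k. Y k \<in> measurable M (count_space UNIV)"
    and Y_range: "\<And>k. countable (Y k ` space M)"
    and Y_S: "\<And>k. AE \<omega> in M. Y k \<omega> \<in> S"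
    and two_times: "\<And>j m s t. prob {\<omega> \<in> space M. Y j \<omega> = s \<and> Y (j + m) \<omega> = t} =
      prob {\<omega> \<in> space M. Y j \<omega> = s} * pmf (K m s) t"
    and forget: "\<And>m s s'. s \<in> S \<Longrightarrow> s' \<in> S \<Longrightarrow> \<tau> s = \<tau> s' \<Longrightarrow> \<kappa> s < m \<Longrightarrow> \<kappa> s' < m \<Longrightarrow> K m s = K m s'"
    and R: "R > 1" and B: "B \<ge> 0"
    and moments: "\<And>k. (\<integral>\<^sup>+\<omega>. ennreal (R ^ \<kappa> (Y k \<omega>)) \<partial>M) \<le> ennreal B"
begin

definition law :: "nat \<Rightarrow> 's pmf" where
  "law k = (SOME q. distr M (count_space UNIV) (Y k) = measure_pmf q \<and> set_pmf q \<subseteq> S \<and>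
    (\<forall>s. pmf q s = prob {\<omega> \<in> space M. Y k \<omega> = s}))"

lemma law: "distr M (count_space UNIV) (Y k) = measure_pmf (law k)" "set_pmf (law k) \<subseteq> S"
  "pmf (law k) s = prob {\<omega> \<in> space M. Y k \<omega> = s}"
proof -
  have "\<exists>q. distr M (count_space UNIV) (Y k) = measure_pmf q \<and> set_pmf q \<subseteq> S \<and>
    (\<forall>s. pmf q s = prob {\<omega> \<in> space M. Y k \<omega> = s})"
  proof -
    have "AE \<omega> in M. Y k \<omega> \<in> S \<inter> Y k ` space M"
      using Y_S[of k] AE_space by eventually_elim auto
    then show ?thesis
      using ex_law[OF Y_meas[of k], of "S \<inter> Y k ` space M"] Y_range[of k] by (metis countable_Int2 le_inf_iff)
  qed
  from someI_ex[OF this] show "distr M (count_space UNIV) (Y k) = measure_pmf (law k)"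
    "set_pmf (law k) \<subseteq> S" "pmf (law k) s = prob {\<omega> \<in> space M. Y k \<omega> = s}"
    unfolding law_def by blast+
qed

lemma expectation_Y:
  fixes g :: "'s \<Rightarrow> real"
  shows "expectation (\<lambda>\<omega>. g (Y k \<omega>)) = Ep (law k) g"
  unfolding law(1)[symmetric] by (subst integral_distr) auto

lemma pair_measurable: "(\<lambda>\<omega>. (Y j \<omega>, Y (j + m) \<omega>)) \<in> measurable M (count_space UNIV)"
proof -
  have pY: "Measurable.pred M (\<lambda>\<omega>. Y k \<omega> = s)" for k s
    using measurable_compose[OF Y_meas[of k], of "\<lambda>x. x = s" "count_space UNIV"] by simp
    let ?Z = "\<lambda>\<omega>. (Y j \<omega>, Y (j + m) \<omega>)" and ?C = "Y j ` space M \<times> Y (j + m) ` space M"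
    have "?Z -` {(s, t)} \<inter> space M = {\<omega> \<in> space M. Y j \<omega> = s \<and> Y (j + m) \<omega> = t}" for s t
      by auto
    moreover have "{\<omega> \<in> space M. Y j \<omega> = s \<and> Y (j + m) \<omega> = t} \<in> sets M" for s t
      using pY[of j s] pY[of "j + m" t] by measurable
    ultimately have "?Z \<in> measurable M (count_space ?C)"
      by (subst measurable_count_space_eq_countable) (auto simp: Y_range)
  then show ?thesis
      using measurable_compose[of ?Z M "count_space ?C" "\<lambda>x. x" "count_space UNIV"] by simp
qed

lemma law_add: "law (j + m) = bind_pmf (law j) (K m)"
  and law_pair: "distr M (count_space UNIV) (\<lambda>\<omega>. (Y j \<omega>, Y (j + m) \<omega>)) =
    measure_pmf (bind_pmf (law j) (\<lambda>s. map_pmf (Pair s) (K m s)))"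
proof -
  show pr: "distr M (count_space UNIV) (\<lambda>\<omega>. (Y j \<omega>, Y (j + m) \<omega>)) =
    measure_pmf (bind_pmf (law j) (\<lambda>s. map_pmf (Pair s) (K m s)))"
  proof (rule distr_eq_pmf[OF pair_measurable])
    show "prob {\<omega> \<in> space M. (Y j \<omega>, Y (j + m) \<omega>) = z} =
        pmf (bind_pmf (law j) (\<lambda>s. map_pmf (Pair s) (K m s))) z" for z
      using two_times[of j "fst z" m "snd z"] law(3)[of j "fst z"]
        pmf_bind_Pair[of "law j" "K m" "fst z" "snd z"] by (cases z) auto
  qed
  have "measure_pmf (law (j + m)) = distr (distr M (count_space UNIV) (\<lambda>\<omega>. (Y j \<omega>, Y (j + m) \<omega>))) (count_space UNIV) snd"
    by (subst distr_distr) (use pair_measurable in \<open>auto simp: law(1)[symmetric] o_def\<close>)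
  also have "\<dots> = measure_pmf (map_pmf snd (bind_pmf (law j) (\<lambda>s. map_pmf (Pair s) (K m s))))"
    unfolding pr map_pmf_rep_eq ..
  also have "map_pmf snd (bind_pmf (law j) (\<lambda>s. map_pmf (Pair s) (K m s))) = bind_pmf (law j) (K m)"
    by (simp add: map_bind_pmf map_pmf_comp)
  finally show "law (j + m) = bind_pmf (law j) (K m)" by (simp add: measure_pmf_inject)
qed

end

context coupled_chain
begin

lemma law_moment: "(\<integral>\<^sup>+s. ennreal (R ^ \<kappa> s) \<partial>measure_pmf (law k)) \<le> ennreal B"
  unfolding law(1)[symmetric] using moments[of k] by (subst nn_integral_distr) auto

definition mid :: "nat \<Rightarrow> ('s \<Rightarrow> real) \<Rightarrow> nat \<Rightarrow> real" where
  "mid m v i = (if \<exists>s\<in>S. \<tau> s = i \<and> \<kappa> s < m then Ep (K m (SOME s. s \<in> S \<and> \<tau> s = i \<and> \<kappa> s < m)) v else 0)"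

lemma mid_eq:
  assumes "s \<in> S" "\<kappa> s < m"
  shows "Ep (K m s) v = mid m v (\<tau> s)"
proof -
  let ?s = "SOME s'. s' \<in> S \<and> \<tau> s' = \<tau> s \<and> \<kappa> s' < m"
  have "\<exists>s'. s' \<in> S \<and> \<tau> s' = \<tau> s \<and> \<kappa> s' < m" using assms by blast
  from someI_ex[OF this] have s: "?s \<in> S" "\<tau> ?s = \<tau> s" "\<kappa> ?s < m" by blast+
  have e: "K m s = K m ?s" using forget[of s ?s m] s assms by simp
  have "\<exists>s'\<in>S. \<tau> s' = \<tau> s \<and> \<kappa> s' < m" using assms by blast
  then have "mid m v (\<tau> s) = Ep (K m ?s) v" unfolding mid_def by (simp only: if_True)
  then show ?thesis unfolding e by simp
qed

lemma mid_bounds: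
  assumes "\<And>s. 0 \<le> v s" "\<And>s. v s \<le> b"
  shows "0 \<le> mid m v i" "mid m v i \<le> b"
proof -
  have "0 \<le> b" using assms order.trans by blast
  then show "0 \<le> mid m v i" "mid m v i \<le> b"
    using Ep_bounds[of _ v b] assms by (auto simp: mid_def)
qed

lemma deviation_mid:
  assumes v: "\<And>s. 0 \<le> v s" "\<And>s. v s \<le> b" and "s \<in> S"
  shows "\<bar>Ep (K m s) v - mid m v (\<tau> s)\<bar> \<le> b * indicator {s. m \<le> \<kappa> s} s"
proof (cases "\<kappa> s < m")
  case False
  have "0 \<le> Ep (K m s) v" "Ep (K m s) v \<le> b" using Ep_bounds[of "K m s" v b] v by auto
  then show ?thesis using False mid_bounds[of v b m "\<tau> s", OF v] by (simp add: abs_le_iff)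
qed (simp add: mid_eq[OF assms(3)])

end

text \<open>The special case of a deterministic initial type.\<close>

locale phase_chain = coupled_chain M Y K S \<kappa> \<tau> R B
  for M :: "'w measure" and Y and K :: "nat \<Rightarrow> 's \<Rightarrow> 's pmf" and S \<kappa> \<tau> R B +
  fixes ph :: "nat \<Rightarrow> nat"
  assumes ph: "\<And>k. AE \<omega> in M. \<tau> (Y k \<omega>) = ph k"
begin

lemma law_ph: "s \<in> set_pmf (law k) \<Longrightarrow> \<tau> s = ph k"
proof -
  have "AE s in distr M (count_space UNIV) (Y k). \<tau> s = ph k"
    using ph[of k] by (subst AE_distr_iff) auto
  then show "s \<in> set_pmf (law k) \<Longrightarrow> \<tau> s = ph k" unfolding law(1) by (simp add: AE_measure_pmf_iff)
qed

text \<open>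
  Given the state at time \<open>j\<close>, the expectation of a function at time \<open>j + m\<close> is a constant unless
  the state has size at least \<open>m\<close>; hence correlations decay exponentially.
\<close>

lemma covariance_decay:
  assumes u: "\<And>s. 0 \<le> u s" "\<And>s. u s \<le> b" and v: "\<And>s. 0 \<le> v s" "\<And>s. v s \<le> b"
  shows "\<bar>expectation (\<lambda>\<omega>. u (Y j \<omega>) * v (Y (j + m) \<omega>)) -
      expectation (\<lambda>\<omega>. u (Y j \<omega>)) * expectation (\<lambda>\<omega>. v (Y (j + m) \<omega>))\<bar> \<le> 2 * b\<^sup>2 * (B / R ^ m)"
proof -
  define g where "g s = Ep (K m s) v" for s
  define c where "c = mid m v (ph j)"
  let ?q = "law j"
  let ?T = "{s. m \<le> \<kappa> s}"
  have b: "0 \<le> b" using u order.trans by blast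
  have g: "0 \<le> g s" "g s \<le> b" for s using Ep_bounds[of "K m s" v b] v by (auto simp: g_def)
  have c: "0 \<le> c" "c \<le> b" using mid_bounds[of v b, OF v] by (auto simp: c_def)
  have iu: "integrable (measure_pmf q) u" for q
    using u by (intro integrable_pmf_bounded[of _ _ b]) (simp add: abs_le_iff order.trans[of _ 0])
  have ig: "integrable (measure_pmf q) g" for q
    using g by (intro integrable_pmf_bounded[of _ _ b]) simp
  have iug: "integrable (measure_pmf q) (\<lambda>s. u s * g s)" for q
    using u g b by (intro integrable_pmf_bounded[of _ _ "b * b"]) (simp add: abs_mult mult_mono)
  have "(\<integral>\<omega>. (\<lambda>(s, t). u s * v t) (Y j \<omega>, Y (j + m) \<omega>) \<partial>M) =
      Ep (bind_pmf ?q (\<lambda>s. map_pmf (Pair s) (K m s))) (\<lambda>(s, t). u s * v t)"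
  proof -
    have "(\<lambda>\<omega>. (Y j \<omega>, Y (j + m) \<omega>)) \<in> measurable M (count_space UNIV)"
      by (rule pair_measurable)
    then show ?thesis unfolding law_pair[symmetric] by (subst integral_distr) auto
  qed
  also have "\<dots> = Ep ?q (\<lambda>s. Ep (map_pmf (Pair s) (K m s)) (\<lambda>(s, t). u s * v t))"
    using u v b by (intro Ep_bind[of _ "b * b"]) (auto intro: mult_mono)
  also have "\<dots> = Ep ?q (\<lambda>s. u s * g s)" by (simp add: g_def)
  finally have E1: "expectation (\<lambda>\<omega>. u (Y j \<omega>) * v (Y (j + m) \<omega>)) = Ep ?q (\<lambda>s. u s * g s)" by simp
  have E2: "expectation (\<lambda>\<omega>. v (Y (j + m) \<omega>)) = Ep ?q g"
    unfolding expectation_Y law_add using v by (subst Ep_bind[of _ b]) (auto simp: g_def[abs_def])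
  have dev: "\<bar>g s - c\<bar> \<le> b * indicator ?T s" if "s \<in> set_pmf ?q" for s
    using deviation_mid[of v b s m, OF v] law(2)[of j] that law_ph[OF that] by (auto simp: g_def c_def)
  have P: "measure_pmf.prob ?q ?T \<le> B / R ^ m" by (rule exp_moment_pmf(3)[OF R law_moment B])
  have iT: "integrable (measure_pmf q) (indicator ?T :: 's \<Rightarrow> real)" for q
    by (intro integrable_pmf_bounded[of _ _ 1]) (auto split: split_indicator)
  have iuc: "integrable (measure_pmf ?q) (\<lambda>s. u s * c)" using iu by simp
  have "Ep ?q (\<lambda>s. u s * g s) - Ep ?q u * Ep ?q g
      = Ep ?q (\<lambda>s. u s * (g s - c)) - Ep ?q u * Ep ?q (\<lambda>s. g s - c)"
  proof -
    have 1: "Ep ?q (\<lambda>s. u s * (g s - c)) = Ep ?q (\<lambda>s. u s * g s) - Ep ?q u * c"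
      unfolding right_diff_distrib using iug iuc by simp
    have 2: "Ep ?q (\<lambda>s. g s - c) = Ep ?q g - c" using ig by simp
    show ?thesis unfolding 1 2 by (simp add: algebra_simps)
  qed
  moreover have "\<bar>Ep ?q (\<lambda>s. u s * (g s - c))\<bar> \<le> b\<^sup>2 * (B / R ^ m)"
  proof -
    have "\<bar>Ep ?q (\<lambda>s. u s * (g s - c))\<bar> \<le> Ep ?q (\<lambda>s. (b * b) * indicator ?T s)"
    proof (rule Ep_abs_le)
      show "\<bar>u s * (g s - c)\<bar> \<le> b * b * indicator ?T s" if "s \<in> set_pmf ?q" for s
        using mult_mono[of "u s" b "\<bar>g s - c\<bar>" "b * indicator ?T s"] dev[OF that] u[of s] b
        by (simp add: abs_mult mult.assoc)
    qed (use iT in simp)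
    also have "\<dots> = b * b * measure_pmf.prob ?q ?T" by simp
    also have "\<dots> \<le> b * b * (B / R ^ m)" using P b by (intro mult_left_mono) auto
    finally show ?thesis by (simp add: power2_eq_square)
  qed
  moreover have "\<bar>Ep ?q u * Ep ?q (\<lambda>s. g s - c)\<bar> \<le> b\<^sup>2 * (B / R ^ m)"
  proof -
    have "\<bar>Ep ?q (\<lambda>s. g s - c)\<bar> \<le> Ep ?q (\<lambda>s. b * indicator ?T s)"
      by (rule Ep_abs_le) (use dev iT in auto)
    also have "\<dots> = b * measure_pmf.prob ?q ?T" by simp
    also have "\<dots> \<le> b * (B / R ^ m)" using P b by (rule mult_left_mono)
    finally have 1: "\<bar>Ep ?q (\<lambda>s. g s - c)\<bar> \<le> b * (B / R ^ m)" .
    have 2: "\<bar>Ep ?q u\<bar> \<le> b" using Ep_bounds[of ?q u b] u by auto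
    show ?thesis unfolding abs_mult
      using mult_mono[OF 2 1 b] by (simp add: power2_eq_square mult.assoc)
  qed
  ultimately show ?thesis unfolding E1 E2 unfolding expectation_Y by linarith
qed

end

lemma min_le_geometric_mean:
  fixes x a b t :: real
  assumes "0 \<le> x" "x \<le> a" "x \<le> b" "0 \<le> t" "t \<le> 1"
  shows "x \<le> a powr (1 - t) * b powr t"
proof (cases "x = 0")
  case False
  then have "x = x powr (1 - t) * x powr t" using assms by (simp flip: powr_add)
  also have "\<dots> \<le> a powr (1 - t) * b powr t"
    using assms by (intro mult_mono powr_mono2) auto
  finally show ?thesis .
qed simp

lemma sum_geometric_le:
  fixes q :: real
  assumes "0 \<le> q" "q < 1"
  shows "(\<Sum>k<n. q ^ k) \<le> 1 / (1 - q)"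
proof -
  have "(\<Sum>k<n. q ^ k) = (1 - q ^ n) / (1 - q)"
    using sum_gp_strict[of q n] assms by simp
  then show ?thesis using assms by (simp add: divide_right_mono)
qed

lemma double_sum_geometric_le:
  fixes q :: real
  assumes q: "0 \<le> q" "q < 1"
  shows "(\<Sum>i<n. \<Sum>j<n. q ^ (max i j - min i j)) \<le> real n * (2 / (1 - q))"
proof -
  have "(\<Sum>j<n. q ^ (max i j - min i j)) \<le> 2 / (1 - q)" if "i < n" for i
  proof -
    have "(\<Sum>j<n. q ^ (max i j - min i j)) = (\<Sum>j\<in>{..<i}. q ^ (i - j)) + (\<Sum>j\<in>{i..<n}. q ^ (j - i))"
    proof -
      let ?f = "\<lambda>j. q ^ (max i j - min i j)"
      have "{..<i} \<union> {i..<n} = {..<n}" using that by auto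
      then have "sum ?f {..<n} = sum ?f ({..<i} \<union> {i..<n})" by (rule arg_cong[where f = "sum ?f", symmetric])
      also have "\<dots> = sum ?f {..<i} + sum ?f {i..<n}" by (rule sum.union_disjoint) auto
      also have "sum ?f {..<i} = (\<Sum>j\<in>{..<i}. q ^ (i - j))" by (intro sum.cong) auto
      also have "sum ?f {i..<n} = (\<Sum>j\<in>{i..<n}. q ^ (j - i))" by (intro sum.cong) auto
      finally show ?thesis .
    qed
    also have "(\<Sum>j\<in>{..<i}. q ^ (i - j)) = (\<Sum>d\<in>{1..i}. q ^ d)"
      by (rule sum.reindex_bij_witness[of _ "\<lambda>d. i - d" "\<lambda>j. i - j"]) auto
    also have "\<dots> \<le> (\<Sum>d<Suc i. q ^ d)" using q by (intro sum_mono2) auto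
    also have "(\<Sum>j\<in>{i..<n}. q ^ (j - i)) = (\<Sum>d<n - i. q ^ d)"
      by (rule sum.reindex_bij_witness[of _ "\<lambda>d. d + i" "\<lambda>j. j - i"]) auto
    also have "(\<Sum>d<Suc i. q ^ d) + (\<Sum>d<n - i. q ^ d) \<le> 1 / (1 - q) + 1 / (1 - q)"
      by (intro add_mono sum_geometric_le q)
    finally show ?thesis by simp
  qed
  then have "(\<Sum>i<n. \<Sum>j<n. q ^ (max i j - min i j)) \<le> (\<Sum>i<n. 2 / (1 - q))"
    by (intro sum_mono) auto
  then show ?thesis by simp
qed

locale phase_chain_fun = phase_chain M Y K S \<kappa> \<tau> R B ph
  for M :: "'w measure" and Y and K :: "nat \<Rightarrow> 's \<Rightarrow> 's pmf" and S \<kappa> \<tau> R B ph +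
  fixes h :: "'s \<Rightarrow> real" and r :: real
  assumes r: "1 < r" "r < R" and h: "\<And>s. 0 \<le> h s" "\<And>s. h s \<le> r ^ \<kappa> s"
begin

text \<open>An exponent \<open>p > 1\<close> for which \<open>h (Y k)\<close> has bounded \<open>p\<close>-th moments.\<close>

definition p :: real where "p = min 2 (ln R / ln r)"

lemma p: "1 < p" "p \<le> 2" "r powr p \<le> R"
proof -
  show "1 < p" using r by (simp add: p_def field_simps)
  show "p \<le> 2" by (simp add: p_def)
  have "r powr p \<le> r powr (ln R / ln r)" using r by (intro powr_mono) (auto simp: p_def)
  also have "\<dots> = R" using r by (simp add: powr_def)
  finally show "r powr p \<le> R" .
qed

lemma h_powr: "h s powr p \<le> R ^ \<kappa> s"
proof -
  have "h s powr p \<le> (r ^ \<kappa> s) powr p" using h p by (intro powr_mono2) auto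
  also have "\<dots> = (r powr p) ^ \<kappa> s" using r by (simp add: powr_power powr_realpow[symmetric] powr_powr mult.commute)
  also have "\<dots> \<le> R ^ \<kappa> s" using p by (intro power_mono) auto
  finally show ?thesis .
qed

lemma R_moment: "integrable (measure_pmf (law k)) (\<lambda>s. R ^ \<kappa> s)" "Ep (law k) (\<lambda>s. R ^ \<kappa> s) \<le> B"
  by (rule exp_moment_pmf[OF R law_moment B])+

lemma h_powr_moment: "integrable (measure_pmf (law k)) (\<lambda>s. h s powr p)" "Ep (law k) (\<lambda>s. h s powr p) \<le> B"
proof -
  show i: "integrable (measure_pmf (law k)) (\<lambda>s. h s powr p)"
    by (rule Bochner_Integration.integrable_bound[OF R_moment(1)[of k]])
       (use h_powr in \<open>auto intro: order.trans[OF _ abs_ge_self]\<close>)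
  have "Ep (law k) (\<lambda>s. h s powr p) \<le> Ep (law k) (\<lambda>s. R ^ \<kappa> s)"
    using i R_moment h_powr by (intro Ep_mono) auto
  then show "Ep (law k) (\<lambda>s. h s powr p) \<le> B" using R_moment(2)[of k] by linarith
qed

definition tr :: "nat \<Rightarrow> 's \<Rightarrow> real" where "tr k s = min (h s) (real (Suc k))"

lemma tr: "0 \<le> tr k s" "tr k s \<le> real (Suc k)" "tr k s \<le> h s" using h by (auto simp: tr_def)

lemma tr_square: "(tr k s)\<^sup>2 \<le> h s powr p * real (Suc k) powr (2 - p)"
proof (cases "tr k s = 0")
  case False
  then have t: "tr k s > 0" using tr(1)[of k s] by simp
  have "(tr k s)\<^sup>2 = tr k s powr p * tr k s powr (2 - p)"
    using t by (simp add: powr_numeral flip: powr_add)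
  also have "\<dots> \<le> h s powr p * real (Suc k) powr (2 - p)"
    using tr[where k = k and s = s] p by (intro mult_mono powr_mono2) auto
  finally show ?thesis .
qed simp

definition U :: "nat \<Rightarrow> 'w \<Rightarrow> real" where "U k \<omega> = tr k (Y k \<omega>)"

definition mn :: "nat \<Rightarrow> real" where "mn k = Ep (law k) (tr k)"

lemma U_measurable [measurable]: "U k \<in> borel_measurable M"
  unfolding U_def[abs_def]
  using measurable_compose[OF Y_meas[of k], of "tr k" borel] by simp

lemma expectation_U: "expectation (U k) = mn k"
  unfolding U_def[abs_def] mn_def by (rule expectation_Y)

lemma integrable_U: "integrable M (U k)" "integrable M (\<lambda>\<omega>. U i \<omega> * U j \<omega>)"
proof -
  show "integrable M (U k)"
    by (rule integrable_const_bound[where B = "real (Suc k)"]) (use tr in \<open>auto simp: U_def\<close>)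
  have "\<bar>U i \<omega> * U j \<omega>\<bar> \<le> real (Suc i) * real (Suc j)" for \<omega>
    unfolding U_def abs_mult using tr by (intro mult_mono) auto
  then show "integrable M (\<lambda>\<omega>. U i \<omega> * U j \<omega>)"
    by (intro integrable_const_bound[where B = "real (Suc i) * real (Suc j)"]) auto
qed

lemma second_moment: "k < n \<Longrightarrow> expectation (\<lambda>\<omega>. U k \<omega> * U k \<omega>) \<le> B * real n powr (2 - p)"
proof -
  assume kn: "k < n"
  have "expectation (\<lambda>\<omega>. U k \<omega> * U k \<omega>) = Ep (law k) (\<lambda>s. (tr k s)\<^sup>2)"
    unfolding U_def using expectation_Y[of "\<lambda>s. (tr k s)\<^sup>2" k] by (simp add: power2_eq_square)
  also have "\<dots> \<le> Ep (law k) (\<lambda>s. h s powr p * real (Suc k) powr (2 - p))"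
  proof (rule Ep_mono)
    have "\<bar>(tr k s)\<^sup>2\<bar> \<le> (real (Suc k))\<^sup>2" for s using tr by (simp add: power_mono)
    then show "integrable (measure_pmf (law k)) (\<lambda>s. (tr k s)\<^sup>2)" by (rule integrable_pmf_bounded)
  qed (use tr_square h_powr_moment in auto)
  also have "\<dots> = Ep (law k) (\<lambda>s. h s powr p) * real (Suc k) powr (2 - p)" by simp
  also have "\<dots> \<le> B * real n powr (2 - p)"
    using h_powr_moment(2)[of k] kn p B by (intro mult_mono powr_mono2) auto
  finally show ?thesis .
qed

definition cv :: "nat \<Rightarrow> nat \<Rightarrow> real" where
  "cv i j = expectation (\<lambda>\<omega>. U i \<omega> * U j \<omega>) - mn i * mn j"

lemma cv_sym: "cv i j = cv j i" by (simp add: cv_def mult.commute)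

lemma mn_nonneg: "0 \<le> mn k" unfolding mn_def using Ep_bounds(1)[of "law k" "tr k" "real (Suc k)"] tr by auto

lemma cv_le_moment:
  assumes "i < n" "j < n"
  shows "\<bar>cv i j\<bar> \<le> B * real n powr (2 - p)"
proof -
  let ?c = "B * real n powr (2 - p)"
  have sq: "mn k * mn k \<le> expectation (\<lambda>\<omega>. U k \<omega> * U k \<omega>)" for k
  proof -
    have "0 \<le> expectation (\<lambda>\<omega>. (U k \<omega> - mn k)\<^sup>2)" by simp
    also have "expectation (\<lambda>\<omega>. (U k \<omega> - mn k)\<^sup>2) = expectation (\<lambda>\<omega>. U k \<omega> * U k \<omega>) - mn k * mn k"
      using integrable_U(1)[of k] integrable_U(2)[of k k]
      by (simp add: power2_eq_square algebra_simps expectation_U prob_space)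
    finally show ?thesis by simp
  qed
  have am: "2 * (a * b) \<le> a * a + b * b" for a b :: real
    using sum_squares_bound[of a b] by (simp add: power2_eq_square)
  have "2 * expectation (\<lambda>\<omega>. U i \<omega> * U j \<omega>) = expectation (\<lambda>\<omega>. 2 * (U i \<omega> * U j \<omega>))" by simp
  also have "\<dots> \<le> expectation (\<lambda>\<omega>. U i \<omega> * U i \<omega> + U j \<omega> * U j \<omega>)"
    using integrable_U(2) am by (intro integral_mono) auto
  also have "\<dots> = expectation (\<lambda>\<omega>. U i \<omega> * U i \<omega>) + expectation (\<lambda>\<omega>. U j \<omega> * U j \<omega>)"
    using integrable_U(2) by simp
  finally have 1: "expectation (\<lambda>\<omega>. U i \<omega> * U j \<omega>) \<le> ?c"
    using second_moment[OF assms(1)] second_moment[OF assms(2)] by linarith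
  have 2: "mn i * mn j \<le> ?c"
    using am[of "mn i" "mn j"] sq[of i] sq[of j] second_moment[OF assms(1)] second_moment[OF assms(2)] by linarith
  have "0 \<le> expectation (\<lambda>\<omega>. U i \<omega> * U j \<omega>)" using tr by (intro integral_nonneg_AE) (auto simp: U_def)
  moreover have "0 \<le> mn i * mn j" using mn_nonneg by simp
  ultimately show ?thesis using 1 2 unfolding cv_def by linarith
qed

lemma cv_le_decay:
  assumes "i < n" "j < n"
  shows "\<bar>cv i j\<bar> \<le> 2 * (real n)\<^sup>2 * (B / R ^ (max i j - min i j))"
proof -
  have *: "\<bar>cv i (i + m)\<bar> \<le> 2 * (real n)\<^sup>2 * (B / R ^ m)" if "i + m < n" for i m
  proof -
    have b: "tr k s \<le> real n" if "k < n" for k s using tr(2)[of k s] that by linarith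
    show ?thesis
      using covariance_decay[of "tr i" "real n" "tr (i + m)" i m] tr(1) b that
      by (simp add: cv_def U_def expectation_Y mn_def)
  qed
  show ?thesis
  proof (cases "i \<le> j")
    case True
    then show ?thesis using *[of i "j - i"] assms by (simp add: max_def min_def)
  next
    case False
    then show ?thesis using *[of j "i - j"] assms cv_sym[of i j] by (simp add: max_def min_def)
  qed
qed

lemma variance_growth:
  obtains D where "D \<ge> 0" "\<And>n. n \<ge> 1 \<Longrightarrow>
    expectation (\<lambda>\<omega>. ((\<Sum>k<n. U k \<omega>) - (\<Sum>k<n. expectation (U k)))\<^sup>2) \<le> D * real n powr (2 - (p - 1) / 2)"
proof -
  define t where "t = (p - 1) / (2 * p)"
  have t: "0 < t" "t < 1" "(2 - p) * (1 - t) + 2 * t = 1 - (p - 1) / 2"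
    using p by (auto simp: t_def field_simps power2_eq_square)
  define q where "q = R powr (- t)"
  have q: "0 \<le> q" "q < 1" using R t by (auto simp: q_def powr_less_one)
  define e where "e = 1 - (p - 1) / 2"
  define D where "D = 2 * B * (2 / (1 - q))"
  have cv: "\<bar>cv i j\<bar> \<le> 2 * B * real n powr e * q ^ (max i j - min i j)" if ij: "i < n" "j < n" for i j n
  proof -
    define d where "d = max i j - min i j"
    have n: "real n > 0" using ij by simp
    have "\<bar>cv i j\<bar> \<le> 2 * B * real n powr (2 - p)"
      using cv_le_moment[OF ij] B order.trans[of _ "B * real n powr (2 - p)"] by (simp add: mult_right_mono)
    moreover have "\<bar>cv i j\<bar> \<le> 2 * B * (real n powr 2 * R powr (- real d))"
      using cv_le_decay[OF ij, folded d_def] R n by (simp add: powr_minus powr_realpow field_simps)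
    ultimately have "\<bar>cv i j\<bar> \<le> (2 * B * real n powr (2 - p)) powr (1 - t) * (2 * B * (real n powr 2 * R powr (- real d))) powr t"
      using t by (intro min_le_geometric_mean) auto
    also have "\<dots> = ((2 * B) powr (1 - t) * (2 * B) powr t) * (real n powr ((2 - p) * (1 - t)) * real n powr (2 * t)) * R powr (- real d * t)"
      using B by (simp add: powr_mult powr_powr algebra_simps del: powr_numeral)
    also have "(2 * B) powr (1 - t) * (2 * B) powr t = 2 * B" using B by (simp flip: powr_add)
    also have "real n powr ((2 - p) * (1 - t)) * real n powr (2 * t) = real n powr e"
      using t(3) by (simp add: e_def flip: powr_add)
    also have "R powr (- real d * t) = q ^ d"
      using R by (simp add: q_def powr_realpow[symmetric] powr_powr mult.commute)
    finally show ?thesis unfolding d_def .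
  qed
  have "expectation (\<lambda>\<omega>. ((\<Sum>k<n. U k \<omega>) - (\<Sum>k<n. expectation (U k)))\<^sup>2) \<le> D * real n powr (2 - (p - 1) / 2)"
    if n: "n \<ge> 1" for n
  proof -
    have "((\<Sum>k<n. U k \<omega>) - (\<Sum>k<n. expectation (U k)))\<^sup>2 =
        (\<Sum>i<n. \<Sum>j<n. (U i \<omega> - mn i) * (U j \<omega> - mn j))" for \<omega>
      by (simp add: power2_eq_square sum_product expectation_U flip: sum_subtractf)
    then have "expectation (\<lambda>\<omega>. ((\<Sum>k<n. U k \<omega>) - (\<Sum>k<n. expectation (U k)))\<^sup>2) =
        expectation (\<lambda>\<omega>. \<Sum>i<n. \<Sum>j<n. (U i \<omega> - mn i) * (U j \<omega> - mn j))" by simp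
    also have "\<dots> = (\<Sum>i<n. \<Sum>j<n. cv i j)"
    proof -
      have i: "integrable M (\<lambda>\<omega>. (U i \<omega> - mn i) * (U j \<omega> - mn j))" for i j
        using integrable_U(1) integrable_U(2)[of i j] by (simp add: algebra_simps)
      have "expectation (\<lambda>\<omega>. (U i \<omega> - mn i) * (U j \<omega> - mn j)) = cv i j" for i j
        using integrable_U(1) integrable_U(2)[of i j]
        by (simp add: algebra_simps cv_def expectation_U prob_space)
      then show ?thesis using i by simp
    qed
    also have "\<dots> \<le> (\<Sum>i<n. \<Sum>j<n. 2 * B * real n powr e * q ^ (max i j - min i j))"
      by (intro sum_mono order.trans[OF abs_ge_self cv]) auto
    also have "\<dots> = 2 * B * real n powr e * (\<Sum>i<n. \<Sum>j<n. q ^ (max i j - min i j))"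
      by (simp only: sum_distrib_left)
    also have "\<dots> \<le> 2 * B * real n powr e * (real n * (2 / (1 - q)))"
      using B by (intro mult_left_mono double_sum_geometric_le q) auto
    also have "\<dots> = D * (real n powr 1 * real n powr e)" using n by (simp add: D_def)
    also have "real n powr 1 * real n powr e = real n powr (2 - (p - 1) / 2)"
      unfolding e_def powr_add[symmetric] by simp
    finally show ?thesis .
  qed
  moreover have "D \<ge> 0" using B q by (simp add: D_def)
  ultimately show ?thesis using that by blast
qed

lemma mn_le: "mn k \<le> B"
proof -
  have "tr k s \<le> R ^ \<kappa> s" for s
  proof -
    have "r ^ \<kappa> s \<le> R ^ \<kappa> s" using r by (intro power_mono) auto
    then show ?thesis using tr(3)[of k s] h(2)[of s] by linarith
  qed
  moreover have "integrable (measure_pmf (law k)) (tr k)"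
    using tr by (intro integrable_pmf_bounded[of _ _ "real (Suc k)"]) auto
  ultimately have "mn k \<le> Ep (law k) (\<lambda>s. R ^ \<kappa> s)"
    unfolding mn_def using R_moment by (intro Ep_mono) auto
  then show ?thesis using R_moment(2)[of k] by linarith
qed

lemma tail_h: "measure_pmf.prob (law k) {s. h s > c} \<le> B * c powr (- p)" if "c > 0"
proof -
  have pt: "indicator {s. h s > c} s \<le> h s powr p * c powr (- p)" for s
  proof (cases "h s > c")
    case True
    then have "c powr p \<le> h s powr p" using that p by (intro powr_mono2) auto
    then show ?thesis using True that by (simp add: powr_minus field_simps)
  qed simp
  have "measure_pmf.prob (law k) {s. h s > c} = Ep (law k) (indicator {s. h s > c})" by simp
  also have "\<dots> \<le> Ep (law k) (\<lambda>s. h s powr p * c powr (- p))"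
  proof (rule Ep_mono)
    show "integrable (measure_pmf (law k)) (indicator {s. h s > c} :: 's \<Rightarrow> real)"
      by (rule integrable_pmf_bounded[of _ _ 1]) (auto split: split_indicator)
  qed (use h_powr_moment(1)[of k] pt in auto)
  also have "\<dots> \<le> B * c powr (- p)" using h_powr_moment(2)[of k] by (simp add: mult_right_mono)
  finally show ?thesis .
qed

lemma centered_lln:
  "AE \<omega> in M. (\<lambda>n. ((\<Sum>k<n. h (Y k \<omega>)) - (\<Sum>k<n. mn k)) / real n) \<longlonglongrightarrow> 0"
proof -
  obtain D where D: "D \<ge> 0" "\<And>n. n \<ge> 1 \<Longrightarrow>
    expectation (\<lambda>\<omega>. ((\<Sum>k<n. U k \<omega>) - (\<Sum>k<n. expectation (U k)))\<^sup>2) \<le> D * real n powr (2 - (p - 1) / 2)"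
    using variance_growth by blast
  have "AE \<omega> in M. (\<lambda>n. ((\<Sum>k<n. U k \<omega>) - (\<Sum>k<n. expectation (U k))) / real n) \<longlonglongrightarrow> 0"
    by (rule lln_of_variance[where b = "\<lambda>k. real (Suc k)" and B = B and \<gamma> = "(p - 1) / 2", OF _ _ _ _ D(1) _ D(2)])
       (use tr p mn_le in \<open>auto simp: U_def[symmetric] expectation_U\<close>, auto simp: U_def tr)
  moreover have "AE \<omega> in M. eventually (\<lambda>k. \<omega> \<in> space M - {\<omega> \<in> space M. h (Y k \<omega>) > real (Suc k)}) sequentially"
  proof (rule borel_cantelli_AE1)
    have e: "prob {\<omega> \<in> space M. h (Y k \<omega>) > c} = measure_pmf.prob (law k) {s. h s > c}" for k c
      unfolding law(1)[symmetric] by (subst measure_distr) (auto simp: vimage_def Int_def conj_commute)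
    show "{\<omega> \<in> space M. h (Y k \<omega>) > real (Suc k)} \<in> sets M" for k
      using measurable_compose[OF Y_meas[of k], of h borel] by measurable
    have "summable (\<lambda>k. B * real (Suc k) powr (- p))"
      using summable_real_powr_iff[of "-p"] summable_Suc_iff[of "\<lambda>i. real i powr (-p)"] p
      by (intro summable_mult) simp
    then show "summable (\<lambda>k. prob {\<omega> \<in> space M. h (Y k \<omega>) > real (Suc k)})"
      by (rule summable_comparison_test') (use tail_h in \<open>auto simp: e\<close>)
  qed (simp add: emeasure_eq_measure)
  ultimately show ?thesis
  proof eventually_elim
    case (elim \<omega>)
    then obtain k0 where k0: "\<And>k. k \<ge> k0 \<Longrightarrow> h (Y k \<omega>) \<le> real (Suc k)"
      by (fastforce simp: eventually_sequentially)
    have "(\<lambda>k. h (Y k \<omega>) - U k \<omega>) \<longlonglongrightarrow> 0"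
      by (rule tendsto_eventually)
         (auto simp: eventually_sequentially U_def tr_def min_def intro!: exI[of _ k0] dest: k0)
    then have "(\<lambda>n. (\<Sum>k<n. h (Y k \<omega>) - U k \<omega>) / real n) \<longlonglongrightarrow> 0" by (rule cesaro_null)
    from tendsto_add[OF this elim(1)]
    show ?case by (simp add: expectation_U sum_subtractf add_divide_distrib[symmetric])
  qed
qed

end

locale phase_chain_inv = phase_chain M Y K S \<kappa> \<tau> R B ph
  for M :: "'w measure" and Y and K :: "nat \<Rightarrow> 's \<Rightarrow> 's pmf" and S \<kappa> \<tau> R B ph +
  fixes \<rho> :: "'s pmf"
  assumes rho_S: "set_pmf \<rho> \<subseteq> S"
    and rho_inv: "\<And>m. bind_pmf \<rho> (K m) = \<rho>"
    and rho_half: "measure_pmf.prob \<rho> {s. \<tau> s = 1} = 1 / 2"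
    and ty12: "\<And>s. s \<in> S \<Longrightarrow> \<tau> s \<in> {1, 2}"
    and ph01: "ph 0 \<in> {1, 2}" "ph 1 = 3 - ph 0"
begin

text \<open>
  Started at either type, the chain forgets its initial state; the two laws at consecutive times
  together carry both types with the weights that an invariant law gives them.
\<close>

lemma mean_pair:
  assumes v: "\<And>s. 0 \<le> v s" "\<And>s. v s \<le> b"
  shows "\<bar>Ep (law m) v + Ep (law (Suc m)) v - 2 * Ep \<rho> v\<bar>
    \<le> b * (2 * (B / R ^ m) + 2 * measure_pmf.prob \<rho> {s. m \<le> \<kappa> s})"
proof -
  let ?T = "{s. m \<le> \<kappa> s}"
  define g where "g = (\<lambda>s. Ep (K m s) v)"
  have b: "0 \<le> b" using v order.trans by blast
  have g: "0 \<le> g s" "g s \<le> b" for s using Ep_bounds[of "K m s" v b] v by (auto simp: g_def)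
  have ig: "integrable (measure_pmf q) g" for q
    using g by (intro integrable_pmf_bounded[of _ _ b]) simp
  have iT: "integrable (measure_pmf q) (indicator ?T :: 's \<Rightarrow> real)" for q
    by (intro integrable_pmf_bounded[of _ _ 1]) (auto split: split_indicator)
  have im: "integrable (measure_pmf q) (\<lambda>s. mid m v (\<tau> s))" for q
    using mid_bounds[of v b, OF v] by (intro integrable_pmf_bounded[of _ _ b]) (simp add: abs_le_iff order.trans[of _ 0])
  have dev: "\<bar>Ep q g - Ep q (\<lambda>s. mid m v (\<tau> s))\<bar> \<le> b * measure_pmf.prob q ?T" if "set_pmf q \<subseteq> S" for q
  proof -
    have "\<bar>Ep q (\<lambda>s. g s - mid m v (\<tau> s))\<bar> \<le> Ep q (\<lambda>s. b * indicator ?T s)"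
      using deviation_mid[of v b _ m, OF v] that iT by (intro Ep_abs_le) (auto simp: g_def)
    then show ?thesis using ig im by simp
  qed
  have mid_law: "Ep (law k) (\<lambda>s. mid m v (\<tau> s)) = mid m v (ph k)" for k
  proof -
    have "Ep (law k) (\<lambda>s. mid m v (\<tau> s)) = Ep (law k) (\<lambda>s. mid m v (ph k))"
      by (intro integral_cong_AE) (auto simp: AE_measure_pmf_iff law_ph)
    then show ?thesis by simp
  qed
  have 1: "\<bar>Ep (law m) v - mid m v (ph 0)\<bar> \<le> b * (B / R ^ m)"
  proof -
    have "Ep (law (0 + m)) v = Ep (law 0) g"
      unfolding law_add g_def using v by (rule Ep_bind)
    then have "\<bar>Ep (law m) v - mid m v (ph 0)\<bar> \<le> b * measure_pmf.prob (law 0) ?T"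
      using dev[OF law(2), of 0] mid_law by simp
    also have "\<dots> \<le> b * (B / R ^ m)"
      by (rule mult_left_mono[OF exp_moment_pmf(3)[OF R law_moment B] b])
    finally show ?thesis .
  qed
  have 2: "\<bar>Ep (law (Suc m)) v - mid m v (ph 1)\<bar> \<le> b * (B / R ^ m)"
  proof -
    have "Ep (law (1 + m)) v = Ep (law 1) g"
      unfolding law_add g_def using v by (rule Ep_bind)
    then have "\<bar>Ep (law (Suc m)) v - mid m v (ph 1)\<bar> \<le> b * measure_pmf.prob (law 1) ?T"
      using dev[OF law(2), of 1] mid_law by simp
    also have "\<dots> \<le> b * (B / R ^ m)"
      by (rule mult_left_mono[OF exp_moment_pmf(3)[OF R law_moment B] b])
    finally show ?thesis .
  qed
  have 3: "\<bar>Ep \<rho> v - (mid m v 1 + mid m v 2) / 2\<bar> \<le> b * measure_pmf.prob \<rho> ?T"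
  proof -
    have "Ep \<rho> v = Ep (bind_pmf \<rho> (K m)) v" by (simp add: rho_inv)
    also have "\<dots> = Ep \<rho> g" unfolding g_def using v by (rule Ep_bind)
    finally have e: "Ep \<rho> v = Ep \<rho> g" .
    have i1: "integrable (measure_pmf \<rho>) (indicator {s. \<tau> s = 1} :: 's \<Rightarrow> real)"
      by (intro integrable_pmf_bounded[of _ _ 1]) (auto split: split_indicator)
    have "Ep \<rho> (\<lambda>s. mid m v (\<tau> s)) =
        Ep \<rho> (\<lambda>s. mid m v 2 + (mid m v 1 - mid m v 2) * indicator {s. \<tau> s = 1} s)"
    proof (intro integral_cong_AE)
      have "mid m v (\<tau> s) = mid m v 2 + (mid m v 1 - mid m v 2) * indicator {s. \<tau> s = 1} s"
        if "s \<in> set_pmf \<rho>" for s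
        using ty12[of s] rho_S that by (cases "\<tau> s = 1") auto
      then show "AE s in measure_pmf \<rho>. mid m v (\<tau> s) =
          mid m v 2 + (mid m v 1 - mid m v 2) * indicator {s. \<tau> s = 1} s"
        by (simp add: AE_measure_pmf_iff)
    qed auto
    also have "\<dots> = mid m v 2 + (mid m v 1 - mid m v 2) * (1 / 2)"
      using i1 rho_half by simp
    finally show ?thesis using dev[OF rho_S] e by (simp add: field_simps)
  qed
  have 4: "mid m v (ph 0) + mid m v (ph 1) = mid m v 1 + mid m v 2"
    using ph01 by auto
  have 5: "b * (2 * (B / R ^ m) + 2 * measure_pmf.prob \<rho> ?T) =
      2 * (b * (B / R ^ m)) + 2 * (b * measure_pmf.prob \<rho> ?T)"
    by (simp add: algebra_simps)
  have "\<bar>x + y - 2 * z\<bar> \<le> 2 * e + 2 * f"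
    if "\<bar>x - a\<bar> \<le> e" "\<bar>y - a'\<bar> \<le> e" "\<bar>z - (c + c') / 2\<bar> \<le> f" "a + a' = c + c'"
    for x y z a a' c c' e f :: real
    using that by (simp add: abs_le_iff field_simps)
  from this[OF 1 2 3 4] show ?thesis unfolding 5 .
qed

lemma rho_tail: "(\<lambda>m. measure_pmf.prob \<rho> {s. m \<le> \<kappa> s}) \<longlonglongrightarrow> 0"
proof -
  have "(\<lambda>m. measure_pmf.prob \<rho> {s. m \<le> \<kappa> s}) \<longlonglongrightarrow> measure_pmf.prob \<rho> (\<Inter>m. {s. m \<le> \<kappa> s})"
    by (rule measure_pmf.finite_Lim_measure_decseq) (auto simp: decseq_def)
  moreover have "(\<Inter>m. {s. m \<le> \<kappa> s}) = {}"
    by auto (meson not_less_eq_eq)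
  ultimately show ?thesis by simp
qed

lemma R_pow_null: "(\<lambda>m. B / R ^ m) \<longlonglongrightarrow> 0"
  using R tendsto_mult_right_zero[OF LIMSEQ_power_zero[of "1 / R"], of B]
  by (simp add: power_divide)

lemma rho_moment: "(\<integral>\<^sup>+s. ennreal (R ^ \<kappa> s) \<partial>measure_pmf \<rho>) \<le> ennreal B"
proof -
  have R0: "0 \<le> R ^ k" for k using R by simp
  have fin: "Ep \<rho> (\<lambda>s. min (R ^ \<kappa> s) (real n)) \<le> B" for n
  proof -
    let ?v = "\<lambda>s. min (R ^ \<kappa> s) (real n)"
    have le: "Ep (law k) ?v \<le> B" for k
    proof -
      have "Ep (law k) ?v \<le> Ep (law k) (\<lambda>s. R ^ \<kappa> s)"
        using exp_moment_pmf(1)[OF R law_moment B] R0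
        by (intro Ep_mono integrable_pmf_bounded[of _ ?v "real n"]) auto
      then show ?thesis using exp_moment_pmf(2)[OF R law_moment[of k] B] by linarith
    qed
    have "2 * Ep \<rho> ?v - 2 * B \<le> real n * (2 * (B / R ^ m) + 2 * measure_pmf.prob \<rho> {s. m \<le> \<kappa> s})" for m
      using mean_pair[of ?v "real n" m] R0 le[of m] le[of "Suc m"] by (auto simp: abs_le_iff)
    moreover have "(\<lambda>m. real n * (2 * (B / R ^ m) + 2 * measure_pmf.prob \<rho> {s. m \<le> \<kappa> s})) \<longlonglongrightarrow> real n * (2 * 0 + 2 * 0)"
      by (intro tendsto_intros R_pow_null rho_tail)
    ultimately have "2 * Ep \<rho> ?v - 2 * B \<le> real n * (2 * 0 + 2 * 0)"
      by (intro tendsto_lowerbound[of _ _ sequentially]) auto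
    then show ?thesis by simp
  qed
  have sup: "ennreal (R ^ \<kappa> s) = (SUP n. ennreal (min (R ^ \<kappa> s) (real n)))" for s
  proof (rule antisym)
    obtain n :: nat where "R ^ \<kappa> s \<le> real n" using real_arch_simple by blast
    then show "ennreal (R ^ \<kappa> s) \<le> (SUP n. ennreal (min (R ^ \<kappa> s) (real n)))"
      by (intro SUP_upper2[of n]) (auto simp: min_def)
  qed (auto intro!: SUP_least ennreal_leI)
  have "(\<integral>\<^sup>+s. ennreal (R ^ \<kappa> s) \<partial>measure_pmf \<rho>) =
      (SUP n. \<integral>\<^sup>+s. ennreal (min (R ^ \<kappa> s) (real n)) \<partial>measure_pmf \<rho>)"
    unfolding sup by (rule nn_integral_monotone_convergence_SUP)
      (auto simp: incseq_def le_fun_def intro!: ennreal_leI)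
  also have "\<dots> \<le> ennreal B"
  proof (rule SUP_least)
    fix n :: nat
    have "(\<integral>\<^sup>+s. ennreal (min (R ^ \<kappa> s) (real n)) \<partial>measure_pmf \<rho>) = ennreal (Ep \<rho> (\<lambda>s. min (R ^ \<kappa> s) (real n)))"
      using R0 by (intro nn_integral_eq_integral integrable_pmf_bounded[of _ _ "real n"]) auto
    also have "\<dots> \<le> ennreal B" using fin by (rule ennreal_leI)
    finally show "(\<integral>\<^sup>+s. ennreal (min (R ^ \<kappa> s) (real n)) \<partial>measure_pmf \<rho>) \<le> ennreal B" .
  qed
  finally show ?thesis .
qed

end

locale phase_chain_inv_fun = phase_chain_inv M Y K S \<kappa> \<tau> R B ph \<rho> + phase_chain_fun M Y K S \<kappa> \<tau> R B ph h r
  for M :: "'w measure" and Y and K :: "nat \<Rightarrow> 's \<Rightarrow> 's pmf" and S \<kappa> \<tau> R B ph \<rho> h r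
begin

lemma integrable_h: "integrable (measure_pmf \<rho>) h"
proof (rule Bochner_Integration.integrable_bound[OF exp_moment_pmf(1)[OF R rho_moment B]])
  have "r ^ \<kappa> s \<le> R ^ \<kappa> s" for s using r by (intro power_mono) auto
  then show "AE s in measure_pmf \<rho>. norm (h s) \<le> norm (R ^ \<kappa> s)"
    using h R order.trans[OF h(2)] by (intro AE_I2) auto
qed auto

lemma mean_limit: "(\<lambda>n. (\<Sum>k<n. mn k) / real n) \<longlonglongrightarrow> Ep \<rho> h"
proof -
  define c where "c k = Ep (law (Suc k)) (tr k)" for k
  have itr: "integrable (measure_pmf q) (tr k)" for q k
    using tr by (intro integrable_pmf_bounded[of _ _ "real (Suc k)"]) auto
  have "(\<lambda>k. mn k + c k - 2 * Ep \<rho> (tr k)) \<longlonglongrightarrow> 0"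
  proof (rule tendsto_rabs_zero_cancel, rule tendsto_sandwich[OF _ _ tendsto_const])
    show "eventually (\<lambda>k. \<bar>mn k + c k - 2 * Ep \<rho> (tr k)\<bar> \<le> real (Suc k) * (4 * (B / R ^ k))) sequentially"
    proof (intro always_eventually allI)
      fix k
      have "\<bar>mn k + c k - 2 * Ep \<rho> (tr k)\<bar> \<le> real (Suc k) * (2 * (B / R ^ k) + 2 * measure_pmf.prob \<rho> {s. k \<le> \<kappa> s})"
        unfolding mn_def c_def using tr by (intro mean_pair) auto
      also have "\<dots> \<le> real (Suc k) * (2 * (B / R ^ k) + 2 * (B / R ^ k))"
        using exp_moment_pmf(3)[OF R rho_moment B, of k] by (intro mult_left_mono add_left_mono) auto
      finally show "\<bar>mn k + c k - 2 * Ep \<rho> (tr k)\<bar> \<le> real (Suc k) * (4 * (B / R ^ k))" by simp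
    qed
    have "(\<lambda>k. real k * (1 / R) ^ k) \<longlonglongrightarrow> 0" using R by (intro powser_times_n_limit_0) simp
    then have "(\<lambda>k. 4 * B * (real k * (1 / R) ^ k) + 4 * (B / R ^ k)) \<longlonglongrightarrow> 4 * B * 0 + 4 * 0"
      by (intro tendsto_intros R_pow_null)
    moreover have "4 * B * (real k * (1 / R) ^ k) + 4 * (B / R ^ k) = real (Suc k) * (4 * (B / R ^ k))" for k
      by (simp add: power_divide algebra_simps add_divide_distrib)
    ultimately show "(\<lambda>k. real (Suc k) * (4 * (B / R ^ k))) \<longlonglongrightarrow> 0" by simp
  qed simp
  moreover have "(\<lambda>k. Ep \<rho> (tr k)) \<longlonglongrightarrow> Ep \<rho> h"
  proof (rule integral_dominated_convergence[OF _ _ integrable_h])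
    show "AE s in measure_pmf \<rho>. (\<lambda>k. tr k s) \<longlonglongrightarrow> h s"
    proof (rule AE_I2, rule tendsto_eventually)
      fix s
      obtain n :: nat where "h s \<le> real n" using real_arch_simple by blast
      then show "eventually (\<lambda>k. tr k s = h s) sequentially"
        by (auto simp: eventually_sequentially tr_def min_def intro!: exI[of _ n])
    qed
    show "AE s in measure_pmf \<rho>. norm (tr k s) \<le> h s" for k using tr by simp
  qed auto
  moreover have "(\<lambda>k. mn (Suc k) - c k) \<longlonglongrightarrow> 0"
  proof (rule tendsto_rabs_zero_cancel, rule tendsto_sandwich[OF _ _ tendsto_const])
    have pt: "\<bar>tr (Suc k) s - tr k s\<bar> \<le> indicator {s. h s > real (Suc k)} s" for k s
      by (auto simp: tr_def min_def split: split_indicator)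
    have ii: "integrable (measure_pmf q) (indicator A :: 's \<Rightarrow> real)" for q A
      by (intro integrable_pmf_bounded[of _ _ 1]) (auto split: split_indicator)
    have "\<bar>mn (Suc k) - c k\<bar> \<le> B * real (Suc k) powr (- p)" for k
    proof -
      have "\<bar>Ep (law (Suc k)) (\<lambda>s. tr (Suc k) s - tr k s)\<bar> \<le> Ep (law (Suc k)) (indicator {s. h s > real (Suc k)})"
        using pt ii by (intro Ep_abs_le) auto
      also have "\<dots> \<le> B * real (Suc k) powr (- p)" using tail_h[of "real (Suc k)" "Suc k"] by simp
      finally show ?thesis using itr by (simp add: mn_def c_def)
    qed
    then show "eventually (\<lambda>k. \<bar>mn (Suc k) - c k\<bar> \<le> B * real (Suc k) powr (- p)) sequentially" by simp
    have "(\<lambda>k. B * real (Suc k) powr (- p)) \<longlonglongrightarrow> B * 0"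
      using p by (intro tendsto_intros LIMSEQ_Suc[OF tendsto_neg_powr] filterlim_real_sequentially) auto
    then show "(\<lambda>k. B * real (Suc k) powr (- p)) \<longlonglongrightarrow> 0" by simp
  qed simp
  ultimately have "(\<lambda>k. (mn k + c k - 2 * Ep \<rho> (tr k)) + 2 * Ep \<rho> (tr k) + (mn (Suc k) - c k)) \<longlonglongrightarrow> 0 + 2 * Ep \<rho> h + 0"
    by (intro tendsto_intros)
  then have "(\<lambda>k. mn k + mn (Suc k)) \<longlonglongrightarrow> 2 * Ep \<rho> h" by (simp add: algebra_simps)
  from cesaro[OF this] have 1: "(\<lambda>n. (\<Sum>k<n. mn k + mn (Suc k)) / real n) \<longlonglongrightarrow> 2 * Ep \<rho> h" .
  have 2: "(\<lambda>n. (mn n - mn 0) / real n) \<longlonglongrightarrow> 0"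
  proof (rule tendsto_rabs_zero_cancel, rule tendsto_sandwich[OF _ _ tendsto_const])
    have "\<bar>(mn n - mn 0) / real n\<bar> \<le> B * inverse (real n)" for n
    proof -
      have "\<bar>mn n - mn 0\<bar> \<le> B" using mn_nonneg[of n] mn_nonneg[of 0] mn_le[of n] mn_le[of 0] by linarith
      then have "\<bar>mn n - mn 0\<bar> * inverse (real n) \<le> B * inverse (real n)" by (rule mult_right_mono) simp
      then show ?thesis by (simp add: divide_inverse abs_mult)
    qed
    then show "eventually (\<lambda>n. \<bar>(mn n - mn 0) / real n\<bar> \<le> B * inverse (real n)) sequentially" by simp
    have "(\<lambda>n. B * inverse (real n)) \<longlonglongrightarrow> B * 0"
      by (intro tendsto_intros lim_inverse_n)
    then show "(\<lambda>n. B * inverse (real n)) \<longlonglongrightarrow> 0" by simp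
  qed simp
  have s: "(\<Sum>k<n. mn k + mn (Suc k)) = 2 * (\<Sum>k<n. mn k) + (mn n - mn 0)" for n
    by (induction n) auto
  have "(\<lambda>n. ((\<Sum>k<n. mn k + mn (Suc k)) / real n - (mn n - mn 0) / real n) / 2) \<longlonglongrightarrow> (2 * Ep \<rho> h - 0) / 2"
    by (intro tendsto_intros 1 2) simp
  moreover have "((\<Sum>k<n. mn k + mn (Suc k)) / real n - (mn n - mn 0) / real n) / 2 = (\<Sum>k<n. mn k) / real n" for n
    unfolding s by (simp add: add_divide_distrib)
  ultimately show ?thesis by simp
qed

lemma lln: "AE \<omega> in M. (\<lambda>n. (\<Sum>k<n. h (Y k \<omega>)) / real n) \<longlonglongrightarrow> Ep \<rho> h"
  using centered_lln
proof eventually_elim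
  case (elim \<omega>)
  from tendsto_add[OF elim mean_limit] show ?case by (simp add: diff_divide_distrib)
qed

end

locale coupled_chain_inv = coupled_chain M Y K S \<kappa> \<tau> R B
  for M :: "'w measure" and Y and K :: "nat \<Rightarrow> 's \<Rightarrow> 's pmf" and S \<kappa> \<tau> R B +
  fixes \<rho> :: "'s pmf"
  assumes rho_S: "set_pmf \<rho> \<subseteq> S"
    and rho_inv: "\<And>m. bind_pmf \<rho> (K m) = \<rho>"
    and rho_half: "measure_pmf.prob \<rho> {s. \<tau> s = 1} = 1 / 2"
    and ty12: "\<And>s. s \<in> S \<Longrightarrow> \<tau> s \<in> {1, 2}"
    and alternate: "\<And>k. AE \<omega> in M. \<tau> (Y (Suc k) \<omega>) = 3 - \<tau> (Y k \<omega>)"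
begin

text \<open>Conditioned on its initial type, the chain has a deterministic sequence of types.\<close>

lemma conditional_phase_chain:
  assumes i: "i \<in> {1, 2}" and A: "A = {\<omega> \<in> space M. \<tau> (Y 0 \<omega>) = i}" "prob A > 0"
  shows "phase_chain_inv (uniform_measure M A) Y K S \<kappa> \<tau> R (B / prob A) (\<lambda>k. if even k then i else 3 - i) \<rho>"
proof -
  let ?N = "uniform_measure M A" and ?ph = "\<lambda>k::nat. if even k then i else 3 - i"
  have pred: "Measurable.pred M (\<lambda>\<omega>. Q (Y k \<omega>))" for Q k
    using measurable_compose[OF Y_meas[of k], of Q "count_space UNIV"] by simp
  have As: "A \<in> sets M" unfolding A using pred[of "\<lambda>s. \<tau> s = i" 0] by simp
  have A0: "emeasure M A \<noteq> 0" "emeasure M A < \<infinity>" using A(2) by (auto simp: emeasure_eq_measure)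
  have AE_N: "(AE \<omega> in ?N. Q \<omega>) \<longleftrightarrow> (AE \<omega> in M. \<omega> \<in> A \<longrightarrow> Q \<omega>)" for Q
    by (rule AE_uniform_measure[OF A0])
  have meas_N: "measurable ?N L = measurable M L" for L by (intro measurable_cong_sets) auto
  have types: "AE \<omega> in M. \<forall>k. \<tau> (Y k \<omega>) = (if even k then \<tau> (Y 0 \<omega>) else 3 - \<tau> (Y 0 \<omega>)) \<and> \<tau> (Y k \<omega>) \<in> {1, 2}"
  proof -
    have "AE \<omega> in M. \<forall>k. \<tau> (Y (Suc k) \<omega>) = 3 - \<tau> (Y k \<omega>)" using alternate by (simp add: AE_all_countable)
    moreover have "AE \<omega> in M. \<forall>k. Y k \<omega> \<in> S" using Y_S by (simp add: AE_all_countable)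
    ultimately show ?thesis
    proof eventually_elim
      case (elim \<omega>)
      have t: "\<tau> (Y k \<omega>) \<in> {1, 2}" for k using elim(2) ty12 by blast
      have "\<tau> (Y k \<omega>) = (if even k then \<tau> (Y 0 \<omega>) else 3 - \<tau> (Y 0 \<omega>))" for k
      proof (induction k)
        case (Suc k)
        then show ?case using elim(1) t[of 0] by auto
      qed simp
      then show ?case using t by blast
    qed
  qed
  have phA: "AE \<omega> in M. \<omega> \<in> A \<longleftrightarrow> \<tau> (Y k \<omega>) = ?ph k" for k
    using types AE_space
  proof eventually_elim
    case (elim \<omega>)
    have t: "\<tau> (Y 0 \<omega>) \<in> {1, 2}" "\<tau> (Y k \<omega>) = (if even k then \<tau> (Y 0 \<omega>) else 3 - \<tau> (Y 0 \<omega>))"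
      using elim(1) by blast+
    then show ?case using i elim(2) by (auto simp: A)
  qed
  interpret N: prob_space ?N by (rule prob_space_uniform_measure) (use A0 in auto)
  show ?thesis
  proof unfold_locales
    show "Y k \<in> measurable ?N (count_space UNIV)" for k unfolding meas_N by (rule Y_meas)
    show "countable (Y k ` space ?N)" for k using Y_range by simp
    show "AE \<omega> in ?N. Y k \<omega> \<in> S" for k unfolding AE_N using Y_S[of k] by eventually_elim simp
    show "N.prob {\<omega> \<in> space ?N. Y j \<omega> = s \<and> Y (j + m) \<omega> = t} =
        N.prob {\<omega> \<in> space ?N. Y j \<omega> = s} * pmf (K m s) t" for j m s t
    proof -
      have *: "N.prob {\<omega> \<in> space ?N. Y j \<omega> = s \<and> Q \<omega>} =
          (if \<tau> s = ?ph j then prob {\<omega> \<in> space M. Y j \<omega> = s \<and> Q \<omega>} / prob A else 0)"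
        if Q: "Measurable.pred M Q" for Q
      proof -
        note [measurable] = Q pred[of "\<lambda>x. x = s" j]
        have E: "{\<omega> \<in> space M. Y j \<omega> = s \<and> Q \<omega>} \<in> sets M" by measurable
        have "N.prob {\<omega> \<in> space ?N. Y j \<omega> = s \<and> Q \<omega>} =
            prob (A \<inter> {\<omega> \<in> space M. Y j \<omega> = s \<and> Q \<omega>}) / prob A"
          using measure_uniform_measure[of M A "{\<omega> \<in> space M. Y j \<omega> = s \<and> Q \<omega>}"] A0 E by simp
        also have "prob (A \<inter> {\<omega> \<in> space M. Y j \<omega> = s \<and> Q \<omega>}) =
            prob (if \<tau> s = ?ph j then {\<omega> \<in> space M. Y j \<omega> = s \<and> Q \<omega>} else {})"
        proof (rule finite_measure_eq_AE)
          show "AE \<omega> in M. (\<omega> \<in> A \<inter> {\<omega> \<in> space M. Y j \<omega> = s \<and> Q \<omega>}) =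
              (\<omega> \<in> (if \<tau> s = ?ph j then {\<omega> \<in> space M. Y j \<omega> = s \<and> Q \<omega>} else {}))"
            using phA[of j]
          proof eventually_elim
            case (elim \<omega>)
            show ?case
            proof (cases "\<tau> s = ?ph j")
              case True
              then have "Y j \<omega> = s \<Longrightarrow> \<omega> \<in> A" using elim by simp
              then show ?thesis using True by auto
            next
              case False
              then have "Y j \<omega> = s \<Longrightarrow> \<omega> \<notin> A" using elim by blast
              then show ?thesis using False by auto
            qed
          qed
        qed (use As E in auto)
        finally show ?thesis by simp
      qed
      have "N.prob {\<omega> \<in> space ?N. Y j \<omega> = s} = N.prob {\<omega> \<in> space ?N. Y j \<omega> = s \<and> True}" by simp
      then show ?thesis
        using *[OF pred[of "\<lambda>x. x = t" "j + m"]] *[of "\<lambda>_. True"] two_times[of j s m t] by simp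
    qed
    show "K m s = K m s'" if "s \<in> S" "s' \<in> S" "\<tau> s = \<tau> s'" "\<kappa> s < m" "\<kappa> s' < m" for m s s'
      by (rule forget[OF that])
    show "1 < R" by (rule R)
    show "0 \<le> B / prob A" using B by simp
    show "(\<integral>\<^sup>+\<omega>. ennreal (R ^ \<kappa> (Y k \<omega>)) \<partial>?N) \<le> ennreal (B / prob A)" for k
    proof -
      have f: "(\<lambda>\<omega>. ennreal (R ^ \<kappa> (Y k \<omega>))) \<in> borel_measurable M"
        using measurable_compose[OF Y_meas[of k], of "\<lambda>s. ennreal (R ^ \<kappa> s)" borel] by simp
      have "(\<integral>\<^sup>+\<omega>. ennreal (R ^ \<kappa> (Y k \<omega>)) \<partial>?N) =
          (\<integral>\<^sup>+\<omega>. ennreal (R ^ \<kappa> (Y k \<omega>)) * indicator A \<omega> \<partial>M) / emeasure M A"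
        by (rule nn_integral_uniform_measure[OF f As])
      also have "\<dots> \<le> ennreal B / emeasure M A"
        by (intro divide_right_mono_ennreal order.trans[OF nn_integral_mono moments[of k]])
           (auto split: split_indicator)
      also have "\<dots> = ennreal (B / prob A)"
        using A(2) B by (simp add: emeasure_eq_measure divide_ennreal)
      finally show ?thesis .
    qed
    show "AE \<omega> in ?N. \<tau> (Y k \<omega>) = ?ph k" for k
      unfolding AE_N using phA[of k] by eventually_elim simp
    show "set_pmf \<rho> \<subseteq> S" by (rule rho_S)
    show "bind_pmf \<rho> (K m) = \<rho>" for m by (rule rho_inv)
    show "measure_pmf.prob \<rho> {s. \<tau> s = 1} = 1 / 2" by (rule rho_half)
    show "\<tau> s \<in> {1, 2}" if "s \<in> S" for s using ty12[OF that] .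
    show "?ph 0 \<in> {1, 2}" using i by simp
    show "?ph 1 = 3 - ?ph 0" by simp
  qed
qed

theorem ergodic:
  fixes h :: "'s \<Rightarrow> real"
  assumes r: "1 < r" "r < R" and C: "C > 0" and h: "\<And>s. s \<in> S \<Longrightarrow> \<bar>h s\<bar> \<le> C * r ^ \<kappa> s"
  shows "integrable (measure_pmf \<rho>) h"
    and "AE \<omega> in M. (\<lambda>n. (\<Sum>k<n. h (Y k \<omega>)) / real n) \<longlonglongrightarrow> Ep \<rho> h"
proof -
  define h1 where "h1 s = (if s \<in> S then max 0 (h s) / C else 0)" for s
  define h2 where "h2 s = (if s \<in> S then max 0 (- h s) / C else 0)" for s
  have hs: "0 \<le> h1 s" "h1 s \<le> r ^ \<kappa> s" "0 \<le> h2 s" "h2 s \<le> r ^ \<kappa> s" for s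
    using h[of s] C r by (auto simp: h1_def h2_def field_simps max_def)
  have h12: "h s = C * h1 s - C * h2 s" if "s \<in> S" for s
    using that C by (simp add: h1_def h2_def max_def)
  have key: "integrable (measure_pmf \<rho>) g \<and>
      (AE \<omega> in M. \<omega> \<in> A \<longrightarrow> (\<lambda>n. (\<Sum>k<n. g (Y k \<omega>)) / real n) \<longlonglongrightarrow> Ep \<rho> g)"
    if g: "\<And>s. 0 \<le> g s" "\<And>s. g s \<le> r ^ \<kappa> s" and i: "i \<in> {1, 2}"
      and A: "A = {\<omega> \<in> space M. \<tau> (Y 0 \<omega>) = i}" "prob A > 0" for g i A
  proof -
    interpret N: phase_chain_inv "uniform_measure M A" Y K S \<kappa> \<tau> R "B / prob A" "\<lambda>k. if even k then i else 3 - i" \<rho>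
      by (rule conditional_phase_chain[OF i A])
    interpret N': phase_chain_inv_fun "uniform_measure M A" Y K S \<kappa> \<tau> R "B / prob A" "\<lambda>k. if even k then i else 3 - i" \<rho> g r
      by unfold_locales (use g r in auto)
    have A0: "emeasure M A \<noteq> 0" "emeasure M A < \<infinity>" using A(2) by (auto simp: emeasure_eq_measure)
    show ?thesis
      using N'.integrable_h iffD1[OF AE_uniform_measure[OF A0] N'.lln] by (rule conjI)
  qed
  define A where "A i = {\<omega> \<in> space M. \<tau> (Y 0 \<omega>) = i}" for i
  have As: "A i \<in> sets M" for i
    unfolding A_def using measurable_compose[OF Y_meas[of 0], of "\<lambda>s. \<tau> s = i" "count_space UNIV"] by simp
  have cover: "AE \<omega> in M. \<omega> \<in> A 1 \<or> \<omega> \<in> A 2"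
    using Y_S[of 0] AE_space by eventually_elim (use ty12 in \<open>auto simp: A_def\<close>)
  have null: "AE \<omega> in M. \<omega> \<notin> A i" if "\<not> prob (A i) > 0" for i
  proof -
    have "prob (A i) = 0" using that measure_nonneg[of M "A i"] by linarith
    then show ?thesis using As[of i] by (intro AE_not_in null_setsI) (auto simp: emeasure_eq_measure)
  qed
  have all: "integrable (measure_pmf \<rho>) g \<and>
      (AE \<omega> in M. (\<lambda>n. (\<Sum>k<n. g (Y k \<omega>)) / real n) \<longlonglongrightarrow> Ep \<rho> g)"
    if g: "\<And>s. 0 \<le> g s" "\<And>s. g s \<le> r ^ \<kappa> s" for g
  proof
    have "\<exists>i\<in>{1, 2}. prob (A i) > 0"
    proof (rule ccontr)
      assume "\<not> ?thesis"
      then have "AE \<omega> in M. \<omega> \<notin> A 1" "AE \<omega> in M. \<omega> \<notin> A 2" using null by auto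
      with cover have "AE \<omega> in M. False" by eventually_elim auto
      then show False by simp
    qed
    then show "integrable (measure_pmf \<rho>) g" using key[OF g _ A_def] by blast
    have t: "AE \<omega> in M. \<omega> \<in> A i \<longrightarrow> (\<lambda>n. (\<Sum>k<n. g (Y k \<omega>)) / real n) \<longlonglongrightarrow> Ep \<rho> g" if i: "i \<in> {1, 2}" for i
    proof (cases "prob (A i) > 0")
      case True
      then show ?thesis using key[OF g i A_def] by blast
    next
      case False
      show ?thesis using null[OF False] by eventually_elim simp
    qed
    have "1 \<in> {1, 2 :: nat}" "2 \<in> {1, 2 :: nat}" by auto
    from t[OF this(1)] t[OF this(2)] cover show "AE \<omega> in M. (\<lambda>n. (\<Sum>k<n. g (Y k \<omega>)) / real n) \<longlonglongrightarrow> Ep \<rho> g"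
      by eventually_elim auto
  qed
  have 1: "integrable (measure_pmf \<rho>) h1" "AE \<omega> in M. (\<lambda>n. (\<Sum>k<n. h1 (Y k \<omega>)) / real n) \<longlonglongrightarrow> Ep \<rho> h1"
    using all[of h1] hs by auto
  have 2: "integrable (measure_pmf \<rho>) h2" "AE \<omega> in M. (\<lambda>n. (\<Sum>k<n. h2 (Y k \<omega>)) / real n) \<longlonglongrightarrow> Ep \<rho> h2"
    using all[of h2] hs by auto
  have hrho: "AE s in measure_pmf \<rho>. h s = C * h1 s - C * h2 s"
    using rho_S h12 by (auto simp: AE_measure_pmf_iff)
  have "integrable (measure_pmf \<rho>) (\<lambda>s. C * h1 s - C * h2 s)" using 1(1) 2(1) by simp
  then show "integrable (measure_pmf \<rho>) h"
    by (rule integrable_cong_AE_imp) (use hrho in auto)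
  have E: "Ep \<rho> h = C * Ep \<rho> h1 - C * Ep \<rho> h2"
  proof -
    have "Ep \<rho> h = Ep \<rho> (\<lambda>s. C * h1 s - C * h2 s)" using hrho by (intro integral_cong_AE) auto
    then show ?thesis using 1(1) 2(1) by simp
  qed
  have "AE \<omega> in M. \<forall>k. Y k \<omega> \<in> S" using Y_S by (simp add: AE_all_countable)
  with 1(2) 2(2) show "AE \<omega> in M. (\<lambda>n. (\<Sum>k<n. h (Y k \<omega>)) / real n) \<longlonglongrightarrow> Ep \<rho> h"
  proof eventually_elim
    case (elim \<omega>)
    have "(\<Sum>k<n. h (Y k \<omega>)) / real n = C * ((\<Sum>k<n. h1 (Y k \<omega>)) / real n) - C * ((\<Sum>k<n. h2 (Y k \<omega>)) / real n)" for n
      using elim(3) h12 by (simp add: sum_subtractf diff_divide_distrib flip: sum_distrib_left)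
    moreover have "(\<lambda>n. C * ((\<Sum>k<n. h1 (Y k \<omega>)) / real n) - C * ((\<Sum>k<n. h2 (Y k \<omega>)) / real n)) \<longlonglongrightarrow> Ep \<rho> h"
      unfolding E by (intro tendsto_intros elim)
    ultimately show ?case by simp
  qed
qed

end

section \<open>The two chains of the free product\<close>

lemma remdups_adj_remdups_adj_append: "remdups_adj (remdups_adj xs @ ys) = remdups_adj (xs @ ys)"
proof (induction xs rule: remdups_adj.induct)
  case (3 x y xs)
  obtain ws where "remdups_adj (y # xs) = y # ws" by (metis remdups_adj_Cons_alt)
  then show ?case using 3 by auto
qed auto

lemma map_append_unshift:
  assumes "\<And>w. w \<in> set L \<Longrightarrow> \<exists>u. w = c @ u"
  shows "map ((@) c) (unshift c L) = L"
  unfolding unshift_def map_map by (rule map_idI) (use assms in force)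

lemma unshift_remdups_adj:
  assumes "\<And>w. w \<in> set L \<Longrightarrow> \<exists>u. w = c @ u"
  shows "unshift c (remdups_adj L) = remdups_adj (unshift c L)"
proof -
  have "remdups_adj L = map ((@) c) (remdups_adj (unshift c L))"
    using map_append_unshift[OF assms] remdups_adj_map_injective[of "(@) c" "unshift c L"]
    by (simp add: inj_def)
  then show ?thesis by simp
qed

lemma hd_restrict_path_gate:
  assumes "successively E \<pi>" "\<pi> \<noteq> []" "hd \<pi> \<notin> A"
    and into: "\<And>x y. E x y \<Longrightarrow> x \<notin> A \<Longrightarrow> y \<in> A \<Longrightarrow> y = c"
    and ne: "restrict_path \<pi> A \<noteq> []"
  shows "hd (restrict_path \<pi> A) = c"
proof -
  have "filter (\<lambda>v. v \<in> A) \<pi> = [] \<or> hd (filter (\<lambda>v. v \<in> A) \<pi>) = c"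
    using assms(1-3)
  proof (induction \<pi>)
    case (Cons x xs)
    show ?case
    proof (cases xs)
      case (Cons y ys)
      then have "E x y" "successively E xs" using Cons.prems by auto
      then show ?thesis using Cons Cons.IH Cons.prems into[of x y] by (cases "y \<in> A") auto
    qed (use Cons.prems in auto)
  qed simp
  then show ?thesis using ne by (auto simp: restrict_path_def)
qed

context transient_walk
begin

lemma cone_append_iff:
  assumes "c \<in> W" "c = c' @ [g]" "c' @ w \<in> W"
  shows "c' @ w \<in> cn c \<longleftrightarrow> w \<in> cn [g]"
  using assms by (auto simp: cone_def append_W)

lemma hists_prefix:
  assumes h: "h \<in> hists k" and k: "k \<ge> 1"
  obtains c g where "last h = c @ [g]" "c \<in> W" "g \<in> N 1 \<union> N 2" "[g] \<in> W" "length c = k - 1"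
    "wty (last h) = ty g" "c \<noteq> [] \<Longrightarrow> wty c \<noteq> ty g"
proof -
  have l: "last h \<in> W" "last h \<noteq> []" "length (last h) = k"
    using hists_last[OF h] hists_last_ne[OF h k] by auto
  then obtain c g where cg: "last h = c @ [g]" by (cases "last h" rule: rev_cases) auto
  then have "c \<in> W" "[g] \<in> W" "c \<noteq> [] \<Longrightarrow> wty c \<noteq> ty g" using l(1) by (auto simp: append_W wty_def)
  moreover have "g \<in> N 1 \<union> N 2" using W_letters[OF l(1), of g] cg by simp
  ultimately show ?thesis using that cg l by (auto simp: wty_def)
qed

text \<open>The chain \<open>(W\<^sub>k, \<psi>\<^sub>k)\<close> as a function of the history, and its update by a block.\<close>

definition psi_of :: "'a list list \<Rightarrow> 'a \<times> 'a list list" where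
  "psi_of h = (last (last h),
     if length (last h) = 1 then restrict_path h (VS (wty (last h)))
     else unshift (butlast (last h)) (restrict_path h (cn (butlast (last h)))))"

definition psi_upd :: "'a \<times> 'a list list \<Rightarrow> 'a list list \<Rightarrow> 'a \<times> 'a list list" where
  "psi_upd s a = (last (last a), remdups_adj (unshift [fst s] (filter (\<lambda>w. w \<in> cn [fst s]) (snd s)) @ a))"

lemma cone_letter_prefix: "w \<in> cn c \<Longrightarrow> \<exists>u. w = c @ u" by (auto simp: cone_def)

lemma psi_of_restrict:
  assumes h: "h \<in> hists k" and k: "k \<ge> 1"
  shows "unshift [last (last h)] (restrict_path (snd (psi_of h)) (cn [last (last h)])) =
    unshift (last h) (restrict_path h (cn (last h)))"
proof -
  obtain c g where cg: "last h = c @ [g]" "c \<in> W" "g \<in> N 1 \<union> N 2" "[g] \<in> W" "length c = k - 1"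
    "wty (last h) = ty g" using hists_prefix[OF h k] by metis
  show ?thesis
  proof (cases "c = []")
    case True
    have "cn [g] \<subseteq> VS (ty g)" using ty_in[OF cg(3)] by (auto simp: cone_def vstar_def)
    then have "restrict_path (restrict_path h (VS (ty g))) (cn [g]) = restrict_path h (cn [g])"
      by (rule restrict_path_restrict_path)
    then show ?thesis using True cg by (simp add: psi_of_def)
  next
    case False
    define \<phi> where "\<phi> = unshift c (restrict_path h (cn c))"
    have \<phi>: "snd (psi_of h) = \<phi>" using cg(1) False by (simp add: psi_of_def \<phi>_def)
    have L: "restrict_path h (cn c) = map ((@) c) \<phi>"
      unfolding \<phi>_def by (rule map_append_unshift[symmetric]) (auto simp: set_restrict_path cone_def)
    have cW: "c @ [g] \<in> W" using hists_last[OF h] cg by simp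
    have "cn (c @ [g]) \<subseteq> cn c" using cg by (auto simp: cone_def)
    then have "restrict_path h (cn (c @ [g])) = restrict_path (map ((@) c) \<phi>) (cn (c @ [g]))"
      using restrict_path_restrict_path[of "cn (c @ [g])" "cn c" h] L by simp
    also have "\<dots> = map ((@) c) (restrict_path \<phi> {w. c @ w \<in> cn (c @ [g])})"
      by (rule restrict_path_map_append)
    also have "restrict_path \<phi> {w. c @ w \<in> cn (c @ [g])} = restrict_path \<phi> (cn [g])"
    proof (rule restrict_path_cong)
      fix w assume "w \<in> set \<phi>"
      then have "c @ w \<in> set (restrict_path h (cn c))" unfolding L by simp
      then have "c @ w \<in> W" by (auto simp: set_restrict_path cone_def)
      then show "w \<in> {w. c @ w \<in> cn (c @ [g])} \<longleftrightarrow> w \<in> cn [g]" using cone_append_iff[OF cW] by simp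
    qed
    finally have "restrict_path h (cn (last h)) = map ((@) c) (restrict_path \<phi> (cn [g]))" by (simp add: cg)
    then show ?thesis using cg \<phi> by (simp add: unshift_def)
  qed
qed

lemma psi_of_ext_snd:
  assumes h: "h \<in> hists k" and k: "k \<ge> 1" and a: "a \<in> blocks (opp h)"
  shows "snd (psi_of (ext h a)) = unshift (last h) (restrict_path h (cn (last h))) @ tl a"
    and "snd (psi_of (ext h a)) = remdups_adj (unshift (last h) (restrict_path h (cn (last h))) @ a)"
    and "unshift (last h) (restrict_path h (cn (last h))) \<noteq> []"
proof -
  define c where "c = last h"
  have c: "c \<in> W" "c \<noteq> []" "h \<noteq> []" using hists_last[OF h] hists_last_ne[OF h k] by (auto simp: c_def)
  obtain z where z: "last a = [z]" using block_letter(2)[OF a opp_range] by metis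
  have le: "last (ext h a) = c @ [z]" using last_ext[OF a] z by (simp add: c_def)
  define F where "F = unshift c (filter (\<lambda>w. w \<in> cn c) h)"
  have F: "map ((@) c) F = filter (\<lambda>w. w \<in> cn c) h"
    unfolding F_def by (rule map_append_unshift) (auto simp: cone_def)
  have "filter (\<lambda>w. w \<in> cn c) h \<noteq> [] \<and> last (filter (\<lambda>w. w \<in> cn c) h) = c"
    using c cone_refl[OF c(1)] by (cases h rule: rev_cases) (auto simp: c_def)
  then have Fl: "F \<noteq> []" "last F = []" by (auto simp: F_def unshift_def last_map)
  have "c @ w \<in> cn c" if "w \<in> set (tl a)" for w
    using that a list.set_sel(2)[of a w] blocks_ne[OF a] unfolding cone_eq[OF c(1,2)]
    by (auto simp: blocks_def c_def)
  then have "filter (\<lambda>w. w \<in> cn c) (map ((@) c) (tl a)) = map ((@) c) (tl a)" by (intro filter_True) auto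
  then have "filter (\<lambda>w. w \<in> cn c) (ext h a) = map ((@) c) (F @ tl a)"
    using F by (simp add: ext_def c_def)
  then have r: "restrict_path (ext h a) (cn c) = map ((@) c) (remdups_adj (F @ tl a))"
    by (simp only: restrict_path_def) (rule remdups_adj_map_injective, simp add: inj_def)
  have s: "snd (psi_of (ext h a)) = remdups_adj (F @ tl a)"
    using le c(2) r by (simp add: psi_of_def)
  have u: "unshift c (restrict_path h (cn c)) = remdups_adj F"
    unfolding restrict_path_def F_def by (rule unshift_remdups_adj) (auto simp: cone_def)
  have sa: "successively adm a" "a \<noteq> []" "last F = hd a" using a Fl by (auto simp: blocks_def)
  note t = remdups_adj_successively_append_tl[OF sa(1) adm_irrefl sa(2) Fl(1) sa(3)]
  show "snd (psi_of (ext h a)) = unshift (last h) (restrict_path h (cn (last h))) @ tl a"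
    using s t(2) u by (simp add: c_def)
  show "snd (psi_of (ext h a)) = remdups_adj (unshift (last h) (restrict_path h (cn (last h))) @ a)"
    using s t(1) u by (simp add: c_def remdups_adj_remdups_adj_append)
  show "unshift (last h) (restrict_path h (cn (last h))) \<noteq> []" using u Fl by (simp add: c_def)
qed

lemma psi_of_ext:
  assumes h: "h \<in> hists k" and k: "k \<ge> 1" and a: "a \<in> blocks (opp h)"
  shows "psi_of (ext h a) = psi_upd (psi_of h) a"
proof -
  let ?g = "last (last h)"
  have g: "fst (psi_of h) = ?g" by (simp add: psi_of_def)
  have "last a \<noteq> []" using block_letter(2)[OF a opp_range] by (metis list.distinct(1))
  then have "fst (psi_of (ext h a)) = last (last a)" using last_ext[OF a] by (simp add: psi_of_def)
  moreover have "unshift [?g] (restrict_path (snd (psi_of h)) (cn [?g])) =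
      remdups_adj (unshift [?g] (filter (\<lambda>w. w \<in> cn [?g]) (snd (psi_of h))))"
    unfolding restrict_path_def by (rule unshift_remdups_adj) (auto simp: cone_def)
  then have "snd (psi_of (ext h a)) =
      remdups_adj (unshift [?g] (filter (\<lambda>w. w \<in> cn [?g]) (snd (psi_of h))) @ a)"
    using psi_of_ext_snd(2)[OF h k a] psi_of_restrict[OF h k] by (simp add: remdups_adj_remdups_adj_append)
  ultimately show ?thesis by (intro prod_eqI) (auto simp: psi_upd_def g)
qed

definition psi_states :: "('a \<times> 'a list list) set" where
  "psi_states = {(g, \<phi>). g \<in> N 1 \<union> N 2 \<and> \<phi> \<in> fp_paths V rt p \<alpha> \<and> hd \<phi> = [] \<and> last \<phi> = [g]}"

lemma psi_of_states:
  assumes h: "h \<in> hists k" and k: "k \<ge> 1"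
  shows "psi_of h \<in> psi_states"
proof -
  obtain c g where cg: "last h = c @ [g]" "c \<in> W" "g \<in> N 1 \<union> N 2" "[g] \<in> W" "length c = k - 1"
    "wty (last h) = ty g" using hists_prefix[OF h k] by metis
  have hp: "h \<noteq> []" "hd h = []" "set h \<subseteq> W" "successively adm h" "last h \<in> W"
    using h hists_last[OF h] by (auto simp: hists_def)
  show ?thesis
  proof (cases "c = []")
    case True
    let ?A = "VS (ty g)"
    have "[g] \<in> ?A" using cg ty_in[OF cg(3)] by (simp add: vstar_def)
    then have "last (restrict_path h ?A) = [g]" using last_restrict_path[OF hp(1)] cg True by simp
    moreover have "hd (restrict_path h ?A) = []" using hd_restrict_path[OF hp(1)] hp(2) by simp
    moreover have "successively adm (restrict_path h ?A)"
      by (rule successively_restrict_path[OF hp(4)]) (use vstar_gate[OF _ ty_12(1)] in blast)+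
    moreover have "[g] \<in> set (restrict_path h ?A)"
      using \<open>[g] \<in> ?A\<close> hp(1) cg True last_in_set[OF hp(1)] by (simp add: set_restrict_path)
    then have "restrict_path h ?A \<noteq> []" by force
    ultimately show ?thesis using cg True hp(3)
      by (auto simp: psi_states_def psi_of_def fp_paths_def set_restrict_path)
  next
    case False
    define L where "L = restrict_path h (cn c)"
    define \<phi> where "\<phi> = unshift c L"
    have "last h \<in> cn c" using cg hp(5) by (auto simp: cone_def)
    then have Ll: "last L = last h" "L \<noteq> []"
      using last_restrict_path[OF hp(1)] last_in_set[OF hp(1)] by (auto simp: L_def set_restrict_path simp flip: set_empty)
    have Ls: "set L \<subseteq> cn c" by (auto simp: L_def set_restrict_path)
    have Lphi: "L = map ((@) c) \<phi>" unfolding \<phi>_def by (rule map_append_unshift[symmetric]) (use Ls in \<open>auto simp: cone_def\<close>)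
    have "successively adm L"
      unfolding L_def by (rule successively_restrict_path[OF hp(4)]) (use cone_gate in blast)+
    moreover have sphi: "set \<phi> \<subseteq> VS (3 - wty c)"
      using Ls unfolding Lphi cone_eq[OF cg(2) False] by auto
    ultimately have "successively adm \<phi>" using successively_shift[OF cg(2) False] Lphi by simp
    moreover have "hd L = c"
      unfolding L_def
    proof (rule hd_restrict_path_gate[OF hp(4) hp(1)])
      show "hd h \<notin> cn c" using hp(2) False by (auto simp: cone_def)
      show "restrict_path h (cn c) \<noteq> []" using Ll(2) by (simp add: L_def)
    qed (use cone_gate in blast)
    then have "hd \<phi> = []" "\<phi> \<noteq> []" using Ll(2) unfolding Lphi by (auto simp: hd_map)
    moreover have "last \<phi> = [g]" using Ll cg(1) \<open>\<phi> \<noteq> []\<close> unfolding Lphi by (simp add: last_map)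
    moreover have "set \<phi> \<subseteq> W" using sphi vstar_W by blast
    ultimately show ?thesis using cg False
      by (auto simp: psi_states_def psi_of_def fp_paths_def L_def \<phi>_def)
  qed
qed

lemma WPsi_psi_of:
  assumes "nice (\<lambda>n. X n \<omega>)" "k \<ge> 1"
  shows "WPsi V rt X k \<omega> = psi_of (H k \<omega>)"
proof -
  let ?x = "\<lambda>n. X n \<omega>"
  have len: "length (?x (et ?x k)) = k" by (rule entry_length[OF assms(1)])
  have ne: "?x (et ?x k) \<noteq> []" using len assms(2) by auto
  have lh: "last (H k \<omega>) = ?x (et ?x k)" by (simp add: H_hist hist_def)
  show ?thesis
  proof (cases "k = 1")
    case True
    then show ?thesis using len word_type_wty[OF nice_W[OF assms(1)] ne]
      by (simp add: WPsi_def psi_of_def lh last_letter_def entry_point_def psi_def Let_def)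
         (simp add: H_hist hist_def)?
  next
    case False
    have "?x (et ?x (k - 1)) = butlast (?x (et ?x k))"
      using entry_time_Suc(2)[OF assms(1), of "k - 1"] assms(2) by simp
    then show ?thesis using False len
      by (simp add: WPsi_def psi_of_def lh last_letter_def entry_point_def psi_def Let_def)
         (simp add: H_hist hist_def)?
  qed
qed

text \<open>The chain \<open>(W\<^sub>k, e\<^sub>k - e\<^sub>k\<^sub>-\<^sub>1)\<close>.\<close>

definition prev_entry :: "'a list list \<Rightarrow> nat" where
  "prev_entry h = (LEAST l. \<forall>i. l \<le> i \<and> i < length h \<longrightarrow> h ! i \<in> cn (butlast (last h)))"

definition inc_of :: "'a list list \<Rightarrow> 'a \<times> nat" where
  "inc_of h = (last (last h), length h - 1 - prev_entry h)"

definition inc_upd :: "'a \<times> nat \<Rightarrow> 'a list list \<Rightarrow> 'a \<times> nat" where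
  "inc_upd s a = (last (last a), length a - 1)"

lemma inc_of_ext:
  assumes h: "h \<in> hists k" and k: "k \<ge> 1" and a: "a \<in> blocks (opp h)"
  shows "inc_of (ext h a) = inc_upd (inc_of h) a"
proof -
  define c where "c = last h"
  have c: "c \<in> W" "c \<noteq> []" "h \<noteq> []" using hists_last[OF h] hists_last_ne[OF h k] by (auto simp: c_def)
  have h2: "2 \<le> length h" "last (butlast h) \<notin> cn c" using h by (auto simp: hists_def c_def)
  obtain z where z: "last a = [z]" using block_letter(2)[OF a opp_range] by metis
  have le: "last (ext h a) = c @ [z]" using last_ext[OF a] z by (simp add: c_def)
  have mem: "c @ w \<in> cn c" if "w \<in> set (tl a)" for w
    using that a list.set_sel(2)[of a w] blocks_ne[OF a] unfolding cone_eq[OF c(1,2)]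
    by (auto simp: blocks_def c_def)
  have "prev_entry (ext h a) = length h - 1"
    unfolding prev_entry_def le butlast_snoc
  proof (rule Least_equality)
    show "\<forall>i. length h - 1 \<le> i \<and> i < length (ext h a) \<longrightarrow> ext h a ! i \<in> cn c"
    proof (intro allI impI)
      fix i assume i: "length h - 1 \<le> i \<and> i < length (ext h a)"
      show "ext h a ! i \<in> cn c"
      proof (cases "i = length h - 1")
        case True
        then have "ext h a ! i = c" using c by (simp add: ext_def nth_append c_def last_conv_nth)
        then show ?thesis using cone_refl[OF c(1)] by simp
      next
        case False
        then have ge: "i \<ge> length h" using i by linarith
        have "i < length h + length (tl a)" using i by (simp add: ext_def)
        then have lt: "i - length h < length (tl a)" using ge by linarith
        then have "ext h a ! i = c @ tl a ! (i - length h)" using ge by (simp add: ext_def nth_append c_def)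
        then show ?thesis using mem[OF nth_mem[OF lt]] by simp
      qed
    qed
    fix l assume l: "\<forall>i. l \<le> i \<and> i < length (ext h a) \<longrightarrow> ext h a ! i \<in> cn c"
    show "length h - 1 \<le> l"
    proof (rule ccontr)
      assume "\<not> ?thesis"
      then have "l \<le> length h - 2" "length h - 2 < length (ext h a)" using h2 by (auto simp: ext_def)
      then have "ext h a ! (length h - 2) \<in> cn c" using l by blast
      moreover have "ext h a ! (length h - 2) = last (butlast h)"
        using h2 by (simp add: ext_def nth_append last_conv_nth nth_butlast numeral_2_eq_2 flip: length_greater_0_conv)
      ultimately show False using h2 by simp
    qed
  qed
  moreover have "length (ext h a) - 1 - (length h - 1) = length a - 1"
    using h2(1) by (simp add: ext_def)
  ultimately show ?thesis using le z by (simp add: inc_of_def inc_upd_def)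
qed

definition inc_states :: "('a \<times> nat) set" where "inc_states = (N 1 \<union> N 2) \<times> {1..}"

lemma inc_of_states:
  assumes h: "h \<in> hists k" and k: "k \<ge> 1"
  shows "inc_of h \<in> inc_states"
proof -
  obtain c g where cg: "last h = c @ [g]" "c \<in> W" "g \<in> N 1 \<union> N 2" "[g] \<in> W" using hists_prefix[OF h k] by metis
  have h2: "2 \<le> length h" "last h \<in> W" "h \<noteq> []" using h hists_last[OF h] by (auto simp: hists_def)
  obtain b where b: "h = b @ [last h]" using h2 by (metis append_butlast_last_id)
  then have bne: "b \<noteq> []" using h2(1) by (metis append_Nil length_Cons list.size(3) numeral_le_one_iff
        semiring_norm(69) One_nat_def)
  have lc: "last h \<in> cn c" "last h \<noteq> c" using cg h2 by (auto simp: cone_def)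
  have "adm (last b) (last h)" using h b bne
    by (metis (mono_tags, lifting) hists_def list.sel(1) list.simps(3) mem_Collect_eq successively_append_iff)
  then have bc: "last b \<in> cn c" using cone_gate(2)[of "last b" "last h" c] lc by blast
  have "prev_entry h \<le> length h - 2"
    unfolding prev_entry_def
  proof (rule Least_le, intro allI impI)
    fix i assume i: "length h - 2 \<le> i \<and> i < length h"
    have bl: "butlast (last h) = c" using cg by simp
    have lb: "length h = Suc (length b)" "length b \<ge> 1" using b bne by (metis length_append_singleton, cases b) auto
    then have "i = length b - 1 \<or> i = length b" using i by linarith
    then show "h ! i \<in> cn (butlast (last h))"
    proof
      assume e: "i = length b - 1"
      then have "h ! i = last b" using lb by (subst b) (simp add: nth_append last_conv_nth bne)
      then show ?thesis using bc bl by simp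
    next
      assume "i = length b"
      then have "h ! i = last h" by (subst b) simp
      then show ?thesis using lc bl by simp
    qed
  qed
  then show ?thesis using cg h2 by (simp add: inc_of_def inc_states_def)
qed

end

lemma pmf_invariantI:
  fixes \<mu> :: "'s pmf"
  assumes D: "set_pmf \<mu> \<subseteq> D"
    and inv: "\<And>t. t \<in> D \<Longrightarrow> ((\<lambda>s. pmf \<mu> s * pmf (Q s) t) has_sum pmf \<mu> t) D"
  shows "bind_pmf \<mu> Q = \<mu>"
proof -
  have eqD: "pmf (bind_pmf \<mu> Q) t = pmf \<mu> t" if t: "t \<in> D" for t
  proof -
    let ?f = "\<lambda>s. pmf \<mu> s * pmf (Q s) t"
    have s: "?f summable_on D" "infsum ?f D = pmf \<mu> t" using inv[OF t] by (auto simp: has_sum_iff)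
    have a: "Infinite_Set_Sum.abs_summable_on ?f D"
      using s(1) by (simp add: abs_summable_equivalent[symmetric] summable_on_iff_abs_summable_on_real[symmetric])
    have "ennreal (pmf (bind_pmf \<mu> Q) t) = (\<integral>\<^sup>+s. ennreal (?f s) \<partial>count_space UNIV)"
      by (simp add: ennreal_pmf_bind nn_integral_measure_pmf ennreal_mult)
    also have "\<dots> = (\<integral>\<^sup>+s. ennreal (?f s) \<partial>count_space D)"
    proof -
      have "ennreal (?f s) = ennreal (?f s) * indicator D s" for s
        using D by (cases "s \<in> D") (auto simp: set_pmf_iff subset_iff)
      then show ?thesis by (subst (2) nn_integral_count_space_indicator) auto
    qed
    also have "\<dots> = ennreal (infsetsum ?f D)" by (rule nn_integral_conv_infsetsum[OF a]) simp
    also have "infsetsum ?f D = infsum ?f D" by (rule infsetsum_infsum[OF a])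
    finally show ?thesis using s by simp
  qed
  have "measure_pmf.prob (bind_pmf \<mu> Q) D = measure_pmf.prob \<mu> D"
    using infsetsum_cong[OF eqD refl, of D] by (simp add: measure_pmf_conv_infsetsum)
  also have "\<dots> = 1" using D by (simp add: measure_pmf.prob_eq_1 AE_measure_pmf_iff subset_iff)
  finally have "set_pmf (bind_pmf \<mu> Q) \<subseteq> D"
    by (auto simp: measure_pmf.prob_eq_1 AE_measure_pmf_iff)
  then show ?thesis
    using D eqD by (intro pmf_eqI) (metis pmf_eq_0_set_pmf subset_iff)
qed

locale sized_block_chain = block_chain V rt p \<alpha> M X \<Psi> T
  for V :: "nat \<Rightarrow> 'a set" and rt p \<alpha> and M :: "'w measure" and X
    and \<Psi> :: "'a list list \<Rightarrow> 'a \<times> 'b" and T +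
  fixes S :: "('a \<times> 'b) set" and \<kappa> :: "'a \<times> 'b \<Rightarrow> nat" and R B :: real
    and Z :: "nat \<Rightarrow> 'w \<Rightarrow> 'a \<times> 'b"
  assumes fst_T: "\<And>s a. fst (T s a) = last (last a)"
    and \<Psi>_S: "\<And>h k. h \<in> hists k \<Longrightarrow> k \<ge> 1 \<Longrightarrow> \<Psi> h \<in> S"
    and Z_measurable: "\<And>k. Z k \<in> measurable M (count_space UNIV)"
    and Z_\<Psi>: "AE \<omega> in M. \<forall>k\<ge>1. Z k \<omega> = \<Psi> (H k \<omega>)"
    and forget: "\<And>m s s'. s \<in> S \<Longrightarrow> s' \<in> S \<Longrightarrow> ty (fst s) = ty (fst s') \<Longrightarrow> \<kappa> s < m \<Longrightarrow> \<kappa> s' < m \<Longrightarrow>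
      iter_kernel Q m s = iter_kernel Q m s'"
    and R: "R > 1" and B: "B \<ge> 0"
    and moments: "\<And>k. k \<ge> 2 \<Longrightarrow> (\<integral>\<^sup>+\<omega>. ennreal (R ^ \<kappa> (Z k \<omega>)) \<partial>M) \<le> ennreal B"
begin

lemma Z_pred: "Measurable.pred M (\<lambda>\<omega>. L (Z k \<omega>))"
  using measurable_compose[OF Z_measurable[of k], of L "count_space UNIV"] by simp

lemma prob_Z: "k \<ge> 1 \<Longrightarrow> prob {\<omega> \<in> space M. Z k \<omega> = s} = prob {\<omega> \<in> space M. Y k \<omega> = s}"
  using Z_pred[of "\<lambda>x. x = s" k] Y_pred[of k s]
  by (intro finite_measure_eq_AE eventually_mono[OF Z_\<Psi>]) auto

lemma prob_Z_Z:
  "k \<ge> 1 \<Longrightarrow> prob {\<omega> \<in> space M. Z (Suc k) \<omega> = t \<and> Z k \<omega> = s} = prob {\<omega> \<in> space M. Z k \<omega> = s} * pmf (Q s) t"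
proof -
  assume k: "k \<ge> 1"
  note [measurable] = Z_pred[of "\<lambda>x. x = s" k] Z_pred[of "\<lambda>x. x = t" "Suc k"]
  have "prob {\<omega> \<in> space M. Z (Suc k) \<omega> = t \<and> Z k \<omega> = s} = prob {\<omega> \<in> space M. Y k \<omega> = s \<and> Y (k + 1) \<omega> = t}"
    using k by (intro finite_measure_eq_AE eventually_mono[OF Z_\<Psi>]) auto
  moreover have "iter_kernel Q 1 s = Q s"
  proof -
    have "iter_kernel Q 0 = return_pmf" by (intro ext) simp
    then show ?thesis by (simp add: bind_return_pmf')
  qed
  ultimately show ?thesis using prob_Y_Y[OF k, of s 1 t] prob_Z[OF k] by simp
qed

lemma step_prob_eq:
  assumes "s \<in> states_at M Z k" "k \<ge> 1"
  shows "step_prob M Z s t = pmf (Q s) t"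
proof -
  let ?k = "LEAST k. k \<ge> 1 \<and> s \<in> states_at M Z k"
  have k: "?k \<ge> 1 \<and> s \<in> states_at M Z ?k" by (rule LeastI[of _ k]) (use assms in simp)
  have "step_prob M Z s t = \<P>(\<omega> in M. Z (Suc ?k) \<omega> = t \<bar> Z ?k \<omega> = s)"
    by (simp add: step_prob_def Let_def)
  also have "\<dots> = pmf (Q s) t"
    using k prob_Z_Z[of ?k t s] by (simp add: cond_prob_def states_at_def)
  finally show ?thesis .
qed

lemma states_S:
  assumes "s \<in> states_at M Z k" "k \<ge> 1"
  shows "s \<in> S"
proof (rule ccontr)
  assume "s \<notin> S"
  have "AE \<omega> in M. Z k \<omega> \<noteq> s"
    using Z_\<Psi> AE_H_hists by eventually_elim (use assms(2) \<Psi>_S \<open>s \<notin> S\<close> in metis)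
  then have "prob {\<omega> \<in> space M. Z k \<omega> = s} = 0"
    using Z_pred[of "\<lambda>x. x = s" k] by (intro iffD2[OF prob_eq_0]) auto
  then show False using assms(1) by (simp add: states_at_def)
qed

lemma set_Q_type: "t \<in> set_pmf (Q s) \<Longrightarrow> ty (fst t) = 3 - ty (fst s)"
proof -
  assume "t \<in> set_pmf (Q s)"
  moreover have i: "3 - ty (fst s) \<in> {1, 2}" using ty_12(1)[of "fst s"] by auto
  ultimately obtain a where "a \<in> blocks (3 - ty (fst s))" "t = T s a"
    using set_mu[OF i] by (auto simp: Q_def)
  then show "ty (fst t) = 3 - ty (fst s)"
    using block_letter(3)[OF _ i, of a] by (simp add: fst_T wty_def)
qed

lemma invariant_half:
  assumes "bind_pmf \<mu> Q = \<mu>"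
  shows "measure_pmf.prob \<mu> {s. ty (fst s) = 1} = 1 / 2"
proof -
  let ?A = "{s. ty (fst s) = 1}"
  have "emeasure (Q s) ?A = indicator (- ?A) s" for s
  proof -
    have t: "ty (fst s) = 1 \<or> ty (fst s) = 2" using ty_12(1)[of "fst s"] by auto
    show ?thesis
    proof (cases "s \<in> ?A")
      case True
      then have "set_pmf (Q s) \<inter> ?A = {}" using set_Q_type[of _ s] by force
      then show ?thesis using True by (simp add: emeasure_Int_set_pmf[symmetric] Int_commute)
    next
      case False
      then have "set_pmf (Q s) \<subseteq> ?A" using set_Q_type[of _ s] t by force
      then have "emeasure (Q s) ?A = 1"
        by (intro measure_pmf.emeasure_eq_1_AE) (auto simp: AE_measure_pmf_iff)
      then show ?thesis using False by simp
    qed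
  qed
  then have "emeasure (bind_pmf \<mu> Q) ?A = emeasure \<mu> (- ?A)" by simp
  then have "measure_pmf.prob \<mu> ?A = measure_pmf.prob \<mu> (- ?A)"
    unfolding assms by (simp add: measure_pmf.emeasure_eq_measure)
  then show ?thesis using measure_pmf.prob_compl[of ?A \<mu>] by (simp add: Compl_eq_Diff_UNIV)
qed

text \<open>
  Averages of a function of the process converge to its mean under any invariant distribution.
  The first value is left out, since the length of the first segment is not controlled.
\<close>

theorem ergodic_chain:
  fixes h :: "'a \<times> 'b \<Rightarrow> real"
  assumes D: "D \<subseteq> (\<Union>k\<in>{1..}. states_at M Z k)" and inv: "invariant_distribution M Z D \<mu>"
    and r: "1 < r" "r < R" and C: "C > 0" and h: "\<And>s. s \<in> S \<Longrightarrow> \<bar>h s\<bar> \<le> C * r ^ \<kappa> s"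
  shows "integrable (measure_pmf \<mu>) h"
    and "AE \<omega> in M. (\<lambda>n. (\<Sum>k<n. h (Z (k + 2) \<omega>)) / real n) \<longlonglongrightarrow> Ep \<mu> h"
proof -
  have \<mu>D: "set_pmf \<mu> \<subseteq> D" using inv by (simp add: invariant_distribution_def)
  have st: "\<exists>k\<ge>1. s \<in> states_at M Z k" if "s \<in> D" for s using D that by auto
  have DS: "D \<subseteq> S" using st states_S by blast
  have b: "bind_pmf \<mu> Q = \<mu>"
  proof (rule pmf_invariantI[OF \<mu>D])
    fix t assume "t \<in> D"
    then have "((\<lambda>s. pmf \<mu> s * step_prob M Z s t) has_sum pmf \<mu> t) D"
      using inv by (simp add: invariant_distribution_def)
    moreover have "step_prob M Z s t = pmf (Q s) t" if "s \<in> D" for s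
      using st[OF that] step_prob_eq by blast
    ultimately show "((\<lambda>s. pmf \<mu> s * pmf (Q s) t) has_sum pmf \<mu> t) D"
      by (subst (asm) has_sum_cong) auto
  qed
  interpret L: coupled_chain_inv M "\<lambda>k \<omega>. Y (k + 2) \<omega>" "iter_kernel Q" S \<kappa> "\<lambda>s. ty (fst s)" R B \<mu>
  proof unfold_locales
    show "(\<lambda>\<omega>. Y (k + 2) \<omega>) \<in> measurable M (count_space UNIV)" for k by (rule Y_measurable)
    have "(\<lambda>\<omega>. Y (k + 2) \<omega>) ` space M \<subseteq> \<Psi> ` lists W" for k using IP_lists by (auto simp: H_def)
    moreover have "countable (\<Psi> ` lists W)" using countable_W by blast
    ultimately show "countable ((\<lambda>\<omega>. Y (k + 2) \<omega>) ` space M)" for k by (rule countable_subset)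
    show "AE \<omega> in M. Y (k + 2) \<omega> \<in> S" for k
      using AE_H_hists by eventually_elim (use \<Psi>_S[of _ "k + 2"] in auto)
    show "prob {\<omega> \<in> space M. Y (j + 2) \<omega> = s \<and> Y (j + m + 2) \<omega> = t} =
        prob {\<omega> \<in> space M. Y (j + 2) \<omega> = s} * pmf (iter_kernel Q m s) t" for j m s t
      using prob_Y_Y[of "j + 2" s m t] by (simp add: add.assoc add.commute[of m])
    show "iter_kernel Q m s = iter_kernel Q m s'"
      if "s \<in> S" "s' \<in> S" "ty (fst s) = ty (fst s')" "\<kappa> s < m" "\<kappa> s' < m" for m s s'
      by (rule forget[OF that])
    show "1 < R" "0 \<le> B" by (rule R, rule B)
    show "(\<integral>\<^sup>+\<omega>. ennreal (R ^ \<kappa> (Y (k + 2) \<omega>)) \<partial>M) \<le> ennreal B" for k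
    proof -
      have "(\<integral>\<^sup>+\<omega>. ennreal (R ^ \<kappa> (Y (k + 2) \<omega>)) \<partial>M) = (\<integral>\<^sup>+\<omega>. ennreal (R ^ \<kappa> (Z (k + 2) \<omega>)) \<partial>M)"
        by (intro nn_integral_cong_AE eventually_mono[OF Z_\<Psi>]) simp
      then show ?thesis using moments[of "k + 2"] by simp
    qed
    show "set_pmf \<mu> \<subseteq> S" using \<mu>D DS by blast
    show "bind_pmf \<mu> (iter_kernel Q m) = \<mu>" for m
    proof (induction m)
      case 0
      have "iter_kernel Q 0 = return_pmf" by (intro ext) simp
      then show ?case by (simp add: bind_return_pmf')
    next
      case (Suc m)
      have "iter_kernel Q (Suc m) = (\<lambda>s. bind_pmf (Q s) (iter_kernel Q m))" by (intro ext) simp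
      then have "bind_pmf \<mu> (iter_kernel Q (Suc m)) = bind_pmf (bind_pmf \<mu> Q) (iter_kernel Q m)"
        by (simp only: bind_assoc_pmf)
      then show ?case by (simp only: Suc b)
    qed
    show "measure_pmf.prob \<mu> {s. ty (fst s) = 1} = 1 / 2" by (rule invariant_half[OF b])
    show "ty (fst s) \<in> {1, 2}" for s :: "'a \<times> 'b" by (rule ty_12(1))
    show "AE \<omega> in M. ty (fst (Y (Suc k + 2) \<omega>)) = 3 - ty (fst (Y (k + 2) \<omega>))" for k
      using AE_nice
    proof eventually_elim
      case (elim \<omega>)
      obtain a where a: "a \<in> blocks (opp (hist (\<lambda>n. X n \<omega>) (k + 2)))"
        "hist (\<lambda>n. X n \<omega>) (Suc (k + 2)) = ext (hist (\<lambda>n. X n \<omega>) (k + 2)) a"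
        using hist_Suc[OF elim, of "k + 2"] by auto
      then have e: "H (Suc (k + 2)) \<omega> = ext (H (k + 2) \<omega>) a" "a \<in> blocks (opp (H (k + 2) \<omega>))"
        by (simp_all only: H_hist)
      have "wty (last (ext (H (k + 2) \<omega>) a)) = opp (H (k + 2) \<omega>)"
        using opp_ext[OF e(2)] ty_12(2)[of "last (ext (H (k + 2) \<omega>) a)"] ty_12(2)[of "last (H (k + 2) \<omega>)"]
        by auto
      then show ?case using e(1) by (simp add: fst_\<Psi> wty_def)
    qed
  qed
  show "integrable (measure_pmf \<mu>) h" by (rule L.ergodic(1)[OF r C h])
  have "AE \<omega> in M. (\<lambda>n. (\<Sum>k<n. h (Y (k + 2) \<omega>)) / real n) \<longlonglongrightarrow> Ep \<mu> h"
    by (rule L.ergodic(2)[OF r C h])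
  with Z_\<Psi> show "AE \<omega> in M. (\<lambda>n. (\<Sum>k<n. h (Z (k + 2) \<omega>)) / real n) \<longlonglongrightarrow> Ep \<mu> h"
    by eventually_elim simp
qed

end

context transient_walk
begin

lemma path_functional_measurable:
  "(\<lambda>\<omega>. G (IP (E k \<omega>) \<omega>) (X (E m \<omega>) \<omega>)) \<in> measurable M (count_space UNIV)"
proof (rule measurable_compose_countable[OF _ E_measurable[of m]])
  fix n'
  show "(\<lambda>\<omega>. G (IP (E k \<omega>) \<omega>) (X n' \<omega>)) \<in> measurable M (count_space UNIV)"
  proof (rule measurable_compose_countable[OF _ E_measurable[of k]])
    fix n
    have "IP n \<omega> = take (Suc n) (IP (n + n') \<omega>)" "X n' \<omega> = IP (n + n') \<omega> ! n'" for \<omega>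
      unfolding IP_def using initial_path_append[of n "n + n'" "\<lambda>m. X m \<omega>"]
        nth_initial_path[of n' "n + n'" "\<lambda>m. X m \<omega>"] by simp_all
    then show "(\<lambda>\<omega>. G (IP n \<omega>) (X n' \<omega>)) \<in> measurable M (count_space UNIV)"
      using measurable_compose[OF IP_measurable[of "n + n'"], of "\<lambda>h. G (take (Suc n) h) (h ! n')" "count_space UNIV"]
      by simp
  qed
qed

lemma WPsi_measurable: "WPsi V rt X k \<in> measurable M (count_space UNIV)"
proof -
  define F where "F h c = (last (last h),
      if k = 1 then restrict_path h (VS (the (word_type V rt (last h))))
      else unshift c (restrict_path h (cn c)))" for h c
  have "WPsi V rt X k = (\<lambda>\<omega>. F (IP (E k \<omega>) \<omega>) (X (E (k - 1) \<omega>) \<omega>))"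
    by (rule ext) (simp add: F_def WPsi_def last_letter_def entry_point_def psi_def E_def IP_def Let_def)
  then show ?thesis using path_functional_measurable[of F] by (simp only:)
qed

lemma WInc_measurable: "WInc V rt X k \<in> measurable M (count_space UNIV)"
proof -
  have "WInc V rt X k = (\<lambda>\<omega>. (\<lambda>i \<omega>. (last (last (H k \<omega>)), length (H k \<omega>) - 1 - i)) (E (k - 1) \<omega>) \<omega>)"
    by (rule ext) (simp add: WInc_def last_letter_def entry_point_def E_def H_def IP_def Let_def)
  moreover have "(\<lambda>\<omega>. (\<lambda>i \<omega>. (last (last (H k \<omega>)), length (H k \<omega>) - 1 - i)) (E (k - 1) \<omega>) \<omega>)
      \<in> measurable M (count_space UNIV)"
  proof (rule measurable_compose_countable[OF _ E_measurable[of "k - 1"]])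
    show "(\<lambda>\<omega>. (last (last (H k \<omega>)), length (H k \<omega>) - 1 - i)) \<in> measurable M (count_space UNIV)" for i
      by (rule H_fun_measurable)
  qed
  ultimately show ?thesis by simp
qed

lemma WInc_inc_of:
  assumes "nice (\<lambda>n. X n \<omega>)" "k \<ge> 1"
  shows "WInc V rt X k \<omega> = inc_of (H k \<omega>)"
proof -
  let ?x = "\<lambda>n. X n \<omega>"
  define e e' where "e = et ?x (k - 1)" and "e' = et ?x k"
  have Suc_k: "Suc (k - 1) = k" using assms(2) by simp
  have H: "H k \<omega> = initial_path ?x e'" by (simp add: H_hist hist_def e'_def)
  have lt: "e < e'" and b: "?x e = butlast (?x e')"
    using entry_time_Suc[OF assms(1), of "k - 1"] Suc_k by (simp_all add: e_def e'_def)
  have "prev_entry (H k \<omega>) = e"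
    unfolding prev_entry_def H last_initial_path b[symmetric]
  proof (rule Least_equality)
    show "\<forall>i. e \<le> i \<and> i < length (initial_path ?x e') \<longrightarrow> initial_path ?x e' ! i \<in> cn (?x e)"
      using entry_stays[OF assms(1), of "k - 1"] by (simp add: nth_initial_path e_def less_Suc_eq_le)
    fix l assume l: "\<forall>i. l \<le> i \<and> i < length (initial_path ?x e') \<longrightarrow> initial_path ?x e' ! i \<in> cn (?x e)"
    show "e \<le> l"
    proof (rule ccontr)
      assume "\<not> e \<le> l"
      then have le: "l \<le> e - 1" "e \<ge> 1" by auto
      then have k1: "k - 1 \<ge> 1" by (cases "k - 1 = 0") (auto simp: e_def entry_time_0)
      have "e - 1 < length (initial_path ?x e')" using lt by simp
      then have "initial_path ?x e' ! (e - 1) \<in> cn (?x e)" using l le by blast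
      then have "?x (e - 1) \<in> cn (?x e)" using lt nth_initial_path[of "e - 1" e' ?x] by simp
      then show False using entry_from_outside[OF assms(1) k1] by (simp add: e_def)
    qed
  qed
  then show ?thesis using H
    by (simp add: WInc_def inc_of_def last_letter_def entry_point_def Let_def e_def e'_def)
qed

sublocale Psi: block_chain V rt p \<alpha> M X psi_of psi_upd
  by unfold_locales (use psi_of_ext in \<open>auto simp: psi_of_def\<close>)

sublocale Inc: block_chain V rt p \<alpha> M X inc_of inc_upd
  by unfold_locales (use inc_of_ext in \<open>auto simp: inc_of_def\<close>)

text \<open>
  A path enters the state after \<open>d\<close> updates only through its vertices of length greater than
  \<open>d\<close>, since each update restricts it to a cone of the next level.
\<close>

definition deep_eq :: "nat \<Rightarrow> 'a \<times> 'a list list \<Rightarrow> 'a \<times> 'a list list \<Rightarrow> bool" where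
  "deep_eq d s s' \<longleftrightarrow> fst s = fst s' \<and> (\<exists>u u' v. snd s = remdups_adj (u @ v) \<and>
     snd s' = remdups_adj (u' @ v) \<and> (\<forall>w\<in>set u \<union> set u'. length w \<le> d))"

lemma psi_upd_remdups_adj:
  "psi_upd (g, remdups_adj l) a = psi_upd (g, l) a"
proof -
  let ?P = "\<lambda>w. w \<in> cn [g]"
  have u: "unshift [g] (remdups_adj (filter ?P l)) = remdups_adj (unshift [g] (filter ?P l))" for l
    by (rule unshift_remdups_adj) (auto simp: cone_def)
  have "remdups_adj (unshift [g] (filter ?P (remdups_adj l)) @ a) =
      remdups_adj (unshift [g] (remdups_adj (filter ?P (remdups_adj l))) @ a)"
    by (simp add: u remdups_adj_remdups_adj_append)
  also have "\<dots> = remdups_adj (unshift [g] (filter ?P l) @ a)"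
    by (simp add: remdups_adj_filter_remdups_adj u remdups_adj_remdups_adj_append)
  finally show ?thesis by (simp add: psi_upd_def)
qed

lemma deep_eq_upd:
  assumes "deep_eq (Suc d) s s'"
  shows "deep_eq d (psi_upd s a) (psi_upd s' a)"
proof -
  obtain g u u' v where s: "s = (g, remdups_adj (u @ v))" "s' = (g, remdups_adj (u' @ v))"
    and len: "\<forall>w\<in>set u \<union> set u'. length w \<le> Suc d"
    using assms unfolding deep_eq_def by (cases s; cases s') auto
  let ?f = "\<lambda>l. unshift [g] (filter (\<lambda>w. w \<in> cn [g]) l)"
  have "psi_upd s a = (last (last a), remdups_adj (?f u @ (?f v @ a)))"
    "psi_upd s' a = (last (last a), remdups_adj (?f u' @ (?f v @ a)))"
    unfolding s psi_upd_remdups_adj by (simp_all add: psi_upd_def unshift_def)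
  moreover have "length w \<le> d" if w: "w \<in> set (?f u) \<union> set (?f u')" for w
  proof -
    obtain w' where "w' \<in> set u \<union> set u'" "w = drop 1 w'" using w by (auto simp: unshift_def)
    then show ?thesis using bspec[OF len, of w'] by simp
  qed
  ultimately show ?thesis
    unfolding deep_eq_def by (intro conjI exI[of _ "?f u"] exI[of _ "?f u'"] exI[of _ "?f v @ a"]) auto
qed

lemma deep_eq_0:
  assumes "deep_eq 0 s s'"
  shows "psi_upd s a = psi_upd s' a"
proof -
  obtain g u u' v where s: "s = (g, remdups_adj (u @ v))" "s' = (g, remdups_adj (u' @ v))"
    and len: "\<forall>w\<in>set u \<union> set u'. length w \<le> 0"
    using assms unfolding deep_eq_def by (cases s; cases s') auto
  have "filter (\<lambda>w. w \<in> cn [g]) u = []" "filter (\<lambda>w. w \<in> cn [g]) u' = []"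
    using len by (auto simp: filter_empty_conv cone_def)
  then show ?thesis unfolding s psi_upd_remdups_adj by (simp add: psi_upd_def)
qed

lemma iter_kernel_deep_eq:
  "deep_eq d s s' \<Longrightarrow> d < m \<Longrightarrow> iter_kernel Psi.Q m s = iter_kernel Psi.Q m s'"
proof (induction d arbitrary: m s s')
  case 0
  then obtain m' where m: "m = Suc m'" by (cases m) auto
  have "psi_upd s = psi_upd s'" using deep_eq_0[OF 0(1)] by (rule ext)
  moreover have "fst s = fst s'" using 0 by (simp add: deep_eq_def)
  ultimately show ?case by (simp add: m Psi.Q_def[of s] Psi.Q_def[of s'])
next
  case (Suc d)
  then obtain m' where m: "m = Suc m'" "d < m'" by (cases m) auto
  have f: "fst s = fst s'" using Suc by (simp add: deep_eq_def)
  have "iter_kernel Psi.Q m' (psi_upd s a) = iter_kernel Psi.Q m' (psi_upd s' a)" for a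
    using Suc.IH[OF deep_eq_upd[OF Suc.prems(1)] m(2)] .
  then show ?case by (simp add: m Psi.Q_def[of s] Psi.Q_def[of s'] f bind_map_pmf)
qed

lemma psi_states_length:
  assumes "s \<in> psi_states" "w \<in> set (snd s)"
  shows "length w \<le> path_length (snd s)"
  using assms P_pos_length unfolding psi_states_def fp_paths_def
  by (auto intro!: path_word_length_le[where E = adm])

lemma psi_states_path_length: "s \<in> psi_states \<Longrightarrow> path_length (snd s) \<ge> 1"
proof -
  assume "s \<in> psi_states"
  then obtain g \<phi> where s: "s = (g, \<phi>)" "\<phi> \<noteq> []" "hd \<phi> = []" "last \<phi> = [g]"
    by (auto simp: psi_states_def fp_paths_def)
  then show ?thesis by (cases \<phi> rule: list.exhaust; cases "tl \<phi>") (auto simp: path_length_def split: if_splits)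
qed

lemma psi_forget:
  assumes s: "s \<in> psi_states" "s' \<in> psi_states" "ty (fst s) = ty (fst s')"
    and m: "path_length (snd s) < m" "path_length (snd s') < m"
  shows "iter_kernel Psi.Q m s = iter_kernel Psi.Q m s'"
proof -
  define d where "d = max (path_length (snd s)) (path_length (snd s')) - 1"
  obtain m' where m': "m = Suc m'" "d < m'"
    using m psi_states_path_length[OF s(1)] by (cases m) (auto simp: d_def)
  have "deep_eq d (psi_upd s a) (psi_upd s' a)" for a
  proof -
    let ?f = "\<lambda>s. unshift [fst s] (filter (\<lambda>w. w \<in> cn [fst s]) (snd s))"
    have "length w \<le> d" if "w \<in> set (?f s) \<union> set (?f s')" for w
    proof -
      have *: "length w \<le> path_length (snd t) - 1" if t: "t \<in> psi_states" "w \<in> set (?f t)" for t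
      proof -
        obtain w' where "w' \<in> set (snd t)" "w' \<in> cn [fst t]" "w = drop 1 w'"
          using t by (auto simp: unshift_def)
        then show ?thesis using psi_states_length[OF t(1), of w'] by auto
      qed
      show ?thesis using that *[OF s(1)] *[OF s(2)] by (auto simp: d_def)
    qed
    then show ?thesis unfolding deep_eq_def psi_upd_def
      by (intro conjI exI[of _ "?f s"] exI[of _ "?f s'"] exI[of _ a]) auto
  qed
  then have "iter_kernel Psi.Q m' (psi_upd s a) = iter_kernel Psi.Q m' (psi_upd s' a)" for a
    using iter_kernel_deep_eq m'(2) by blast
  then show ?thesis by (simp add: m' Psi.Q_def[of s] Psi.Q_def[of s'] s(3) bind_map_pmf)
qed

lemma inc_forget:
  assumes "ty (fst s) = ty (fst s')" "m \<ge> 1"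
  shows "iter_kernel Inc.Q m s = iter_kernel Inc.Q m s'"
proof -
  obtain m' where m: "m = Suc m'" using assms(2) by (cases m) auto
  have "inc_upd s = inc_upd s'" by (intro ext) (simp add: inc_upd_def)
  then show ?thesis by (simp add: m Inc.Q_def[of s] Inc.Q_def[of s'] assms(1))
qed

end

locale moment_walk = transient_walk V rt p \<alpha> M X
  for V :: "nat \<Rightarrow> 'a set" and rt p \<alpha> and M :: "'w measure" and X +
  fixes \<R> :: real
  assumes R1: "\<R> > 1"
    and moment_sup: "(SUP k\<in>{1..}. \<integral>\<^sup>+\<omega>. ennreal (\<R> ^ path_length (psi V rt (\<lambda>m. X m \<omega>) k)) \<partial>M) < \<infinity>"
begin

definition B :: real where
  "B = enn2real (SUP k\<in>{1..}. \<integral>\<^sup>+\<omega>. ennreal (\<R> ^ path_length (psi V rt (\<lambda>m. X m \<omega>) k)) \<partial>M)"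

lemma psi_moment:
  assumes "k \<ge> 1"
  shows "(\<integral>\<^sup>+\<omega>. ennreal (\<R> ^ path_length (snd (WPsi V rt X k \<omega>))) \<partial>M) \<le> ennreal B"
proof -
  have "(\<integral>\<^sup>+\<omega>. ennreal (\<R> ^ path_length (snd (WPsi V rt X k \<omega>))) \<partial>M) \<le>
      (SUP k\<in>{1..}. \<integral>\<^sup>+\<omega>. ennreal (\<R> ^ path_length (psi V rt (\<lambda>m. X m \<omega>) k)) \<partial>M)"
    using assms by (intro SUP_upper2[of k]) (auto simp: WPsi_def Let_def)
  also have "\<dots> = ennreal B" unfolding B_def using moment_sup by (simp add: less_top)
  finally show ?thesis .
qed

text \<open>The increments are bounded by the path lengths, as the new part of \<open>\<psi>\<^sub>k\<close> is not shortened.\<close>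

lemma inc_le_psi:
  assumes "nice (\<lambda>n. X n \<omega>)" "k \<ge> 2"
  shows "snd (WInc V rt X k \<omega>) \<le> path_length (snd (WPsi V rt X k \<omega>))"
proof -
  define j where "j = k - 1"
  have j: "k = Suc j" "j \<ge> 1" using assms(2) by (auto simp: j_def)
  obtain a where a: "a \<in> blocks (opp (H j \<omega>))" "H (Suc j) \<omega> = ext (H j \<omega>) a"
    using hist_Suc[OF assms(1) j(2)] unfolding H_hist by blast
  have h: "H j \<omega> \<in> hists j" using hist_in_hists[OF assms(1) j(2)] by (simp add: H_hist)
  have "snd (WInc V rt X k \<omega>) = length a - 1"
    using WInc_inc_of[OF assms(1), of k] j a inc_of_ext[OF h j(2) a(1)] by (simp add: inc_upd_def)
  moreover have "snd (WPsi V rt X k \<omega>) = unshift (last (H j \<omega>)) (restrict_path (H j \<omega>) (cn (last (H j \<omega>)))) @ tl a"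
    using WPsi_psi_of[OF assms(1), of k] j a psi_of_ext_snd(1)[OF h j(2) a(1)] by simp
  ultimately show ?thesis using psi_of_ext_snd(3)[OF h j(2) a(1)]
    by (cases "unshift (last (H j \<omega>)) (restrict_path (H j \<omega>) (cn (last (H j \<omega>))))") (auto simp: path_length_def)
qed

sublocale Psi: sized_block_chain V rt p \<alpha> M X psi_of psi_upd psi_states "\<lambda>s. path_length (snd s)" \<R> B "WPsi V rt X"
proof unfold_locales
  show "fst (psi_upd s a) = last (last a)" for s a by (simp add: psi_upd_def)
  show "psi_of h \<in> psi_states" if "h \<in> hists k" "k \<ge> 1" for h k by (rule psi_of_states[OF that])
  show "WPsi V rt X k \<in> measurable M (count_space UNIV)" for k by (rule WPsi_measurable)
  show "AE \<omega> in M. \<forall>k\<ge>1. WPsi V rt X k \<omega> = psi_of (H k \<omega>)"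
    using AE_nice by eventually_elim (use WPsi_psi_of in blast)
  show "iter_kernel Psi.Q m s = iter_kernel Psi.Q m s'"
    if "s \<in> psi_states" "s' \<in> psi_states" "ty (fst s) = ty (fst s')"
      "path_length (snd s) < m" "path_length (snd s') < m" for m s s'
    by (rule psi_forget[OF that])
  show "(\<integral>\<^sup>+\<omega>. ennreal (\<R> ^ path_length (snd (WPsi V rt X k \<omega>))) \<partial>M) \<le> ennreal B" if "2 \<le> k" for k
    using psi_moment[of k] that by simp
qed (simp_all add: R1 B_def)

sublocale Inc: sized_block_chain V rt p \<alpha> M X inc_of inc_upd inc_states snd \<R> B "WInc V rt X"
proof unfold_locales
  show "fst (inc_upd s a) = last (last a)" for s a by (simp add: inc_upd_def)
  show "inc_of h \<in> inc_states" if "h \<in> hists k" "k \<ge> 1" for h k by (rule inc_of_states[OF that])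
  show "WInc V rt X k \<in> measurable M (count_space UNIV)" for k by (rule WInc_measurable)
  show "AE \<omega> in M. \<forall>k\<ge>1. WInc V rt X k \<omega> = inc_of (H k \<omega>)"
    using AE_nice by eventually_elim (use WInc_inc_of in blast)
  show "iter_kernel Inc.Q m s = iter_kernel Inc.Q m s'"
    if "s \<in> inc_states" "s' \<in> inc_states" "ty (fst s) = ty (fst s')" "snd s < m" "snd s' < m" for m s s'
    by (rule inc_forget) (use that in auto)
  show "(\<integral>\<^sup>+\<omega>. ennreal (\<R> ^ snd (WInc V rt X k \<omega>)) \<partial>M) \<le> ennreal B" if k: "2 \<le> k" for k
  proof -
    have "(\<integral>\<^sup>+\<omega>. ennreal (\<R> ^ snd (WInc V rt X k \<omega>)) \<partial>M) \<le>
        (\<integral>\<^sup>+\<omega>. ennreal (\<R> ^ path_length (snd (WPsi V rt X k \<omega>))) \<partial>M)"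
      by (intro nn_integral_mono_AE eventually_mono[OF AE_nice] ennreal_leI power_increasing inc_le_psi k)
         (use R1 in auto)
    then show ?thesis using psi_moment[of k] k by (meson le_trans one_le_numeral order.trans)
  qed
qed (simp_all add: R1 B_def)

end

section \<open>The limit of a cone-additive function\<close>

lemma pmf_sum_expectation:
  fixes g :: "'s \<Rightarrow> real"
  assumes "set_pmf \<mu> \<subseteq> D" "integrable (measure_pmf \<mu>) g"
  shows "(\<lambda>s. pmf \<mu> s * g s) summable_on D" "(\<Sum>\<^sub>\<infinity>s\<in>D. pmf \<mu> s * g s) = Ep \<mu> g"
proof -
  let ?f = "\<lambda>s. pmf \<mu> s * g s"
  have "integrable (count_space UNIV) ?f"
    using assms(2) unfolding measure_pmf_eq_density by (subst (asm) integrable_density) auto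
  then have U: "Infinite_Set_Sum.abs_summable_on ?f UNIV" by (simp add: Infinite_Set_Sum.abs_summable_on_def)
  then have a: "Infinite_Set_Sum.abs_summable_on ?f D" by (rule abs_summable_on_subset) simp
  show "?f summable_on D"
    by (rule abs_summable_summable[OF iffD2[OF abs_summable_equivalent a]])
  have "infsum ?f D = infsetsum ?f D" by (rule infsetsum_infsum[OF a, symmetric])
  also have "\<dots> = infsetsum ?f UNIV"
    using assms(1) by (intro infsetsum_cong_neutral) (auto simp: set_pmf_iff)
  also have "\<dots> = Ep \<mu> g" by (rule pmf_expectation_eq_infsetsum[symmetric])
  finally show "infsum ?f D = Ep \<mu> g" .
qed

text \<open>
  A renewal argument for one trajectory: if \<open>e (k + 1) / k\<close> converges to \<open>c\<close>, then the number of
  completed blocks up to time \<open>n\<close> is asymptotically \<open>n / c\<close>, and the unfinished block is negligible.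
\<close>

lemma renewal_limit:
  fixes e :: "nat \<Rightarrow> nat" and a b g F :: "nat \<Rightarrow> real"
  assumes e: "strict_mono e" and c: "c > 0"
    and lim_e: "(\<lambda>k. (real (e (k + 1)) - real (e 1)) / real k) \<longlonglongrightarrow> c"
    and lim_a: "(\<lambda>k. (\<Sum>i<k. a (i + 2)) / real k) \<longlonglongrightarrow> A"
    and lim_g: "(\<lambda>k. g (k + 2) / real k) \<longlonglongrightarrow> 0"
    and F: "\<And>n. n \<ge> 1 \<Longrightarrow> F n = (\<Sum>j = 1..Max {k. e k \<le> n}. a j) + b n"
    and b: "\<And>n. n \<ge> e 1 \<Longrightarrow> \<bar>b n\<bar> \<le> g (Max {k. e k \<le> n} + 1)"
  shows "(\<lambda>n. F n / real n) \<longlonglongrightarrow> A / c" "(\<lambda>k. real k / real (e k)) \<longlonglongrightarrow> 1 / c"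
proof -
  have inv: "(\<lambda>k. x / real k) \<longlonglongrightarrow> 0" for x :: real by (rule lim_const_over_n)
  have "(\<lambda>k. (real (e (k + 1)) - real (e 1)) / real k + real (e 1) / real k) \<longlonglongrightarrow> c + 0"
    by (intro tendsto_add lim_e inv)
  then have e1: "(\<lambda>k. real (e (k + 1)) / real k) \<longlonglongrightarrow> c" by (simp add: diff_divide_distrib)
  have Sk: "(\<lambda>k. real (Suc k) / real k) \<longlonglongrightarrow> 1" by (rule LIMSEQ_Suc_n_over_n)
  have "(\<lambda>k. real (e (Suc k + 1)) / real (Suc k) * (real (Suc k) / real k)) \<longlonglongrightarrow> c * 1"
    by (intro tendsto_mult Sk LIMSEQ_Suc[OF e1])
  then have e2: "(\<lambda>k. real (e (k + 2)) / real k) \<longlonglongrightarrow> c" by simp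
  have "(\<lambda>k. real (Suc k) / real k / (real (e (k + 1)) / real k)) \<longlonglongrightarrow> 1 / c"
    by (intro tendsto_divide Sk e1) (use c in simp)
  moreover have "eventually (\<lambda>k. real (Suc k) / real k / (real (e (k + 1)) / real k) = real (Suc k) / real (e (Suc k))) sequentially"
    using eventually_gt_at_top[of 0] by eventually_elim simp
  ultimately have "(\<lambda>k. real (Suc k) / real (e (Suc k))) \<longlonglongrightarrow> 1 / c" by (rule Lim_transform_eventually)
  then show "(\<lambda>k. real k / real (e k)) \<longlonglongrightarrow> 1 / c" by (rule LIMSEQ_imp_Suc)
  define m where "m n = Max {k. e k \<le> n}" for n
  define K where "K n = m n - 1" for n
  have fin: "finite {k. e k \<le> n}" for n
    by (rule finite_subset[of _ "{..n}"]) (use strict_mono_imp_increasing[OF e] order.trans in auto)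
  have m: "e (m n) \<le> n" "n < e (m n + 1)" "m n \<ge> k" if "n \<ge> e 1" "n \<ge> e k" for n k
  proof -
    have "m n \<in> {k. e k \<le> n}" unfolding m_def using that fin by (intro Max_in) auto
    then show "e (m n) \<le> n" by simp
    show "n < e (m n + 1)"
    proof (rule ccontr)
      assume "\<not> ?thesis"
      then have "m n + 1 \<le> m n" unfolding m_def using fin by (intro Max_ge) auto
      then show False by simp
    qed
    show "m n \<ge> k" unfolding m_def using that fin by (intro Max_ge) auto
  qed
  have Kinf: "filterlim K at_top sequentially"
    unfolding filterlim_at_top
  proof
    fix k
    show "eventually (\<lambda>n. k \<le> K n) sequentially"
      using eventually_ge_at_top[of "e 1 + e (k + 1)"]
    proof eventually_elim
      case (elim n)
      then have "m n \<ge> k + 1" by (intro m(3)) auto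
      then show ?case by (simp add: K_def)
    qed
  qed
  have ev: "eventually (\<lambda>n. n \<ge> e 1 \<and> n \<ge> 1 \<and> K n \<ge> 1) sequentially"
    using eventually_ge_at_top[of "e 1"] eventually_ge_at_top[of 1] filterlim_at_top[THEN iffD1, OF Kinf, rule_format, of 1]
    by eventually_elim auto
  have mK: "m n = K n + 1" if "n \<ge> e 1" for n using m(3)[OF that, of 1] that by (simp add: K_def)
  have nK: "(\<lambda>n. real n / real (K n)) \<longlonglongrightarrow> c"
  proof (rule tendsto_sandwich)
    show "(\<lambda>n. real (e (K n + 1)) / real (K n)) \<longlonglongrightarrow> c" by (rule filterlim_compose[OF e1 Kinf])
    show "(\<lambda>n. real (e (K n + 2)) / real (K n)) \<longlonglongrightarrow> c" by (rule filterlim_compose[OF e2 Kinf])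
    show "eventually (\<lambda>n. real (e (K n + 1)) / real (K n) \<le> real n / real (K n)) sequentially"
      using ev by eventually_elim (use m(1)[of _ 1] mK in \<open>auto intro!: divide_right_mono\<close>)
    show "eventually (\<lambda>n. real n / real (K n) \<le> real (e (K n + 2)) / real (K n)) sequentially"
      using ev
    proof eventually_elim
      case (elim n)
      then have "n < e (K n + 2)" using m(2)[of n 1] mK[of n] by simp
      then show ?case by (intro divide_right_mono) auto
    qed
  qed
  have bK: "(\<lambda>n. b n / real (K n)) \<longlonglongrightarrow> 0"
  proof (rule tendsto_rabs_zero_cancel, rule tendsto_sandwich[OF _ _ tendsto_const])
    show "(\<lambda>n. g (K n + 2) / real (K n)) \<longlonglongrightarrow> 0" by (rule filterlim_compose[OF lim_g Kinf])
    show "eventually (\<lambda>n. \<bar>b n / real (K n)\<bar> \<le> g (K n + 2) / real (K n)) sequentially"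
      using ev by eventually_elim (use b mK in \<open>auto simp: m_def[symmetric] intro!: divide_right_mono\<close>)
  qed simp
  have "(\<lambda>n. (a 1 / real (K n) + (\<Sum>i<K n. a (i + 2)) / real (K n) + b n / real (K n)) / (real n / real (K n)))
      \<longlonglongrightarrow> (0 + A + 0) / c"
    by (intro tendsto_intros nK bK filterlim_compose[OF inv Kinf] filterlim_compose[OF lim_a Kinf]) (use c in simp)
  moreover have "eventually (\<lambda>n. (a 1 / real (K n) + (\<Sum>i<K n. a (i + 2)) / real (K n) + b n / real (K n)) / (real n / real (K n))
      = F n / real n) sequentially"
    using ev
  proof eventually_elim
    case (elim n)
    have "(\<Sum>j = 1..k + 1. a j) = a 1 + (\<Sum>i<k. a (i + 2))" for k by (induction k) auto
    then have "F n = a 1 + (\<Sum>i<K n. a (i + 2)) + b n" using F[of n] elim mK[of n] by (simp add: m_def[symmetric])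
    then show ?case using elim by (simp add: add_divide_distrib[symmetric])
  qed
  ultimately show "(\<lambda>n. F n / real n) \<longlonglongrightarrow> A / c" by (simp add: Lim_transform_eventually)
qed

lemma summand_over_n_null:
  fixes a :: "nat \<Rightarrow> real"
  assumes "(\<lambda>n. (\<Sum>k<n. a k) / real n) \<longlonglongrightarrow> L"
  shows "(\<lambda>n. a n / real n) \<longlonglongrightarrow> 0"
proof -
  have "(\<lambda>n. (\<Sum>k<Suc n. a k) / real (Suc n) * (real (Suc n) / real n) - (\<Sum>k<n. a k) / real n) \<longlonglongrightarrow> L * 1 - L"
    by (intro tendsto_diff tendsto_mult LIMSEQ_Suc[OF assms] LIMSEQ_Suc_n_over_n assms)
  moreover have "(\<Sum>k<Suc n. a k) / real (Suc n) * (real (Suc n) / real n) - (\<Sum>k<n. a k) / real n = a n / real n" for n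
  proof -
    have "x / real (Suc n) * (real (Suc n) / real n) = x / real n" for x
      by (simp del: of_nat_Suc)
    then show ?thesis by (simp only:) (simp add: add_divide_distrib)
  qed
  ultimately show ?thesis by simp
qed

lemma length_remdups_adj_append_le: "length (remdups_adj xs) \<le> length (remdups_adj (xs @ ys))"
proof (induction xs rule: remdups_adj.induct)
  case (2 x)
  then show ?case by (cases ys) (auto simp: remdups_adj_Cons split: list.splits)
qed auto

locale additive_walk = moment_walk V rt p \<alpha> M X \<R>
  for V :: "nat \<Rightarrow> 'a set" and rt p \<alpha> and M :: "'w measure" and X \<R> +
  fixes f :: "'a list list \<Rightarrow> real" and C R\<^sub>f :: real
  assumes additive: "cone_additive V rt M X f"
    and C: "0 < C" and Rf: "0 < R\<^sub>f" "R\<^sub>f < \<R>"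
    and f_bound: "\<And>\<pi>. \<pi> \<in> fp_paths V rt p \<alpha> \<Longrightarrow> \<bar>f \<pi>\<bar> \<le> C * R\<^sub>f ^ path_length \<pi>"
begin

definition r :: real where "r = max R\<^sub>f ((1 + \<R>) / 2)"

lemma r: "1 < r" "r < \<R>" "R\<^sub>f \<le> r" using R1 Rf by (auto simp: r_def max_def field_simps)

lemma f_bound_r:
  assumes "\<pi> \<in> fp_paths V rt p \<alpha>" "path_length \<pi> \<le> n"
  shows "\<bar>f \<pi>\<bar> \<le> C * r ^ n"
proof -
  have "R\<^sub>f ^ path_length \<pi> \<le> r ^ path_length \<pi>" using r Rf by (intro power_mono) auto
  also have "\<dots> \<le> r ^ n" using r assms by (intro power_increasing) auto
  finally have "C * R\<^sub>f ^ path_length \<pi> \<le> C * r ^ n" using C by (intro mult_left_mono) auto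
  then show ?thesis using f_bound[OF assms(1)] by linarith
qed

definition hf :: "'a \<times> 'a list list \<Rightarrow> real" where
  "hf s = f (restrict_path (snd s) (noncone V rt [fst s]))"

lemma hf_bound:
  assumes "s \<in> psi_states"
  shows "\<bar>hf s\<bar> \<le> C * r ^ path_length (snd s)"
proof -
  obtain g \<phi> where s: "s = (g, \<phi>)" "\<phi> \<in> fp_paths V rt p \<alpha>" "last \<phi> = [g]" "g \<in> N 1 \<union> N 2"
    using assms by (auto simp: psi_states_def)
  let ?\<pi> = "restrict_path \<phi> (noncone V rt [g])"
  have \<phi>: "\<phi> \<noteq> []" "set \<phi> \<subseteq> W" "successively adm \<phi>" using s by (auto simp: fp_paths_def)
  have "[g] \<in> set \<phi>" using \<phi>(1) s(3) last_in_set by metis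
  then have "[g] \<in> set ?\<pi>" using \<phi>(2) by (auto simp: set_restrict_path noncone_def)
  then have "?\<pi> \<noteq> []" by force
  moreover have "successively adm ?\<pi>"
    by (rule successively_restrict_path[OF \<phi>(3)]) (use noncone_gate in blast)+
  ultimately have "?\<pi> \<in> fp_paths V rt p \<alpha>" using \<phi>(2) by (auto simp: fp_paths_def set_restrict_path)
  moreover have "path_length ?\<pi> \<le> path_length \<phi>"
    using length_restrict_path_le[of \<phi>] by (simp add: path_length_def diff_le_mono)
  ultimately show ?thesis unfolding hf_def s(1) by (simp add: f_bound_r)
qed

lemma segment_hf:
  assumes x: "nice (\<lambda>n. X n \<omega>)" and k: "k \<ge> 2"
  shows "f (unshift (entry_point V rt (\<lambda>n. X n \<omega>) (k - 1)) (segment V rt (\<lambda>n. X n \<omega>) k)) = hf (WPsi V rt X k \<omega>)"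
proof -
  let ?x = "\<lambda>n. X n \<omega>"
  define h where "h = H k \<omega>"
  have hG: "h \<in> hists k" using hist_in_hists[OF x, of k] k by (simp add: h_def H_hist)
  obtain c g where cg: "last h = c @ [g]" "c \<in> W" "g \<in> N 1 \<union> N 2" "[g] \<in> W" "length c = k - 1"
    using hists_prefix[OF hG] k by (metis one_le_numeral order.trans)
  have c: "c \<noteq> []" using cg(5) k by auto
  have le: "last h = ?x (et ?x k)" by (simp add: h_def H_hist hist_def)
  have Suc_k: "Suc (k - 1) = k" using k by simp
  have be: "c = ?x (et ?x (k - 1))" using entry_time_Suc(2)[OF x, of "k - 1"] le cg(1) Suc_k by (metis butlast_snoc)
  have ih: "initial_path ?x (et ?x k) = h" by (simp add: h_def H_hist hist_def)
  define \<phi> where "\<phi> = unshift c (restrict_path h (cn c))"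
  have L: "restrict_path h (cn c) = map ((@) c) \<phi>"
    unfolding \<phi>_def by (rule map_append_unshift[symmetric]) (auto simp: set_restrict_path cone_def)
  have "segment V rt ?x k = restrict_path (map ((@) c) \<phi>) (noncone V rt (c @ [g]))"
    by (simp only: segment_def entry_point_def ih be[symmetric] le[symmetric] L cg(1))
  also have "\<dots> = map ((@) c) (restrict_path \<phi> {w. c @ w \<in> noncone V rt (c @ [g])})"
    by (rule restrict_path_map_append)
  also have "restrict_path \<phi> {w. c @ w \<in> noncone V rt (c @ [g])} = restrict_path \<phi> (noncone V rt [g])"
  proof (rule restrict_path_cong)
    fix w assume "w \<in> set \<phi>"
    then have "c @ w \<in> set (restrict_path h (cn c))" unfolding L by simp
    then have w: "c @ w \<in> W" "w \<in> W" by (auto simp: set_restrict_path cone_def append_W)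
    have "c @ [g] \<in> W" using hists_last[OF hG] cg by simp
    from cone_append_iff[OF this refl w(1)] w
    show "w \<in> {w. c @ w \<in> noncone V rt (c @ [g])} \<longleftrightarrow> w \<in> noncone V rt [g]"
      by (auto simp: noncone_def)
  qed
  finally have seg: "segment V rt ?x k = map ((@) c) (restrict_path \<phi> (noncone V rt [g]))" .
  have "WPsi V rt X k \<omega> = (g, \<phi>)"
    using WPsi_psi_of[OF x, of k] k cg(1) c by (simp add: psi_of_def h_def[symmetric] \<phi>_def)
  then show ?thesis unfolding seg entry_point_def be[symmetric] by (simp add: hf_def)
qed

lemma final_segment_bound:
  assumes x: "nice (\<lambda>n. X n \<omega>)" and n: "n \<ge> et (\<lambda>n. X n \<omega>) 1"
  shows "\<bar>f (final_segment V rt (\<lambda>n. X n \<omega>) n)\<bar> \<le>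
    C * r ^ path_length (snd (WPsi V rt X (last_entry V rt (\<lambda>n. X n \<omega>) n + 1) \<omega>))"
proof -
  let ?x = "\<lambda>n. X n \<omega>"
  define k where "k = last_entry V rt ?x n"
  let ?S = "{k. et ?x k \<le> n}"
  have fin: "finite ?S"
    by (rule finite_subset[of _ "{..n}"]) (use strict_mono_imp_increasing[OF entry_mono[OF x]] order.trans in auto)
  have "k \<in> ?S" unfolding k_def last_entry_def using n fin by (intro Max_in) auto
  then have ek: "et ?x k \<le> n" by simp
  have k1: "k \<ge> 1" unfolding k_def last_entry_def using n fin by (intro Max_ge) auto
  have ek1: "n \<le> et ?x (k + 1)"
  proof (rule ccontr)
    assume "\<not> ?thesis"
    then have "k + 1 \<le> k" unfolding k_def last_entry_def using fin by (intro Max_ge) auto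
    then show False by simp
  qed
  define c where "c = ?x (et ?x k)"
  let ?\<pi> = "restrict_path (initial_path ?x n) (cn c)"
  have fs: "final_segment V rt ?x n = ?\<pi>" by (simp add: final_segment_def entry_point_def k_def c_def)
  have "c \<in> set (initial_path ?x n)" using ek by (auto simp: initial_path_def c_def simp del: upt_Suc)
  then have "c \<in> set ?\<pi>" using cone_refl[OF nice_W[OF x]] by (simp add: set_restrict_path c_def)
  then have "?\<pi> \<noteq> []" by force
  moreover have "successively adm ?\<pi>"
    by (rule successively_restrict_path[OF successively_initial_path[OF x]]) (use cone_gate in blast)+
  ultimately have "?\<pi> \<in> fp_paths V rt p \<alpha>" by (auto simp: fp_paths_def set_restrict_path cone_def)
  moreover have "path_length ?\<pi> \<le> path_length (snd (WPsi V rt X (k + 1) \<omega>))"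
  proof -
    have "length ?\<pi> \<le> length (restrict_path (initial_path ?x (et ?x (k + 1))) (cn c))"
      unfolding initial_path_append[OF ek1, of ?x] restrict_path_def filter_append
      by (rule length_remdups_adj_append_le)
    also have "\<dots> = length (snd (WPsi V rt X (k + 1) \<omega>))"
      using k1 by (simp add: WPsi_def psi_def Let_def entry_point_def unshift_def c_def)
    finally show ?thesis by (simp add: path_length_def diff_le_mono)
  qed
  ultimately show ?thesis unfolding fs k_def by (rule f_bound_r)
qed

lemma limits:
  assumes D: "D = states_at M (WPsi V rt X) 1" and \<rho>: "invariant_distribution M (WPsi V rt X) D \<rho>"
    and D0: "D\<^sub>0 = (\<Union>k\<in>{1..}. states_at M (WInc V rt X) k)" and \<sigma>: "invariant_distribution M (WInc V rt X) D\<^sub>0 \<sigma>"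
  shows "integrable (measure_pmf \<rho>) hf" "integrable (measure_pmf \<sigma>) (\<lambda>s. real (snd s))"
    "Ep \<sigma> (\<lambda>s. real (snd s)) > 0"
    "AE \<omega> in M. (\<lambda>n. f (initial_path (\<lambda>m. X m \<omega>) n) / real n) \<longlonglongrightarrow> Ep \<rho> hf / Ep \<sigma> (\<lambda>s. real (snd s))"
    "AE \<omega> in M. (\<lambda>n. real (length (X n \<omega>)) / real n) \<longlonglongrightarrow> l \<Longrightarrow> l = 1 / Ep \<sigma> (\<lambda>s. real (snd s))"
proof -
  let ?c = "Ep \<sigma> (\<lambda>s. real (snd s))"
  have D': "D \<subseteq> (\<Union>k\<in>{1..}. states_at M (WPsi V rt X) k)" using D by auto
  note psi = Psi.ergodic_chain[OF D' \<rho> r(1,2) C]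
  show irho: "integrable (measure_pmf \<rho>) hf" by (rule psi(1)) (rule hf_bound)
  have A: "AE \<omega> in M. (\<lambda>n. (\<Sum>k<n. hf (WPsi V rt X (k + 2) \<omega>)) / real n) \<longlonglongrightarrow> Ep \<rho> hf"
    by (rule psi(2)) (rule hf_bound)
  define G where "G s = C * r ^ path_length (snd s)" for s :: "'a \<times> 'a list list"
  have "AE \<omega> in M. (\<lambda>n. (\<Sum>k<n. G (WPsi V rt X (k + 2) \<omega>)) / real n) \<longlonglongrightarrow> Ep \<rho> G"
    by (rule psi(2)) (use C r in \<open>auto simp: G_def abs_mult\<close>)
  then have G: "AE \<omega> in M. (\<lambda>n. G (WPsi V rt X (n + 2) \<omega>) / real n) \<longlonglongrightarrow> 0"
    by eventually_elim (rule summand_over_n_null)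
  have D0': "D\<^sub>0 \<subseteq> (\<Union>k\<in>{1..}. states_at M (WInc V rt X) k)" using D0 by simp
  define Ci where "Ci = 1 / (r - 1)"
  have Ci: "Ci > 0" using r by (simp add: Ci_def)
  have lin: "\<bar>real (snd s)\<bar> \<le> Ci * r ^ snd s" for s :: "'a \<times> nat"
  proof -
    have "1 + real (snd s) * (r - 1) \<le> (1 + (r - 1)) ^ snd s" using r by (intro Bernoulli_inequality) auto
    then show ?thesis using r by (simp add: Ci_def field_simps)
  qed
  note inc = Inc.ergodic_chain[OF D0' \<sigma> r(1,2) Ci]
  show isig: "integrable (measure_pmf \<sigma>) (\<lambda>s. real (snd s))" by (rule inc(1)) (rule lin)
  have I: "AE \<omega> in M. (\<lambda>n. (\<Sum>k<n. real (snd (WInc V rt X (k + 2) \<omega>))) / real n) \<longlonglongrightarrow> ?c"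
    by (rule inc(2)) (rule lin)
  show cpos: "?c > 0"
  proof -
    have "set_pmf \<sigma> \<subseteq> inc_states"
      using \<sigma> D0 Inc.states_S unfolding invariant_distribution_def by blast
    then have "Ep \<sigma> (\<lambda>_. 1) \<le> ?c" using isig by (intro Ep_mono) (auto simp: inc_states_def)
    then show ?thesis by simp
  qed
  have add1: "AE \<omega> in M. \<forall>n\<ge>1. f (initial_path (\<lambda>m. X m \<omega>) n) =
      (\<Sum>j = 1..last_entry V rt (\<lambda>m. X m \<omega>) n. f (segment V rt (\<lambda>m. X m \<omega>) j)) + f (final_segment V rt (\<lambda>m. X m \<omega>) n)"
    using additive by (simp add: cone_additive_def Let_def AE_all_countable)
  have add2: "AE \<omega> in M. \<forall>j\<ge>1. f (segment V rt (\<lambda>m. X m \<omega>) j) =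
      f (unshift (entry_point V rt (\<lambda>m. X m \<omega>) (j - 1)) (segment V rt (\<lambda>m. X m \<omega>) j))"
    using additive by (simp add: cone_additive_def Let_def AE_all_countable)
  have both: "AE \<omega> in M. (\<lambda>n. f (initial_path (\<lambda>m. X m \<omega>) n) / real n) \<longlonglongrightarrow> Ep \<rho> hf / ?c \<and>
      nice (\<lambda>n. X n \<omega>) \<and> (\<lambda>k. real k / real (et (\<lambda>n. X n \<omega>) k)) \<longlonglongrightarrow> 1 / ?c"
    using AE_nice A G I add1 add2
  proof eventually_elim
    case (elim \<omega>)
    let ?x = "\<lambda>n. X n \<omega>"
    note x = elim(1)
    have seg: "f (segment V rt ?x (i + 2)) = hf (WPsi V rt X (i + 2) \<omega>)" for i
      using elim(6)[rule_format, of "i + 2"] segment_hf[OF x, of "i + 2"] by simp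
    have "(\<Sum>k<n. real (snd (WInc V rt X (k + 2) \<omega>))) = real (et ?x (n + 1)) - real (et ?x 1)" for n
    proof (induction n)
      case (Suc n)
      have "et ?x (n + 1) < et ?x (n + 2)" using entry_time_Suc(1)[OF x, of "n + 1"] by simp
      then show ?case using Suc by (simp add: WInc_def Let_def of_nat_diff)
    qed simp
    then have le: "(\<lambda>k. (real (et ?x (k + 1)) - real (et ?x 1)) / real k) \<longlonglongrightarrow> ?c" using elim(4) by simp
    have la: "(\<lambda>k. (\<Sum>i<k. f (segment V rt ?x (i + 2))) / real k) \<longlonglongrightarrow> Ep \<rho> hf"
      unfolding seg by (rule elim(2))
    have lg: "(\<lambda>k. G (WPsi V rt X (k + 2) \<omega>) / real k) \<longlonglongrightarrow> 0" by (rule elim(3))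
    note ren = renewal_limit[where a = "\<lambda>j. f (segment V rt ?x j)" and b = "\<lambda>n. f (final_segment V rt ?x n)"
        and g = "\<lambda>k. G (WPsi V rt X k \<omega>)" and F = "\<lambda>n. f (initial_path ?x n)", OF entry_mono[OF x] cpos le la lg]
    have F: "f (initial_path ?x n) = (\<Sum>j = 1..Max {k. et ?x k \<le> n}. f (segment V rt ?x j)) + f (final_segment V rt ?x n)"
      if "n \<ge> 1" for n using elim(5) that by (simp add: last_entry_def)
    have b: "\<bar>f (final_segment V rt ?x n)\<bar> \<le> G (WPsi V rt X (Max {k. et ?x k \<le> n} + 1) \<omega>)"
      if "n \<ge> et ?x 1" for n using final_segment_bound[OF x that] by (simp add: G_def last_entry_def)
    show ?case using ren[OF F b] x by blast
  qed
  then show "AE \<omega> in M. (\<lambda>n. f (initial_path (\<lambda>m. X m \<omega>) n) / real n) \<longlonglongrightarrow> Ep \<rho> hf / ?c"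
    by eventually_elim blast
  show "l = 1 / ?c" if l: "AE \<omega> in M. (\<lambda>n. real (length (X n \<omega>)) / real n) \<longlonglongrightarrow> l"
  proof -
    from both l have "AE \<omega> in M. l = 1 / ?c"
    proof eventually_elim
      case (elim \<omega>)
      let ?x = "\<lambda>n. X n \<omega>"
      have x: "nice ?x" using elim(1) by blast
      have "filterlim (et ?x) at_top sequentially" by (rule filterlim_subseq[OF entry_mono[OF x]])
      from filterlim_compose[OF elim(2) this]
      have "(\<lambda>k. real k / real (et ?x k)) \<longlonglongrightarrow> l" by (simp add: entry_length[OF x])
      then show ?case using elim(1) LIMSEQ_unique by blast
    qed
    then show ?thesis by simp
  qed
qed

end

theorem corollary3p15:
  fixes V :: "nat \<Rightarrow> 'a set" and rt :: "nat \<Rightarrow> 'a"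
    and p :: "nat \<Rightarrow> 'a \<Rightarrow> 'a \<Rightarrow> real" and \<alpha> :: real
    and M :: "'w measure" and X :: "nat \<Rightarrow> 'w \<Rightarrow> 'a list"
    and f :: "'a list list \<Rightarrow> real" and \<R> C R\<^sub>f l :: real
    and D :: "('a \<times> 'a list list) set" and \<rho> :: "('a \<times> 'a list list) pmf"
    and D\<^sub>0 :: "('a \<times> nat) set" and \<sigma> :: "('a \<times> nat) pmf"
    and E\<^sub>\<rho> E\<^sub>\<sigma> :: real
  assumes "free_product_data V rt p \<alpha>"
    and "prob_space M"
    and "markov_chain_from M (fp_words V rt) (fp_prob V rt p \<alpha>) [] X"
    and "conv_radius (\<lambda>n. \<P>(\<omega> in M. X n \<omega> = [])) > 1"
    and "\<R> > 1"
    and "(SUP k\<in>{1..}. \<integral>\<^sup>+\<omega>. ennreal (\<R> ^ path_length (psi V rt (\<lambda>m. X m \<omega>) k)) \<partial>M) < \<infinity>"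
    and "cone_additive V rt M X f"
    and "0 < C" and "0 < R\<^sub>f" and "R\<^sub>f < \<R>"
    and "\<And>\<pi>. \<pi> \<in> fp_paths V rt p \<alpha> \<Longrightarrow> \<bar>f \<pi>\<bar> \<le> C * R\<^sub>f ^ path_length \<pi>"
    and "D = states_at M (WPsi V rt X) 1"
    and "invariant_distribution M (WPsi V rt X) D \<rho>"
    and "D\<^sub>0 = (\<Union>k\<in>{1..}. states_at M (WInc V rt X) k)"
    and "invariant_distribution M (WInc V rt X) D\<^sub>0 \<sigma>"
    and "AE \<omega> in M. (\<lambda>n. real (length (X n \<omega>)) / real n) \<longlonglongrightarrow> l"
    and "E\<^sub>\<rho> = (\<Sum>\<^sub>\<infinity>(g, \<phi>)\<in>D. pmf \<rho> (g, \<phi>) * f (restrict_path \<phi> (noncone V rt [g])))"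
    and "E\<^sub>\<sigma> = (\<Sum>\<^sub>\<infinity>(g, n)\<in>D\<^sub>0. real n * pmf \<sigma> (g, n))"
  shows "(\<lambda>(g, \<phi>). pmf \<rho> (g, \<phi>) * f (restrict_path \<phi> (noncone V rt [g]))) summable_on D \<and>
    (\<lambda>(g, n). real n * pmf \<sigma> (g, n)) summable_on D\<^sub>0 \<and>
    (AE \<omega> in M. (\<lambda>n. f (initial_path (\<lambda>m. X m \<omega>) n) / real n) \<longlonglongrightarrow> E\<^sub>\<rho> / E\<^sub>\<sigma>) \<and>
    E\<^sub>\<rho> / E\<^sub>\<sigma> = l * E\<^sub>\<rho>"
proof -
  have fpd: "free_product V rt p \<alpha>" using assms(1) by (rule free_product.intro)
  interpret prob_space M by (rule assms(2))
  interpret A: additive_walk V rt p \<alpha> M X \<R> f C R\<^sub>f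
    by (intro additive_walk.intro moment_walk.intro transient_walk.intro free_product_walk.intro fpd assms(2)
        free_product_walk_axioms.intro transient_walk_axioms.intro moment_walk_axioms.intro
        additive_walk_axioms.intro assms)
  note lim = A.limits[OF assms(12-15)]
  have rD: "set_pmf \<rho> \<subseteq> D" "set_pmf \<sigma> \<subseteq> D\<^sub>0" using assms(13,15) by (auto simp: invariant_distribution_def)
  have e1: "(\<lambda>(g, \<phi>). pmf \<rho> (g, \<phi>) * f (restrict_path \<phi> (noncone V rt [g]))) = (\<lambda>s. pmf \<rho> s * A.hf s)"
    by (auto simp: A.hf_def)
  have e2: "(\<lambda>(g, n). real n * pmf \<sigma> (g, n)) = (\<lambda>s. pmf \<sigma> s * real (snd s))"
    by (auto simp: mult.commute)
  note s1 = pmf_sum_expectation[OF rD(1) lim(1)] and s2 = pmf_sum_expectation[OF rD(2) lim(2)]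
  have E: "E\<^sub>\<rho> = measure_pmf.expectation \<rho> A.hf" "E\<^sub>\<sigma> = measure_pmf.expectation \<sigma> (\<lambda>s. real (snd s))"
    using assms(17,18) s1(2) s2(2) unfolding e1 e2 by simp_all
  have l: "l = 1 / E\<^sub>\<sigma>" using lim(5)[OF assms(16)] E by simp
  show ?thesis
    unfolding e1 e2 E(1,2)[symmetric]
    using s1(1) s2(1) lim(4) l by (simp add: E[symmetric])
qed

end
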